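(* Let $p\ge1$. For arbitrary $0<\varepsilon<\frac12$ and arbitrary points $\nu_1,\nu_2,\ldots,\nu_p\in(-2,2)$ there exists an operator $D\in\mathcal{P}_p(\frac12-\varepsilon)$ such that its discrete spectrum $\sigma_{\rm d}(D)$ is infinite and, moreover, $$E_D=\{\nu_1,\nu_2,\ldots,\nu_p\}.$$
   Context: A complex matrix $D=\|d_{ij}\|_{i,j=1}^\infty$ is called banded of order $p$ ($p$-banded) if $d_{ij}=0$ for $|i-j|>p$ and $d_{ij}\ne0$ for $|i-j|=p$. By convention, for indices with $\min(i,j)\le 0$ one sets $d_{ij}=1$ if $|i-j|=p$ and $d_{ij}=0$ if $|i-j|\neq p$. For $0<\beta<1$, a $p$-banded matrix $D$ belongs to the class $\mathcal{P}_p(\beta)$ if there are constants $C_1,C_2>0$ (depending on $D$) such that for all $n\in\mathbb{N}=\{1,2,\dots\}$ $$q_n:=|d_{n,n-p}-1|+\sum_{r=-p+1}^{p-1}|d_{n,n+r}|+|d_{n,n+p}-1|\le C_1\exp(-C_2 n^\beta).$$ Such a $D$ defines a bounded operator on $\ell^2(\mathbb{N})$ which is a compact perturbation of $D_0=S^p+(S^* )^p$, $S$ the one-sided shift, and $\sigma(D_0)=[-2,2]$. Hence $\sigma(D)=[-2,2]\cup\sigma_{\rm d}(D)$, where the discrete spectrum $\sigma_{\rm d}(D)$ is the at most countable set of eigenvalues (of finite algebraic multiplicity) of $D$ in $\mathbb{C}\setminus[-2,2]$, whose accumulation points all lie in $[-2,2]$. $E_D\subset[-2,2]$ denotes the set of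 all accumulation points of $\sigma_{\rm d}(D)$. *)

theory Defs
  imports "HOL-Analysis.Analysis" "HOL-Library.Function_Algebras"
begin

text \<open>
  Matrices and sequences over the index set \<open>{1,2,\<dots>}\<close> are functions on \<^typ>\<open>nat\<close> whose
  values at index \<open>0\<close> carry no information: row and column \<open>0\<close> of a matrix are never
  inspected, and sequences in \<open>\<ell>\<^sup>2\<close> are normalised to vanish at \<open>0\<close>.
\<close>

definition cscale :: "complex \<Rightarrow> (nat \<Rightarrow> complex) \<Rightarrow> nat \<Rightarrow> complex"
  where "cscale c u = (\<lambda>n. c * u n)"

interpretation cseq: vector_space cscale
  by unfold_locales (auto simp: cscale_def fun_eq_iff algebra_simps)

definition ell2 :: "(nat \<Rightarrow> complex) set"
  where "ell2 = {u. u 0 = 0 \<and> summable (\<lambda>n. (cmod (u n))\<^sup>2)}"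

definition mat_apply :: "(nat \<Rightarrow> nat \<Rightarrow> complex) \<Rightarrow> (nat \<Rightarrow> complex) \<Rightarrow> nat \<Rightarrow> complex"
  where "mat_apply D u = (\<lambda>i. if i = 0 then 0 else (\<Sum>\<^sub>\<infinity>j\<in>{1..}. D i j * u j))"

definition banded :: "nat \<Rightarrow> (nat \<Rightarrow> nat \<Rightarrow> complex) \<Rightarrow> bool"
  where "banded p D \<longleftrightarrow> (\<forall>i\<ge>1. \<forall>j\<ge>1.
    (\<bar>int i - int j\<bar> > int p \<longrightarrow> D i j = 0) \<and> (\<bar>int i - int j\<bar> = int p \<longrightarrow> D i j \<noteq> 0))"

text \<open>The entries \<open>d\<^bsub>ij\<^esub>\<close> for arbitrary integers, with the convention for \<open>min i j \<le> 0\<close>.\<close>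

definition ext_entry :: "nat \<Rightarrow> (nat \<Rightarrow> nat \<Rightarrow> complex) \<Rightarrow> int \<Rightarrow> int \<Rightarrow> complex"
  where "ext_entry p D i j =
    (if min i j \<le> 0 then (if \<bar>i - j\<bar> = int p then 1 else 0) else D (nat i) (nat j))"

definition defect :: "nat \<Rightarrow> (nat \<Rightarrow> nat \<Rightarrow> complex) \<Rightarrow> nat \<Rightarrow> real"
  where "defect p D n =
    cmod (ext_entry p D (int n) (int n - int p) - 1)
    + (\<Sum>r\<in>{- int p + 1..int p - 1}. cmod (ext_entry p D (int n) (int n + r)))
    + cmod (ext_entry p D (int n) (int n + int p) - 1)"

definition P_class :: "nat \<Rightarrow> real \<Rightarrow> (nat \<Rightarrow> nat \<Rightarrow> complex) set"
  where "P_class p \<beta> = {D. banded p D \<and>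
    (\<exists>C1>0. \<exists>C2>0. \<forall>n\<ge>1. defect p D n \<le> C1 * exp (- C2 * real n powr \<beta>))}"

definition is_eigenvalue :: "(nat \<Rightarrow> nat \<Rightarrow> complex) \<Rightarrow> complex \<Rightarrow> bool"
  where "is_eigenvalue D z \<longleftrightarrow> (\<exists>u\<in>ell2. u \<noteq> 0 \<and> mat_apply D u = cscale z u)"

text \<open>The root subspace \<open>\<Union>\<^sub>k ker (D - z)\<^sup>k\<close>; its dimension is the algebraic multiplicity of \<open>z\<close>.\<close>

definition root_space :: "(nat \<Rightarrow> nat \<Rightarrow> complex) \<Rightarrow> complex \<Rightarrow> (nat \<Rightarrow> complex) set"
  where "root_space D z = {u \<in> ell2. \<exists>k. ((\<lambda>v. mat_apply D v - cscale z v) ^^ k) u = 0}"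

definition finite_alg_mult :: "(nat \<Rightarrow> nat \<Rightarrow> complex) \<Rightarrow> complex \<Rightarrow> bool"
  where "finite_alg_mult D z \<longleftrightarrow> (\<exists>B. finite B \<and> root_space D z \<subseteq> cseq.span B)"

text \<open>The interval \<open>[-2,2]\<close> is built in, so this is meant for \<open>D\<close> in \<^const>\<open>P_class\<close>,
  i.e. for compact perturbations of \<open>S\<^sup>p + (S\<^sup>*)\<^sup>p\<close>.\<close>

definition discrete_spectrum :: "(nat \<Rightarrow> nat \<Rightarrow> complex) \<Rightarrow> complex set"
  where "discrete_spectrum D =
    {z. z \<notin> complex_of_real ` {-2..2} \<and> is_eigenvalue D z \<and> finite_alg_mult D z}"

definition acc_set :: "(nat \<Rightarrow> nat \<Rightarrow> complex) \<Rightarrow> complex set"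
  where "acc_set D = {z. z islimpt discrete_spectrum D}"

end

theory Submission
  imports Defs "HOL-Complex_Analysis.Complex_Analysis" "HOL-Real_Asymp.Real_Asymp"
begin

text \<open>
  Residues modulo \<open>p\<close> reduce the claim to one Jacobi matrix per point \<open>\<nu>\<close>. With
  \<open>z = w + 1 / w\<close> its eigenvalues are the zeros in the unit disc of a Jost function. Take
  \<open>\<zeta> + 1 / \<zeta> = \<nu>\<close>, \<open>\<gamma> / (1 + \<gamma>) = 1 / 2 - \<epsilon>\<close> and, up to small constants in the exponent and the cosine,
  \<open>M w = (w - \<zeta>) exp (- X) cos X\<close> with \<open>X = (1 - w / \<zeta>) powr (- \<gamma>)\<close>. The zeros of \<open>M\<close> are simple and
  accumulate only at \<open>\<zeta>\<close>, where \<open>M\<close> is flat, and its Taylor coefficients decay subexponentially.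
  On the circle \<open>M w - M (1 / w) = (w - 1 / w) (1 - H w)\<close> with \<open>\<bar>H\<bar> \<le> 1 / 2\<close>, so that
  \<open>1 - H = \<kappa> / (f w f (1 / w))\<close> with \<open>f\<close> invertible in the disc. The functions \<open>f\<close> and \<open>f M\<close> start a
  continued fraction whose remainders are the Jost solutions of a Jacobi matrix with boundary
  condition \<open>f M = 0\<close>; the Marchenko equation with the scattering function \<open>f (1 / w) / f w\<close> transfers
  the decay to the matrix entries.
\<close>

section \<open>Laurent expansions on the circle\<close>

text \<open>The matrix is not selfadjoint: the weight \<open>1 - H\<close> is in general complex, so
  positivity cannot supply nonzero off-diagonal entries. The bound \<bar>H\<bar> \<le> 1 / 2
  replaces it: it keeps the real part of the weight at least 1 / 2, which makes the weight coercive
  in the mean over the circle, and it provides the logarithm behind the factorisation. The bound is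
  within reach because \<open>w - \<zeta>\<close> alone contributes exactly \<open>w - 1 / w\<close>
  to the odd part of \<open>M\<close>, while a small constant in the exponent makes the rest
  contribute little. The exponent being below 1 / 2 means \<gamma> < 1. Then \<open>X\<close> maps
  the disc into a sector strictly inside the right half plane, where the damping beats the cosine
  from all directions, although the cosine vanishes infinitely often on the radius towards \<zeta>.
  Balancing this flatness against the growth of derivatives near \<zeta> fixes the relation between
  \<gamma> and the decay exponent. Simple zeros matter because a matrix that is not selfadjoint may
  have Jordan chains; at a simple zero a bilinear sum of squares is nonzero and rules them
  out.\<close>

definition laurent_on :: "(int \<Rightarrow> complex) \<Rightarrow> (complex \<Rightarrow> complex) \<Rightarrow> complex set \<Rightarrow> bool"
  where "laurent_on c \<phi> D \<longleftrightarrow> 0 \<notin> D \<and> (\<forall>w\<in>D. ((\<lambda>n. c n * w powi n) has_sum \<phi> w) UNIV)"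

abbreviation circle :: "complex set"
  where "circle \<equiv> sphere 0 1"

text \<open>The origin is removed because \<open>w powi n\<close> also occurs with negative
  \<open>n\<close>. A function analytic in the disc is represented by coefficients that vanish at
  negative indices.\<close>

abbreviation pdisc :: "complex set"
  where "pdisc \<equiv> cball 0 1 - {0}"

lemma laurent_onD: "laurent_on c \<phi> D \<Longrightarrow> w \<in> D \<Longrightarrow> ((\<lambda>n. c n * w powi n) has_sum \<phi> w) UNIV"
  by (simp add: laurent_on_def)

lemma laurent_on_subset: "laurent_on c \<phi> D \<Longrightarrow> D' \<subseteq> D \<Longrightarrow> laurent_on c \<phi> D'"
  by (auto simp: laurent_on_def)

lemma laurent_on_circleI: "laurent_on c \<phi> pdisc \<Longrightarrow> laurent_on c \<phi> circle"
  by (erule laurent_on_subset) auto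

lemma laurent_on_cong:
  assumes "laurent_on c \<phi> D" "\<And>w. w \<in> D \<Longrightarrow> \<phi> w = \<psi> w"
  shows "laurent_on c \<psi> D"
  using assms by (auto simp: laurent_on_def)

text \<open>Unconditional convergence of complex series is absolute convergence. This is why
  \<open>has_sum\<close> in \<open>laurent_on\<close> suffices for all later products and
  rearrangements.\<close>

lemma laurent_on_summable:
  assumes "laurent_on c \<phi> D" "w \<in> D"
  shows "(\<lambda>n. cmod (c n) * cmod w powi n) summable_on UNIV"
proof -
  have "(\<lambda>n. c n * w powi n) summable_on UNIV"
    using assms has_sum_imp_summable laurent_onD by blast
  then have "(\<lambda>n. norm (c n * w powi n)) summable_on UNIV"
    by (simp only: summable_on_iff_abs_summable_on_complex)
  then show ?thesis by (simp add: norm_mult norm_power_int)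
qed

lemma laurent_on_circle_summable:
  assumes "laurent_on c \<phi> circle"
  shows "(\<lambda>n. cmod (c n)) summable_on UNIV"
  using laurent_on_summable[OF assms, of 1] by simp

lemma laurent_on_add:
  assumes "laurent_on a \<phi> D" "laurent_on b \<psi> D"
  shows "laurent_on (\<lambda>n. a n + b n) (\<lambda>w. \<phi> w + \<psi> w) D"
  using assms by (auto simp: laurent_on_def distrib_right intro!: has_sum_add)

lemma laurent_on_cmult:
  assumes "laurent_on a \<phi> D"
  shows "laurent_on (\<lambda>n. k * a n) (\<lambda>w. k * \<phi> w) D"
  using assms by (auto simp: laurent_on_def mult.assoc intro!: has_sum_cmult_right)

lemma laurent_on_diff:
  assumes "laurent_on a \<phi> D" "laurent_on b \<psi> D"
  shows "laurent_on (\<lambda>n. a n - b n) (\<lambda>w. \<phi> w - \<psi> w) D"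
  using laurent_on_add[OF assms(1) laurent_on_cmult[OF assms(2), of "-1"]] by simp

lemma laurent_on_monom:
  assumes "0 \<notin> D"
  shows "laurent_on (\<lambda>n. if n = k then 1 else 0) (\<lambda>w. w powi k) D"
  unfolding laurent_on_def
proof (intro conjI ballI)
  show "((\<lambda>n. (if n = k then 1 else 0) * w powi n) has_sum w powi k) UNIV"
    for w :: complex by (rule has_sum_finite_neutralI[where B = "{k}"]) auto
qed fact

lemma laurent_on_shift:
  assumes "laurent_on a \<phi> D"
  shows "laurent_on (\<lambda>n. a (n - k)) (\<lambda>w. w powi k * \<phi> w) D"
  unfolding laurent_on_def
proof (intro conjI ballI)
  fix w assume w: "w \<in> D"
  have w0: "w \<noteq> 0" using assms w by (auto simp: laurent_on_def)
  have "((\<lambda>n. w powi k * (a n * w powi n)) has_sum w powi k * \<phi> w) UNIV"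
    using laurent_onD[OF assms w] by (rule has_sum_cmult_right)
  then show "((\<lambda>n. a (n - k) * w powi n) has_sum w powi k * \<phi> w) UNIV"
    by (subst has_sum_reindex_bij_witness[where i = "\<lambda>n. n + k" and j = "\<lambda>n. n - k" and T = UNIV
          and h = "\<lambda>n. w powi k * (a n * w powi n)" and s' = "w powi k * \<phi> w"])
      (auto simp: w0 power_int_diff)
qed (use assms in \<open>auto simp: laurent_on_def\<close>)

lemma laurent_on_inverse:
  assumes "laurent_on a \<phi> circle"
  shows "laurent_on (\<lambda>n. a (- n)) (\<lambda>w. \<phi> (inverse w)) circle"
  unfolding laurent_on_def
proof (intro conjI ballI)
  fix w assume w: "w \<in> circle"
  have "inverse w \<in> circle" using w by (simp add: norm_inverse)
  from laurent_onD[OF assms this]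
  show "((\<lambda>n. a (- n) * w powi n) has_sum \<phi> (inverse w)) UNIV"
    by (subst has_sum_reindex_bij_witness[where i = uminus and j = uminus and T = UNIV
          and h = "\<lambda>n. a n * (inverse w) powi n" and s' = "\<phi> (inverse w)"])
      (auto simp: power_int_minus power_int_inverse)
qed auto

lemma laurent_on_cnj:
  assumes "laurent_on a \<phi> circle"
  shows "laurent_on (\<lambda>n. cnj (a (- n))) (\<lambda>w. cnj (\<phi> w)) circle"
proof -
  have "laurent_on (\<lambda>n. cnj (a n)) (\<lambda>w. cnj (\<phi> (inverse w))) circle"
    unfolding laurent_on_def
  proof (intro conjI ballI)
    fix w assume w: "w \<in> circle"
    have "inverse w \<in> circle" using w by (simp add: norm_inverse)
    from laurent_onD[OF assms this]
    have "((\<lambda>n. cnj (a n * inverse w powi n)) has_sum cnj (\<phi> (inverse w))) UNIV"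
      by (simp only: has_sum_cnj_iff)
    moreover have "cnj (inverse w) = w"
      using w by (simp add: complex_cnj_inverse divide_conv_cnj inverse_eq_divide)
    ultimately show "((\<lambda>n. cnj (a n) * w powi n) has_sum cnj (\<phi> (inverse w))) UNIV"
      by (simp add: complex_cnj_power_int del: complex_cnj_inverse)
  qed auto
  from laurent_on_inverse[OF this] show ?thesis by simp
qed

definition conv :: "(int \<Rightarrow> complex) \<Rightarrow> (int \<Rightarrow> complex) \<Rightarrow> int \<Rightarrow> complex"
  where "conv a b n = (\<Sum>\<^sub>\<infinity>m. a m * b (n - m))"

text \<open>The shear sending \<open>(n, m)\<close> to \<open>(m, n - m)\<close> turns the
  absolutely summable product family into the one summed in a convolution.\<close>

lemma product_summable_diag:
  fixes f g :: "int \<Rightarrow> 'a :: {real_normed_field, banach}"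
  assumes "(\<lambda>n. norm (f n)) summable_on UNIV" "(\<lambda>n. norm (g n)) summable_on UNIV"
  shows "(\<lambda>(n, m). norm (f m * g (n - m))) summable_on UNIV \<times> UNIV"
    and "((\<lambda>(n, m). f m * g (n - m)) has_sum (infsum f UNIV * infsum g UNIV)) (UNIV \<times> UNIV)"
proof -
  have 1: "(\<lambda>p. norm (f (fst p) * g (snd p))) summable_on UNIV \<times> UNIV"
    by (rule summable_on_SigmaI[where g = "\<lambda>x. norm (f x) * (\<Sum>\<^sub>\<infinity>y. norm (g y))"])
      (use assms in \<open>auto simp: norm_mult intro!: has_sum_cmult_right summable_on_cmult_left\<close>)
  have bij: "bij_betw (\<lambda>(n, m). (m, n - m)) (UNIV \<times> UNIV) (UNIV \<times> UNIV :: (int \<times> int) set)"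
    by (rule bij_betwI[where g = "\<lambda>(m, k). (m + k, m)"]) auto
  show "(\<lambda>(n, m). norm (f m * g (n - m))) summable_on UNIV \<times> UNIV"
    using summable_on_reindex_bij_betw[OF bij, of "\<lambda>p. norm (f (fst p) * g (snd p))"] 1
    by (simp add: case_prod_unfold)
  have s: "(\<lambda>p. f (fst p) * g (snd p)) summable_on UNIV \<times> UNIV"
    using 1 by (rule abs_summable_summable)
  have "((\<lambda>p. f (fst p) * g (snd p)) has_sum (infsum f UNIV * infsum g UNIV)) (UNIV \<times> UNIV)"
  proof (rule has_sum_SigmaI[OF _ _ s])
    have fs: "f summable_on UNIV" "g summable_on UNIV"
      using assms by (auto intro: abs_summable_summable)
    fix x :: int
    show "((\<lambda>y. f (fst (x, y)) * g (snd (x, y))) has_sum f x * infsum g UNIV) UNIV"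
      using fs by (auto intro!: has_sum_cmult_right)
    show "((\<lambda>x. f x * infsum g UNIV) has_sum (infsum f UNIV * infsum g UNIV)) UNIV"
      using fs by (auto intro!: has_sum_cmult_left)
  qed
  then show "((\<lambda>(n, m). f m * g (n - m)) has_sum (infsum f UNIV * infsum g UNIV)) (UNIV \<times> UNIV)"
    using has_sum_reindex_bij_betw[OF bij, of "\<lambda>p. f (fst p) * g (snd p)"]
    by (simp add: case_prod_unfold)
qed

lemma laurent_on_mult:
  assumes a: "laurent_on a \<phi> D" and b: "laurent_on b \<psi> D"
  shows "laurent_on (conv a b) (\<lambda>w. \<phi> w * \<psi> w) D"
  unfolding laurent_on_def
proof (intro conjI ballI)
  fix w assume w: "w \<in> D"
  have w0: "w \<noteq> 0" using a w by (auto simp: laurent_on_def)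
  define f where "f m = a m * w powi m" for m
  define g where "g m = b m * w powi m" for m
  have f: "(f has_sum \<phi> w) UNIV" and g: "(g has_sum \<psi> w) UNIV"
    using laurent_onD[OF a w] laurent_onD[OF b w] by (simp_all add: f_def[abs_def] g_def[abs_def])
  have fa: "(\<lambda>n. norm (f n)) summable_on UNIV" and ga: "(\<lambda>n. norm (g n)) summable_on UNIV"
    using f g by (simp_all only: has_sum_imp_summable flip: summable_on_iff_abs_summable_on_complex)
  note pr = product_summable_diag[OF fa ga]
  have hs: "((\<lambda>(n, m). f m * g (n - m)) has_sum (\<phi> w * \<psi> w)) (UNIV \<times> UNIV)"
    using pr(2) infsumI[OF f] infsumI[OF g] by simp
  have fg: "f m * g (n - m) = w powi n * (a m * b (n - m))" for n m
    using w0 by (simp add: f_def g_def power_int_diff)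
  have inner: "((\<lambda>m. f m * g (n - m)) has_sum (conv a b n * w powi n)) UNIV" for n
  proof -
    have "(\<lambda>m. f m * g (n - m)) summable_on UNIV"
      using summable_on_SigmaD1[OF has_sum_imp_summable[OF hs]] by simp
    then have "(\<lambda>m. a m * b (n - m)) summable_on UNIV"
      using w0 by (simp add: fg summable_on_cmult_right')
    then have "((\<lambda>m. w powi n * (a m * b (n - m))) has_sum (w powi n * conv a b n)) UNIV"
      unfolding conv_def by (intro has_sum_cmult_right) simp
    then show ?thesis by (simp add: fg mult.commute)
  qed
  show "((\<lambda>n. conv a b n * w powi n) has_sum \<phi> w * \<psi> w) UNIV"
    by (intro has_sum_SigmaD[OF hs]) (use inner in auto)
qed (use a in \<open>auto simp: laurent_on_def\<close>)

text \<open>Sequences with summable weight form a Beurling algebra: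
  \<open>v n \<le> v m * v (n - m)\<close> distributes the weight over the two factors. It is
  applied to subexponential weights and to \<open>v n = cmod w powi n\<close>.\<close>

lemma conv_weighted:
  fixes v :: "int \<Rightarrow> real"
  assumes v: "\<And>n. v n > 0" "\<And>m n. v (m + n) \<le> v m * v n"
    and a: "(\<lambda>n. cmod (a n) * v n) summable_on UNIV"
    and b: "(\<lambda>n. cmod (b n) * v n) summable_on UNIV"
  shows "(\<lambda>n. cmod (conv a b n) * v n) summable_on UNIV"
    and "(\<Sum>\<^sub>\<infinity>n. cmod (conv a b n) * v n) \<le> (\<Sum>\<^sub>\<infinity>n. cmod (a n) * v n) * (\<Sum>\<^sub>\<infinity>n. cmod (b n) * v n)"
proof -
  let ?f = "\<lambda>n. cmod (a n) * v n" and ?g = "\<lambda>n. cmod (b n) * v n"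
  have fa: "(\<lambda>n. norm (?f n)) summable_on UNIV" and ga: "(\<lambda>n. norm (?g n)) summable_on UNIV"
    using a b v(1) by (simp_all add: less_imp_le)
  note pr = product_summable_diag[OF fa ga]
  have inner: "(\<lambda>m. ?f m * ?g (n - m)) summable_on UNIV" for n
    using summable_on_SigmaD1[OF has_sum_imp_summable[OF pr(2)]] by simp
  have le: "cmod (a m * b (n - m)) * v n \<le> ?f m * ?g (n - m)" for m n
  proof -
    have "v n \<le> v m * v (n - m)" using v(2)[of m "n - m"] by simp
    then have "cmod (a m * b (n - m)) * v n \<le> cmod (a m * b (n - m)) * (v m * v (n - m))"
      by (rule mult_left_mono) simp
    then show ?thesis by (simp add: norm_mult mult_ac)
  qed
  have bd: "cmod (conv a b n) * v n \<le> (\<Sum>\<^sub>\<infinity>m. ?f m * ?g (n - m))" for n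
  proof -
    have "(\<lambda>m. norm (complex_of_real (v n) * (a m * b (n - m)))) summable_on UNIV"
      by (rule Infinite_Sum.abs_summable_on_comparison_test'[OF inner[of n]])
        (use le[of _ n] v(1)[of n] in \<open>auto simp: norm_mult mult_ac\<close>)
    then have s: "(\<lambda>m. complex_of_real (v n) * (a m * b (n - m))) summable_on UNIV"
      by (rule abs_summable_summable)
    then have s': "(\<lambda>m. a m * b (n - m)) summable_on UNIV"
      using v(1)[of n] by (subst (asm) summable_on_cmult_right') auto
    have "((\<lambda>m. complex_of_real (v n) * (a m * b (n - m))) has_sum complex_of_real (v n) * conv a b n) UNIV"
      unfolding conv_def using s' by (intro has_sum_cmult_right) simp
    then have "norm (complex_of_real (v n) * conv a b n) \<le> (\<Sum>\<^sub>\<infinity>m. ?f m * ?g (n - m))"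
      by (rule norm_infsum_le[OF _ has_sum_infsum[OF inner]])
        (use le[of _ n] v(1)[of n] in \<open>auto simp: norm_mult mult_ac\<close>)
    then show ?thesis using v(1)[of n] by (simp add: norm_mult mult_ac)
  qed
  have hs: "((\<lambda>n. \<Sum>\<^sub>\<infinity>m. ?f m * ?g (n - m)) has_sum (infsum ?f UNIV * infsum ?g UNIV)) UNIV"
    by (rule has_sum_SigmaD[OF pr(2)]) (use inner in auto)
  show s: "(\<lambda>n. cmod (conv a b n) * v n) summable_on UNIV"
    by (rule summable_on_comparison_test[OF has_sum_imp_summable[OF hs]])
      (use bd v(1) in \<open>auto simp: less_imp_le\<close>)
  show "(\<Sum>\<^sub>\<infinity>n. cmod (conv a b n) * v n) \<le> infsum ?f UNIV * infsum ?g UNIV"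
    by (rule has_sum_mono[OF has_sum_infsum[OF s] hs bd])
qed

fun cpow :: "(int \<Rightarrow> complex) \<Rightarrow> nat \<Rightarrow> int \<Rightarrow> complex" where
  "cpow c 0 = (\<lambda>n. if n = 0 then 1 else 0)"
| "cpow c (Suc k) = conv c (cpow c k)"

lemma laurent_on_cpow:
  assumes "laurent_on c \<phi> D"
  shows "laurent_on (cpow c k) (\<lambda>w. \<phi> w ^ k) D"
proof (induction k)
  case 0
  show ?case using laurent_on_monom[of D 0] assms by (simp add: laurent_on_def)
next
  case (Suc k)
  show ?case using laurent_on_mult[OF assms Suc] by simp
qed

lemma cpow_weighted:
  fixes v :: "int \<Rightarrow> real"
  assumes v: "\<And>n. v n > 0" "\<And>m n. v (m + n) \<le> v m * v n" "v 0 = 1"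
    and a: "(\<lambda>n. cmod (c n) * v n) summable_on UNIV"
  shows "(\<lambda>n. cmod (cpow c k n) * v n) summable_on UNIV \<and>
    (\<Sum>\<^sub>\<infinity>n. cmod (cpow c k n) * v n) \<le> (\<Sum>\<^sub>\<infinity>n. cmod (c n) * v n) ^ k"
proof (induction k)
  case 0
  have "((\<lambda>n. cmod (cpow c 0 n) * v n) has_sum 1) UNIV"
    by (rule has_sum_finite_neutralI[where B = "{0}"]) (auto simp: v)
  then show ?case by (auto simp: has_sum_iff)
next
  case (Suc k)
  have "(\<Sum>\<^sub>\<infinity>n. cmod (cpow c (Suc k) n) * v n)
      \<le> (\<Sum>\<^sub>\<infinity>n. cmod (c n) * v n) * (\<Sum>\<^sub>\<infinity>n. cmod (cpow c k n) * v n)"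
    using conv_weighted(2)[OF v(1,2) a] Suc by simp
  also have "\<dots> \<le> (\<Sum>\<^sub>\<infinity>n. cmod (c n) * v n) * (\<Sum>\<^sub>\<infinity>n. cmod (c n) * v n) ^ k"
    using Suc by (intro mult_left_mono infsum_nonneg) (auto simp: v less_imp_le)
  finally show ?case using conv_weighted(1)[OF v(1,2) a] Suc by simp
qed

section \<open>Averages over roots of unity in place of integrals over the circle\<close>

definition root_avg :: "nat \<Rightarrow> (complex \<Rightarrow> 'a) \<Rightarrow> 'a :: real_normed_vector"
  where "root_avg N \<phi> = (\<Sum>j<N. \<phi> (cis (2 * pi * real j / real N))) /\<^sub>R real N"

lemma cis_powi: "cis t powi n = cis (real_of_int n * t)"
proof (cases "n \<ge> 0")
  case True
  then obtain m where "n = int m" using nonneg_int_cases by blast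
  then show ?thesis by (simp add: Complex.DeMoivre)
next
  case False
  then obtain m where "n = - int m" by (metis int_cases2 linear of_nat_0_le_iff)
  then show ?thesis by (simp add: power_int_minus Complex.DeMoivre cis_inverse)
qed

lemma root_avg_monom:
  assumes "n \<noteq> 0" "\<bar>n\<bar> < int N"
  shows "root_avg N (\<lambda>w. w powi n) = 0"
proof -
  define x where "x = cis (2 * pi * real_of_int n / real N)"
  have N: "N > 0" using assms by linarith
  have "(\<Sum>j<N. cis (2 * pi * real j / real N) powi n) = (\<Sum>j<N. x ^ j)"
    by (rule sum.cong) (auto simp: x_def cis_powi Complex.DeMoivre mult_ac)
  also have "\<dots> = (x ^ N - 1) / (x - 1)"
  proof (rule geometric_sum)
    show "x \<noteq> 1"
    proof
      assume "x = 1"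
      then have "cos (2 * pi * real_of_int n / real N) = 1" by (simp add: x_def complex_eq_iff)
      then obtain m :: int where m: "2 * pi * real_of_int n / real N = real_of_int m * 2 * pi"
        by (metis cos_one_2pi_int)
      then have "2 * pi * real_of_int n = 2 * pi * (real_of_int m * real N)"
        using N by (simp add: field_simps)
      then have "real_of_int n = real_of_int m * real N"
        by (subst (asm) mult_left_cancel) auto
      then have e: "n = m * int N"
        by (metis of_int_eq_iff of_int_mult of_int_of_nat_eq)
      then have "m \<noteq> 0" using assms by auto
      then have "\<bar>m\<bar> * int N \<ge> 1 * int N" by (intro mult_right_mono) auto
      then show False using e assms by (simp add: abs_mult)
    qed
  qed
  also have "x ^ N = 1"
    using N cos_int_2pin[of n] sin_int_2pin[of n]
    by (simp add: x_def Complex.DeMoivre complex_eq_iff mult_ac)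
  finally show ?thesis by (simp add: root_avg_def)
qed

lemma norm_root_avg_le:
  assumes "\<And>w. w \<in> circle \<Longrightarrow> norm (\<phi> w) \<le> \<psi> w"
  shows "norm (root_avg N \<phi>) \<le> root_avg N \<psi>"
proof -
  have "norm (\<Sum>j<N. \<phi> (cis (2 * pi * real j / real N))) \<le> (\<Sum>j<N. \<psi> (cis (2 * pi * real j / real N)))"
    by (rule sum_norm_le) (auto intro!: assms)
  then show ?thesis by (simp add: root_avg_def divide_inverse_commute[symmetric] divide_right_mono mult.commute)
qed

lemma root_avg_const: "N > 0 \<Longrightarrow> root_avg N (\<lambda>_. x) = x"
  by (simp add: root_avg_def sum_constant_scaleR)

lemma root_avg_diff: "root_avg N (\<lambda>w. \<phi> w - \<psi> w) = root_avg N \<phi> - root_avg N \<psi>"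
  by (simp add: root_avg_def sum_subtractf scaleR_diff_right)

lemma root_avg_add: "root_avg N (\<lambda>w. \<phi> w + \<psi> w) = root_avg N \<phi> + root_avg N \<psi>"
  by (simp add: root_avg_def sum.distrib scaleR_add_right)

lemma root_avg_sum: "root_avg N (\<lambda>w. \<Sum>n\<in>F. \<phi> n w) = (\<Sum>n\<in>F. root_avg N (\<phi> n))"
  unfolding root_avg_def by (subst sum.swap) (simp add: scaleR_sum_right)

lemma root_avg_cmult:
  fixes k :: "'a :: real_normed_algebra"
  shows "root_avg N (\<lambda>w. k * \<phi> w) = k * root_avg N \<phi>"
  by (simp add: root_avg_def sum_distrib_left)

text \<open>Up to a uniformly small tail the series is a trigonometric polynomial, whose average
  over \<open>N\<close> roots of unity is exactly its constant term as soon as \<open>N\<close>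
  exceeds the modulus of every frequency.\<close>

lemma root_avg_tendsto:
  assumes "laurent_on c \<phi> circle"
  shows "(\<lambda>N. root_avg N \<phi>) \<longlonglongrightarrow> c 0"
proof (rule LIMSEQ_I)
  fix e :: real assume e: "e > 0"
  have s: "(\<lambda>n. cmod (c n)) summable_on UNIV" by (rule laurent_on_circle_summable[OF assms])
  obtain F where F: "finite F" "dist (sum (\<lambda>n. cmod (c n)) F) (\<Sum>\<^sub>\<infinity>n. cmod (c n)) \<le> e / 2"
    using infsum_finite_approximation[OF s, of "e / 2"] e by auto
  define T where "T = (\<Sum>\<^sub>\<infinity>n\<in>- insert 0 F. cmod (c n))"
  have sT: "(\<lambda>n. cmod (c n)) summable_on - insert 0 F"
    using s summable_on_subset_banach by blast
  have T: "T \<le> e / 2"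
  proof -
    have "(\<Sum>\<^sub>\<infinity>n\<in>F. cmod (c n)) + (\<Sum>\<^sub>\<infinity>n\<in>-F. cmod (c n)) = (\<Sum>\<^sub>\<infinity>n. cmod (c n))"
      by (subst infsum_Un_disjoint[symmetric]) (use s F in \<open>auto intro: summable_on_subset_banach\<close>)
    moreover have "T \<le> (\<Sum>\<^sub>\<infinity>n\<in>-F. cmod (c n))"
      unfolding T_def
      by (rule infsum_mono_neutral) (use s sT in \<open>auto intro: summable_on_subset_banach\<close>)
    moreover have "(\<Sum>\<^sub>\<infinity>n\<in>F. cmod (c n)) = (\<Sum>n\<in>F. cmod (c n))" using F by simp
    ultimately show ?thesis using F(2) unfolding dist_real_def by linarith
  qed
  obtain N0 where N0: "\<And>n. n \<in> insert 0 F \<Longrightarrow> \<bar>n\<bar> < int N0"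
  proof
    fix n assume n: "n \<in> insert 0 F"
    have "\<bar>n\<bar> \<le> (\<Sum>n\<in>insert 0 F. \<bar>n\<bar>)" by (rule member_le_sum) (use F n in auto)
    then show "\<bar>n\<bar> < int (nat (\<Sum>n\<in>insert 0 F. \<bar>n\<bar>) + 1)" by linarith
  qed
  show "\<exists>N0. \<forall>N\<ge>N0. norm (root_avg N \<phi> - c 0) < e"
  proof (intro exI allI impI)
    fix N assume N: "N \<ge> N0"
    have Npos: "N > 0" using N0[of 0] N by simp
    define R where "R w = \<phi> w - (\<Sum>n\<in>insert 0 F. c n * w powi n)" for w
    have R: "norm (R w) \<le> T" if w: "w \<in> circle" for w
    proof -
      have "((\<lambda>n. c n * w powi n) has_sum (\<phi> w - (\<Sum>n\<in>insert 0 F. c n * w powi n))) (UNIV - insert 0 F)"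
        by (rule has_sum_Diff[OF laurent_onD[OF assms w]]) (use F in auto)
      then have h: "((\<lambda>n. c n * w powi n) has_sum R w) (- insert 0 F)"
        by (simp add: R_def Compl_eq_Diff_UNIV)
      show ?thesis unfolding T_def
        by (rule norm_infsum_le[OF h has_sum_infsum[OF sT]])
          (use w in \<open>auto simp: norm_mult norm_power_int\<close>)
    qed
    have "root_avg N \<phi> = root_avg N (\<lambda>w. R w + (\<Sum>n\<in>insert 0 F. c n * w powi n))"
      by (simp add: R_def)
    also have "\<dots> = root_avg N R + (\<Sum>n\<in>insert 0 F. c n * root_avg N (\<lambda>w. w powi n))"
      by (simp only: root_avg_add root_avg_sum root_avg_cmult)
    also have "(\<Sum>n\<in>insert 0 F. c n * root_avg N (\<lambda>w. w powi n)) = c 0"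
    proof -
      have "(\<Sum>n\<in>insert 0 F. c n * root_avg N (\<lambda>w. w powi n))
          = (\<Sum>n\<in>insert 0 F. if n = 0 then c 0 else 0)"
      proof (rule sum.cong[OF refl])
        fix n assume "n \<in> insert 0 F"
        then have "\<bar>n\<bar> < int N" using N0[of n] N by simp
        then show "c n * root_avg N (\<lambda>w. w powi n) = (if n = 0 then c 0 else 0)"
          using root_avg_monom[of n N] root_avg_const[OF Npos, of "1 :: complex"] by auto
      qed
      then show ?thesis using F by simp
    qed
    finally have "norm (root_avg N \<phi> - c 0) = norm (root_avg N R)" by simp
    also have "\<dots> \<le> root_avg N (\<lambda>_. T)" by (rule norm_root_avg_le) (use R in auto)
    also have "\<dots> = T" by (rule root_avg_const[OF Npos])
    finally show "norm (root_avg N \<phi> - c 0) < e" using T e by simp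
  qed
qed

text \<open>Multiplication by \<open>w powi (- n)\<close> moves the coefficient to index 0 and
  preserves moduli on the circle. The bound yields uniqueness of coefficients and the growth rate
  \<open>r ^ k\<close> for powers.\<close>

lemma laurent_on_coeff_le:
  assumes "laurent_on c \<phi> circle" "\<And>w. w \<in> circle \<Longrightarrow> cmod (\<phi> w) \<le> r"
  shows "cmod (c n) \<le> r"
proof -
  have l: "laurent_on (\<lambda>k. c (k + n)) (\<lambda>w. w powi (- n) * \<phi> w) circle"
    using laurent_on_shift[OF assms(1), of "- n"] by simp
  have "(\<lambda>N. norm (root_avg N (\<lambda>w. w powi (- n) * \<phi> w))) \<longlonglongrightarrow> norm (c n)"
    using tendsto_norm[OF root_avg_tendsto[OF l]] by simp
  moreover have "eventually (\<lambda>N. norm (root_avg N (\<lambda>w. w powi (- n) * \<phi> w)) \<le> r) sequentially"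
    using eventually_gt_at_top[of 0]
  proof eventually_elim
    case (elim N)
    have "norm (root_avg N (\<lambda>w. w powi (- n) * \<phi> w)) \<le> root_avg N (\<lambda>_. r)"
      by (rule norm_root_avg_le) (use assms(2) in \<open>auto simp: norm_mult norm_power_int\<close>)
    then show ?case using root_avg_const[OF elim, of r] by simp
  qed
  ultimately show ?thesis by (rule tendsto_upperbound) simp
qed

lemma laurent_on_unique:
  assumes "laurent_on c \<phi> circle" "laurent_on d \<phi> circle"
  shows "c = d"
proof
  fix n
  have "cmod (c n - d n) \<le> 0"
    by (rule laurent_on_coeff_le[OF laurent_on_diff[OF assms]]) auto
  then show "c n = d n" by simp
qed

lemma laurent_on_continuous:
  assumes "laurent_on c \<phi> D" "(\<lambda>n. M n) summable_on UNIV"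
    "\<And>w n. w \<in> D \<Longrightarrow> cmod (c n) * cmod w powi n \<le> M n"
  shows "continuous_on D \<phi>"
proof -
  have "uniform_limit D (\<lambda>X y. \<Sum>n\<in>X. c n * y powi n) \<phi> (finite_subsets_at_top UNIV)"
    by (rule Weierstrass_m_test_general'[where M = M])
      (use assms in \<open>auto simp: laurent_on_def norm_mult norm_power_int\<close>)
  then show ?thesis
  proof (rule uniform_limit_theorem[rotated])
    show "\<forall>\<^sub>F X in finite_subsets_at_top UNIV. continuous_on D (\<lambda>y. \<Sum>n\<in>X. c n * y powi n)"
      using assms(1) by (intro always_eventually allI continuous_intros) (auto simp: laurent_on_def)
  qed simp
qed

lemma laurent_on_circle_continuous:
  assumes "laurent_on c \<phi> circle"
  shows "continuous_on circle \<phi>"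
  by (rule laurent_on_continuous[OF assms laurent_on_circle_summable[OF assms]]) auto

text \<open>The averages of \<bar>U\<bar> squared tend to the sum of the squares of \<bar>u n\<bar>
  (Parseval), those of \<bar>U\<bar> squared times \<open>1 - H\<close> to \<open>h 0 = 0\<close>.
  Their difference is an average against \<open>H\<close>, at most half of the former, so the
  Parseval sum is at most half of itself.\<close>

lemma laurent_on_coercive:
  fixes H :: "complex \<Rightarrow> complex"
  assumes u: "laurent_on u U circle" and h: "laurent_on h (\<lambda>w. (cmod (U w))\<^sup>2 * (1 - H w)) circle"
    and H: "\<And>w. w \<in> circle \<Longrightarrow> cmod (H w) \<le> 1/2" and h0: "h 0 = 0"
  shows "u n = 0"
proof -
  have uu: "laurent_on (conv u (\<lambda>n. cnj (u (- n)))) (\<lambda>w. U w * cnj (U w)) circle"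
    by (rule laurent_on_mult[OF u laurent_on_cnj[OF u]])
  define q where "q = conv u (\<lambda>n. cnj (u (- n))) 0"
  have q: "q = (\<Sum>\<^sub>\<infinity>m. complex_of_real ((cmod (u m))\<^sup>2))"
    unfolding q_def conv_def by (intro infsum_cong) (simp add: complex_norm_square del: of_real_power)
  let ?B = "\<lambda>w. (cmod (U w))\<^sup>2"
  have c1: "(\<lambda>N. root_avg N (\<lambda>w. U w * cnj (U w))) \<longlonglongrightarrow> q"
    unfolding q_def by (rule root_avg_tendsto[OF uu])
  have e1: "root_avg N (\<lambda>w. U w * cnj (U w)) = complex_of_real (root_avg N ?B)" for N
    by (simp add: root_avg_def complex_norm_square scaleR_conv_of_real del: of_real_power)
  have "(\<lambda>N. Re (root_avg N (\<lambda>w. U w * cnj (U w)))) \<longlonglongrightarrow> Re q"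
    by (rule tendsto_Re[OF c1])
  then have B: "(\<lambda>N. root_avg N ?B) \<longlonglongrightarrow> Re q" by (simp add: e1)
  have c2: "(\<lambda>N. root_avg N (\<lambda>w. U w * cnj (U w)) - root_avg N (\<lambda>w. ?B w * (1 - H w))) \<longlonglongrightarrow> q - 0"
    using tendsto_diff[OF c1 root_avg_tendsto[OF h]] h0 by simp
  have le: "norm (root_avg N (\<lambda>w. U w * cnj (U w)) - root_avg N (\<lambda>w. ?B w * (1 - H w))) \<le> root_avg N ?B / 2" for N
  proof -
    have "norm (root_avg N (\<lambda>w. U w * cnj (U w) - ?B w * (1 - H w))) \<le> root_avg N (\<lambda>w. ?B w / 2)"
    proof (rule norm_root_avg_le)
      fix w assume "w \<in> circle"
      then have "cmod (H w) \<le> 1/2" by (rule H)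
      moreover have "U w * cnj (U w) - ?B w * (1 - H w) = ?B w * H w"
        by (simp add: complex_norm_square algebra_simps del: of_real_power)
      ultimately show "norm (U w * cnj (U w) - ?B w * (1 - H w)) \<le> ?B w / 2"
        using mult_left_mono[of "cmod (H w)" "1/2" "?B w"] by (simp add: norm_mult norm_power)
    qed
    also have "root_avg N (\<lambda>w. ?B w / 2) = root_avg N ?B / 2"
      by (simp add: root_avg_def sum_divide_distrib[symmetric])
    finally show ?thesis by (simp add: root_avg_diff)
  qed
  have "norm (q - 0) \<le> Re q / 2"
    by (rule tendsto_le[OF _ tendsto_divide[OF B tendsto_const] tendsto_norm[OF c2]]) (use le in auto)
  then have "Re q \<le> Re q / 2" using complex_Re_le_cmod[of q] by simp
  then have "Re q \<le> 0" by simp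
  have su: "(\<lambda>m. u m * cnj (u (- (0 - m)))) summable_on UNIV"
  proof -
    have s: "(\<lambda>n. norm (u n)) summable_on UNIV" by (rule laurent_on_circle_summable[OF u])
    have "(\<lambda>n. norm (cnj (u (- n)))) summable_on UNIV"
      using laurent_on_circle_summable[OF laurent_on_cnj[OF u]] by simp
    from product_summable_diag(2)[OF s this, THEN has_sum_imp_summable]
    have "(\<lambda>m. u m * cnj (u (- (0 - m)))) summable_on UNIV"
      by (rule summable_on_SigmaD1) auto
    then show ?thesis .
  qed
  then have s2: "(\<lambda>m. complex_of_real ((cmod (u m))\<^sup>2)) summable_on UNIV"
    by (simp add: complex_norm_square del: of_real_power)
  then have s3: "(\<lambda>m. (cmod (u m))\<^sup>2) summable_on UNIV"
    using summable_on_Re[OF s2] by simp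
  have "Re q = (\<Sum>\<^sub>\<infinity>m. (cmod (u m))\<^sup>2)"
    unfolding q by (subst infsum_Re[symmetric]) (use s2 in auto)
  then have "(\<Sum>\<^sub>\<infinity>m. (cmod (u m))\<^sup>2) \<le> 0" using \<open>Re q \<le> 0\<close> by simp
  then have "(cmod (u n))\<^sup>2 = 0"
    by (rule nonneg_infsum_le_0D[OF _ s3]) auto
  then show ?thesis by simp
qed

section \<open>A Wiener-Levy theorem with subexponential weights\<close>

definition subexp_decay :: "real \<Rightarrow> (int \<Rightarrow> complex) \<Rightarrow> bool"
  where "subexp_decay \<beta> c \<longleftrightarrow> (\<exists>C. \<exists>K>0. \<forall>n. cmod (c n) \<le> C * exp (- K * \<bar>real_of_int n\<bar> powr \<beta>))"

lemma summable_exp_powr_nat: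
  fixes K \<beta> :: real
  assumes "K > 0" "\<beta> > 0"
  shows "summable (\<lambda>n. exp (- K * real n powr \<beta>))"
proof (rule summable_comparison_test_bigo)
  show "summable (\<lambda>n. norm (1 / (real n)\<^sup>2))"
    using inverse_power_summable[of 2, where ?'a = real] by (simp add: inverse_eq_divide)
  show "(\<lambda>n. exp (- K * real n powr \<beta>)) \<in> O(\<lambda>n. 1 / (real n)\<^sup>2)"
    using assms by real_asymp
qed

lemma summable_on_int_abs:
  fixes g :: "nat \<Rightarrow> real"
  assumes "summable g" "\<And>n. g n \<ge> 0"
  shows "(\<lambda>n::int. g (nat \<bar>n\<bar>)) summable_on UNIV"
proof -
  have g: "g summable_on UNIV" using assms by (simp add: summable_nonneg_imp_summable_on)
  have 1: "(\<lambda>n::int. g (nat \<bar>n\<bar>)) summable_on {0..}"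
    using g by (subst summable_on_reindex_bij_witness[where i = int and j = nat and T = UNIV and h = g]) auto
  have 2: "(\<lambda>n::int. g (nat \<bar>n\<bar>)) summable_on {..0}"
    using g by (subst summable_on_reindex_bij_witness[where i = "\<lambda>n. - int n" and j = "\<lambda>n. nat (- n)" and T = UNIV and h = g]) auto
  have "(\<lambda>n::int. g (nat \<bar>n\<bar>)) summable_on {0..} \<union> {..0}"
    by (rule summable_on_union[OF 1 2])
  also have "{0..} \<union> {..0} = (UNIV :: int set)" by auto
  finally show ?thesis .
qed

lemma summable_exp_powr_int:
  fixes K \<beta> :: real
  assumes "K > 0" "\<beta> > 0"
  shows "(\<lambda>n. exp (- K * \<bar>real_of_int n\<bar> powr \<beta>)) summable_on UNIV"
  using summable_on_int_abs[OF summable_exp_powr_nat[OF assms]] by simp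

lemma powr_subadditive:
  fixes x y \<beta> :: real
  assumes "x \<ge> 0" "y \<ge> 0" "0 < \<beta>" "\<beta> \<le> 1"
  shows "(x + y) powr \<beta> \<le> x powr \<beta> + y powr \<beta>"
proof (cases "x + y = 0")
  case False
  then have p: "x + y > 0" using assms by linarith
  have *: "t \<le> t powr \<beta>" if "0 \<le> t" "t \<le> 1" for t :: real
    using powr_mono'[of \<beta> 1 t] that assms by simp
  have "(x + y) powr \<beta> = (x + y) powr \<beta> * (x / (x + y) + y / (x + y))"
    using p by (simp add: add_divide_distrib[symmetric])
  also have "\<dots> \<le> (x + y) powr \<beta> * ((x / (x + y)) powr \<beta> + (y / (x + y)) powr \<beta>)"
    using assms p by (intro mult_left_mono add_mono *) auto
  also have "\<dots> = x powr \<beta> + y powr \<beta>"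
    using assms p by (simp add: distrib_left powr_divide)
  finally show ?thesis .
qed (use assms in \<open>auto simp: add_nonneg_eq_0_iff\<close>)

lemma exp_weight_submult:
  fixes K \<beta> :: real and m n :: int
  assumes "K \<ge> 0" "0 < \<beta>" "\<beta> \<le> 1"
  shows "exp (K * \<bar>real_of_int (m + n)\<bar> powr \<beta>)
    \<le> exp (K * \<bar>real_of_int m\<bar> powr \<beta>) * exp (K * \<bar>real_of_int n\<bar> powr \<beta>)"
proof -
  have "\<bar>real_of_int (m + n)\<bar> powr \<beta> \<le> (\<bar>real_of_int m\<bar> + \<bar>real_of_int n\<bar>) powr \<beta>"
    using assms by (intro powr_mono2) auto
  also have "\<dots> \<le> \<bar>real_of_int m\<bar> powr \<beta> + \<bar>real_of_int n\<bar> powr \<beta>"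
    using assms by (intro powr_subadditive) auto
  finally have "K * \<bar>real_of_int (m + n)\<bar> powr \<beta> \<le> K * (\<bar>real_of_int m\<bar> powr \<beta> + \<bar>real_of_int n\<bar> powr \<beta>)"
    using assms by (intro mult_left_mono) auto
  then show ?thesis by (simp add: exp_add[symmetric] distrib_left)
qed

text \<open>Fubini over the pairs \<open>(k, n)\<close>: summing over \<open>n\<close> first gives
  the power series in \<open>\<phi> w\<close>, summing over \<open>k\<close> first gives its
  coefficients. The summability hypothesis is pointwise in \<open>w\<close>, so circle and disc can
  use different majorants.\<close>

lemma laurent_on_power_series:
  assumes c: "laurent_on c \<phi> D"
    and s: "\<And>w. w \<in> D \<Longrightarrow> (\<lambda>(k, n). cmod (F k * cpow c k n) * cmod w powi n) summable_on UNIV \<times> UNIV"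
  shows "laurent_on (\<lambda>n. \<Sum>\<^sub>\<infinity>k. F k * cpow c k n) (\<lambda>w. \<Sum>\<^sub>\<infinity>k. F k * \<phi> w ^ k) D"
  unfolding laurent_on_def
proof (intro conjI ballI)
  fix w assume w: "w \<in> D"
  have w0: "w \<noteq> 0" using c w by (auto simp: laurent_on_def)
  let ?g = "\<lambda>(k, n). F k * cpow c k n * w powi n"
  have "(\<lambda>p. norm (?g p)) summable_on UNIV \<times> UNIV"
    using s[OF w] by (simp add: case_prod_unfold norm_mult norm_power_int)
  then have gs: "?g summable_on UNIV \<times> UNIV" by (rule abs_summable_summable)
  have inner: "((\<lambda>n. ?g (k, n)) has_sum F k * \<phi> w ^ k) UNIV" for k
    using laurent_onD[OF laurent_on_cpow[OF c] w, THEN has_sum_cmult_right] by (simp add: mult.assoc)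
  have "((\<lambda>k. F k * \<phi> w ^ k) has_sum infsum ?g (UNIV \<times> UNIV)) UNIV"
    by (rule has_sum_SigmaD[OF has_sum_infsum[OF gs]]) (use inner in auto)
  then have e: "infsum ?g (UNIV \<times> UNIV) = (\<Sum>\<^sub>\<infinity>k. F k * \<phi> w ^ k)" by (simp add: infsumI)
  let ?h = "\<lambda>(n, k). ?g (k, n)"
  have hs: "(?h has_sum (\<Sum>\<^sub>\<infinity>k. F k * \<phi> w ^ k)) (UNIV \<times> UNIV)"
    using has_sum_infsum[OF gs] unfolding e by (subst (asm) has_sum_swap) simp
  show "((\<lambda>n. (\<Sum>\<^sub>\<infinity>k. F k * cpow c k n) * w powi n) has_sum (\<Sum>\<^sub>\<infinity>k. F k * \<phi> w ^ k)) UNIV"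
  proof (rule has_sum_SigmaD[OF hs])
    fix n :: int
    have "(\<lambda>k. F k * cpow c k n * w powi n) summable_on UNIV"
      using summable_on_SigmaD1[OF has_sum_imp_summable[OF hs]] by simp
    then have "(\<lambda>k. F k * cpow c k n) summable_on UNIV"
      using w0 by (subst (asm) summable_on_cmult_left') auto
    then show "((\<lambda>k. ?h (n, k)) has_sum (\<Sum>\<^sub>\<infinity>k. F k * cpow c k n) * w powi n) UNIV"
      by (auto intro!: has_sum_cmult_left)
  qed
qed (use c in \<open>auto simp: laurent_on_def\<close>)

text \<open>The loss of a constant in the exponent makes Gelfand's formula unnecessary: the coefficients of
  \<open>\<phi> ^ k\<close> are bounded both by \<open>r ^ k\<close> and by \<open>A ^ k\<close> over the weight, and a geometric
  mean of the two bounds is summable against the coefficients of the power series.\<close>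

lemma wiener_levy:
  fixes F :: "nat \<Rightarrow> complex"
  assumes \<beta>: "0 < \<beta>" "\<beta> \<le> 1" and dec: "subexp_decay \<beta> c" and c: "laurent_on c \<phi> circle"
    and r: "\<And>w. w \<in> circle \<Longrightarrow> cmod (\<phi> w) \<le> r" and rR: "r < R"
    and F: "summable (\<lambda>k. cmod (F k) * R ^ k)"
  shows "\<exists>d. subexp_decay \<beta> d \<and> laurent_on d (\<lambda>w. \<Sum>\<^sub>\<infinity>k. F k * \<phi> w ^ k) circle"
proof -
  obtain C K where K: "K > 0" and C: "\<And>n. cmod (c n) \<le> C * exp (- K * \<bar>real_of_int n\<bar> powr \<beta>)"
    using dec by (auto simp: subexp_decay_def)
  define v where "v n = exp (K / 2 * \<bar>real_of_int n\<bar> powr \<beta>)" for n :: int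
  have v: "\<And>n. v n > 0" "\<And>m n. v (m + n) \<le> v m * v n" "v 0 = 1"
    using \<beta> K exp_weight_submult[of "K / 2" \<beta>] by (auto simp: v_def)
  have sv: "(\<lambda>n. cmod (c n) * v n) summable_on UNIV"
  proof (rule summable_on_comparison_test)
    show "(\<lambda>n. C * exp (- (K / 2) * \<bar>real_of_int n\<bar> powr \<beta>)) summable_on UNIV"
      using summable_exp_powr_int[of "K / 2" \<beta>] K \<beta> by (intro summable_on_cmult_right) auto
    fix n :: int
    have "cmod (c n) * v n \<le> C * exp (- K * \<bar>real_of_int n\<bar> powr \<beta>) * v n"
      using C v(1)[of n] by (intro mult_right_mono) auto
    also have "\<dots> = C * exp (- (K / 2) * \<bar>real_of_int n\<bar> powr \<beta>)"
      by (simp add: v_def mult.assoc exp_add[symmetric])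
    finally show "cmod (c n) * v n \<le> C * exp (- (K / 2) * \<bar>real_of_int n\<bar> powr \<beta>)" .
  qed (use v(1) in \<open>auto simp: less_imp_le\<close>)
  have r0: "r \<ge> 0" using r[of 1] norm_ge_zero[of "\<phi> 1"] by (simp del: norm_ge_zero)
  \<comment> \<open>\<open>r\<close> may be 0; the larger value is positive, as the logarithms below
    require, and still less than \<open>R\<close>.\<close>
  define r' where "r' = max r (R / 2)"
  have r': "0 < r'" "r \<le> r'" "r' < R" using r0 rR by (auto simp: r'_def)
  define A where "A = max R (\<Sum>\<^sub>\<infinity>n. cmod (c n) * v n)"
  have A: "R \<le> A" "(\<Sum>\<^sub>\<infinity>n. cmod (c n) * v n) \<le> A" by (auto simp: A_def)
  \<comment> \<open>Interpolation exponent: taken with exponents \<open>1 - \<theta>\<close> and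
    \<open>\<theta>\<close>, the bounds \<open>r' ^ k\<close> and \<open>A ^ k / v n\<close> combine
    to \<open>R ^ k / v n powr \<theta>\<close>, and the power of the weight no longer depends on
    \<open>k\<close>.\<close>
  define \<theta> where "\<theta> = ln (R / r') / ln (A / r')"
  have lnpos: "ln (R / r') > 0" "ln (A / r') > 0" using r' A by (auto intro!: ln_gt_zero)
  have "ln (R / r') \<le> ln (A / r')" using r' A by (subst ln_le_cancel_iff) (auto simp: divide_simps)
  then have \<theta>: "0 < \<theta>" "\<theta> \<le> 1" using lnpos by (auto simp: \<theta>_def divide_simps)
  have key: "r' powr (1 - \<theta>) * A powr \<theta> = R"
  proof -
    have "r' powr (1 - \<theta>) * A powr \<theta> = r' * (A / r') powr \<theta>"
      using r' A by (simp add: powr_diff powr_divide)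
    also have "(A / r') powr \<theta> = exp (\<theta> * ln (A / r'))" using r' A by (simp add: powr_def)
    also have "\<theta> * ln (A / r') = ln (R / r')" using lnpos by (simp add: \<theta>_def)
    also have "exp (ln (R / r')) = R / r'" using r' by simp
    finally show ?thesis using r' by simp
  qed
  have b1: "cmod (cpow c k n) \<le> r' ^ k" for k n
  proof (rule laurent_on_coeff_le[OF laurent_on_cpow[OF c]])
    fix w assume "w \<in> circle"
    then have "cmod (\<phi> w) \<le> r'" using r r'(2) by fastforce
    then show "cmod (\<phi> w ^ k) \<le> r' ^ k" by (simp add: norm_power power_mono)
  qed
  have b2: "cmod (cpow c k n) \<le> A ^ k / v n" for k n
  proof -
    note cw = cpow_weighted[OF v sv, of k]
    have "cmod (cpow c k n) * v n = sum (\<lambda>n. cmod (cpow c k n) * v n) {n}" by simp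
    also have "\<dots> \<le> (\<Sum>\<^sub>\<infinity>n. cmod (cpow c k n) * v n)"
      by (rule finite_sum_le_infsum) (use cw v(1) in \<open>auto simp: less_imp_le\<close>)
    also have "\<dots> \<le> (\<Sum>\<^sub>\<infinity>n. cmod (c n) * v n) ^ k" using cw by simp
    also have "\<dots> \<le> A ^ k"
      using A v(1) by (intro power_mono infsum_nonneg) (auto simp: less_imp_le)
    finally show ?thesis using v(1)[of n] by (simp add: field_simps)
  qed
  have b: "cmod (cpow c k n) \<le> R ^ k * exp (- (\<theta> * K / 2) * \<bar>real_of_int n\<bar> powr \<beta>)" for k n
  proof (cases "cpow c k n = 0")
    case True
    then show ?thesis using r' by simp
  next
    case False
    let ?x = "cmod (cpow c k n)"
    have "?x = ?x powr (1 - \<theta>) * ?x powr \<theta>" using False by (simp add: powr_add[symmetric])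
    also have "\<dots> \<le> (r' ^ k) powr (1 - \<theta>) * (A ^ k / v n) powr \<theta>"
      using b1[of k n] b2[of k n] \<theta> by (intro mult_mono powr_mono2) auto
    also have "\<dots> = ((r' powr (1 - \<theta>)) ^ k * (A powr \<theta>) ^ k) / v n powr \<theta>"
      using r' A v(1)[of n] by (simp add: powr_divide powr_power powr_realpow[symmetric] powr_powr mult_ac)
    also have "(r' powr (1 - \<theta>)) ^ k * (A powr \<theta>) ^ k = R ^ k"
      by (simp add: key power_mult_distrib[symmetric])
    also have "R ^ k / v n powr \<theta> = R ^ k * exp (- (\<theta> * K / 2) * \<bar>real_of_int n\<bar> powr \<beta>)"
      by (simp add: v_def powr_def exp_minus field_simps)
    finally show ?thesis .
  qed
  define K' where "K' = \<theta> * K / 2"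
  have K': "K' > 0" using \<theta> K by (simp add: K'_def)
  define E where "E n = exp (- K' * \<bar>real_of_int n\<bar> powr \<beta>)" for n :: int
  have bE: "cmod (F k * cpow c k n) \<le> cmod (F k) * R ^ k * E n" for k n
    using mult_left_mono[OF b[of k n], of "cmod (F k)"] by (simp add: norm_mult E_def K'_def mult_ac)
  have Fs: "(\<lambda>k. cmod (F k) * R ^ k) summable_on UNIV"
    using F r' by (intro summable_nonneg_imp_summable_on) auto
  have Es: "E summable_on UNIV" unfolding E_def by (rule summable_exp_powr_int[OF K' \<beta>(1)])
  have E0: "E n \<ge> 0" for n by (simp add: E_def)
  have FE: "(\<lambda>(k, n). cmod (F k) * R ^ k * E n) summable_on UNIV \<times> UNIV"
    by (rule summable_on_SigmaI[where g = "\<lambda>k. cmod (F k) * R ^ k * infsum E UNIV"])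
      (use Fs Es r' E0 in \<open>auto intro!: has_sum_cmult_right summable_on_cmult_left\<close>)
  define d where "d n = (\<Sum>\<^sub>\<infinity>k. F k * cpow c k n)" for n
  have "laurent_on d (\<lambda>w. \<Sum>\<^sub>\<infinity>k. F k * \<phi> w ^ k) circle"
    unfolding d_def
  proof (rule laurent_on_power_series[OF c])
    fix w assume "w \<in> circle"
    then have w: "cmod w = 1" by simp
    show "(\<lambda>(k, n). cmod (F k * cpow c k n) * cmod w powi n) summable_on UNIV \<times> UNIV"
      by (rule summable_on_comparison_test[OF FE]) (use bE w in auto)
  qed
  moreover have "subexp_decay \<beta> d"
    unfolding subexp_decay_def
  proof (intro exI conjI allI)
    fix n
    have s1: "(\<lambda>k. cmod (F k) * R ^ k * E n) summable_on UNIV"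
      using Fs by (rule summable_on_cmult_left)
    have "(\<lambda>k. norm (F k * cpow c k n)) summable_on UNIV"
      by (rule Infinite_Sum.abs_summable_on_comparison_test'[OF s1]) (use bE in auto)
    then have s2: "(\<lambda>k. F k * cpow c k n) summable_on UNIV" by (rule abs_summable_summable)
    have "cmod (d n) \<le> (\<Sum>\<^sub>\<infinity>k. cmod (F k) * R ^ k * E n)"
      unfolding d_def by (rule norm_infsum_le[OF has_sum_infsum[OF s2] has_sum_infsum[OF s1] bE])
    also have "\<dots> = (\<Sum>\<^sub>\<infinity>k. cmod (F k) * R ^ k) * E n"
      by (rule infsum_cmult_left') 
    finally show "cmod (d n) \<le> (\<Sum>\<^sub>\<infinity>k. cmod (F k) * R ^ k) * exp (- K' * \<bar>real_of_int n\<bar> powr \<beta>)"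
      by (simp add: E_def)
  qed (rule K')
  ultimately show ?thesis by blast
qed

lemma exp_infsum: "(\<Sum>\<^sub>\<infinity>k. (1 / fact k) * z ^ k) = exp (z :: complex)"
proof -
  have "summable (\<lambda>k. norm (z ^ k /\<^sub>R fact k))" by (rule summable_norm_exp)
  then have "((\<lambda>k. z ^ k /\<^sub>R fact k) has_sum exp z) UNIV"
    by (rule norm_summable_imp_has_sum) (rule exp_converges)
  then show ?thesis by (intro infsumI) (simp add: scaleR_conv_of_real inverse_eq_divide)
qed

lemma wiener_levy_exp:
  assumes \<beta>: "0 < \<beta>" "\<beta> \<le> 1" and dec: "subexp_decay \<beta> c" and c: "laurent_on c \<phi> circle"
  shows "\<exists>d. subexp_decay \<beta> d \<and> laurent_on d (\<lambda>w. exp (\<phi> w)) circle"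
proof -
  define r where "r = (\<Sum>\<^sub>\<infinity>n. cmod (c n))"
  note s = laurent_on_circle_summable[OF c]
  have r: "cmod (\<phi> w) \<le> r" if "w \<in> circle" for w
    unfolding r_def by (rule norm_infsum_le[OF laurent_onD[OF c that] has_sum_infsum[OF s]])
      (use that in \<open>auto simp: norm_mult norm_power_int\<close>)
  have "summable (\<lambda>k. cmod (1 / fact k) * (r + 1) ^ k)"
    using summable_exp[of "r + 1"] by (simp add: norm_divide inverse_eq_divide)
  from wiener_levy[OF \<beta> dec c r _ this] show ?thesis by (simp only: exp_infsum)
qed

text \<open>The term \<open>k = 0\<close> is zero because division by zero gives zero, so the sum
  over all naturals is the usual logarithmic series.\<close>

lemma ln_infsum:
  assumes "cmod z < 1"
  shows "(\<Sum>\<^sub>\<infinity>k. (- 1 / of_nat k) * z ^ k) = Ln (1 - z)"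
proof -
  have "(\<lambda>n. ((-1) ^ Suc n / of_nat n) * (- z) ^ n) sums ln (1 + (- z))"
    by (rule Ln_series) (use assms in simp)
  moreover have "(\<lambda>n. ((-1) ^ Suc n / of_nat n) * (- z) ^ n) = (\<lambda>n. (- 1 / of_nat n) * z ^ n)"
  proof
    show "((-1) ^ Suc n / of_nat n) * (- z) ^ n = (- 1 / of_nat n) * z ^ n" for n
      by (cases "even n") (auto simp: power_minus_odd)
  qed
  ultimately have sm: "(\<lambda>n. (- 1 / of_nat n) * z ^ n) sums Ln (1 - z)" by (simp only: diff_conv_add_uminus)
  have "summable (\<lambda>n. norm ((- 1 / of_nat n) * z ^ n))"
  proof (rule summable_comparison_test)
    show "summable (\<lambda>n. norm z ^ n)" using assms by (simp add: summable_geometric)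
    have "norm (norm ((- 1 / of_nat n) * z ^ n)) \<le> norm z ^ n" for n
      by (cases "n = 0") (auto simp: norm_mult norm_divide norm_power divide_simps mult_le_cancel_left1)
    then show "\<exists>N. \<forall>n\<ge>N. norm (norm ((- 1 / of_nat n) * z ^ n)) \<le> norm z ^ n" by blast
  qed
  from norm_summable_imp_has_sum[OF this sm] show ?thesis by (rule infsumI)
qed

lemma wiener_levy_ln:
  assumes \<beta>: "0 < \<beta>" "\<beta> \<le> 1" and dec: "subexp_decay \<beta> h" and h: "laurent_on h H circle"
    and H: "\<And>w. w \<in> circle \<Longrightarrow> cmod (H w) \<le> 1/2"
  shows "\<exists>d. subexp_decay \<beta> d \<and> laurent_on d (\<lambda>w. Ln (1 - H w)) circle"
proof -
  \<comment> \<open>The value 3 / 4 is a radius strictly between the bound 1 / 2 on \<open>H\<close>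
    and the radius of convergence 1 of the logarithmic series.\<close>
  have "summable (\<lambda>k. cmod (- 1 / of_nat k) * (3/4) ^ k)"
  proof (rule summable_comparison_test)
    show "summable (\<lambda>n. (3/4 :: real) ^ n)" by (simp add: summable_geometric)
    have "norm (cmod (- 1 / of_nat n) * (3/4) ^ n) \<le> (3/4) ^ n" for n
      by (cases "n = 0") (auto simp: norm_divide divide_simps mult_le_cancel_left1)
    then show "\<exists>N. \<forall>n\<ge>N. norm (cmod (- 1 / of_nat n) * (3/4) ^ n) \<le> (3/4) ^ n" by blast
  qed
  from wiener_levy[OF \<beta> dec h H _ this] obtain d where d: "subexp_decay \<beta> d"
    "laurent_on d (\<lambda>w. \<Sum>\<^sub>\<infinity>k. (- 1 / of_nat k) * H w ^ k) circle" by auto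
  have "laurent_on d (\<lambda>w. Ln (1 - H w)) circle"
    by (rule laurent_on_cong[OF d(2)], rule ln_infsum) (use H in force)
  with d show ?thesis by blast
qed

text \<open>Orders at the origin add and leading coefficients multiply. The orders are integers, so
  the same statement serves Laurent polynomials.\<close>

lemma conv_support:
  assumes "\<And>n. n < i \<Longrightarrow> a n = 0" "\<And>n. n < j \<Longrightarrow> b n = 0"
  shows "n < i + j \<Longrightarrow> conv a b n = 0" and "conv a b (i + j) = a i * b j"
proof -
  have "conv a b n = 0" if "n < i + j" for n
    unfolding conv_def
  proof (rule infsum_0)
    fix m :: int
    show "a m * b (n - m) = 0" using assms(1)[of m] assms(2)[of "n - m"] that by (cases "m < i") auto
  qed
  then show "n < i + j \<Longrightarrow> conv a b n = 0" .
  have "((\<lambda>m. a m * b (i + j - m)) has_sum a i * b j) UNIV"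
  proof (rule has_sum_finite_neutralI[where B = "{i}"])
    fix m :: int assume "m \<in> UNIV - {i}"
    then show "a m * b (i + j - m) = 0" using assms(1)[of m] assms(2)[of "i + j - m"] by (cases "m < i") auto
  qed auto
  then show "conv a b (i + j) = a i * b j" unfolding conv_def by (rule infsumI)
qed

lemma cpow_support:
  assumes "\<And>n. n < 1 \<Longrightarrow> c n = 0"
  shows "n < int k \<Longrightarrow> cpow c k n = 0"
proof (induction k arbitrary: n)
  case (Suc k)
  show ?case using conv_support(1)[of 1 c "int k" "cpow c k" n] assms Suc by simp
qed simp

text \<open>The Wiener-Levy argument lives on the circle, whereas the factors have to exist in the
  whole punctured disc. At each point the weight \<open>cmod w powi n\<close> is multiplicative and
  gives the majorant \<open>A ^ k / fact k\<close>. Positive frequencies in the exponent leave 1 as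
  the constant coefficient.\<close>

lemma laurent_on_exp:
  assumes c: "laurent_on c \<phi> D" and supp: "\<And>n. n < 1 \<Longrightarrow> c n = 0"
  shows "\<exists>d. laurent_on d (\<lambda>w. exp (\<phi> w)) D \<and> d 0 = 1 \<and> (\<forall>n<0. d n = 0)"
proof -
  define d where "d n = (\<Sum>\<^sub>\<infinity>k. (1 / fact k) * cpow c k n)" for n
  have "laurent_on d (\<lambda>w. \<Sum>\<^sub>\<infinity>k. (1 / fact k) * \<phi> w ^ k) D"
    unfolding d_def
  proof (rule laurent_on_power_series[OF c])
    fix w assume w: "w \<in> D"
    have w0: "w \<noteq> 0" using c w by (auto simp: laurent_on_def)
    define v where "v n = cmod w powi n" for n
    have v: "\<And>n. v n > 0" "\<And>m n. v (m + n) \<le> v m * v n" "v 0 = 1"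
      using w0 by (auto simp: v_def power_int_add)
    define A where "A = (\<Sum>\<^sub>\<infinity>n. cmod (c n) * v n)"
    note cw = cpow_weighted[OF v laurent_on_summable[OF c w, folded v_def], folded A_def]
    show "(\<lambda>(k, n). cmod (1 / fact k * cpow c k n) * cmod w powi n) summable_on UNIV \<times> UNIV"
    proof (rule summable_on_SigmaI)
      show "((\<lambda>n. case (k, n) of (k, n) \<Rightarrow> cmod (1 / fact k * cpow c k n) * cmod w powi n) has_sum
          (1 / fact k) * (\<Sum>\<^sub>\<infinity>n. cmod (cpow c k n) * v n)) UNIV" for k
        using has_sum_cmult_right[OF has_sum_infsum[OF conjunct1[OF cw[of k]]], of "1 / fact k"]
        by (simp add: norm_mult norm_divide v_def[symmetric])
      show "(\<lambda>k. (1 / fact k) * (\<Sum>\<^sub>\<infinity>n. cmod (cpow c k n) * v n)) summable_on UNIV"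
      proof (rule summable_on_comparison_test)
        have "summable (\<lambda>k. A ^ k / fact k)"
          using summable_exp[of A] by (simp add: inverse_eq_divide)
        moreover have "A \<ge> 0" unfolding A_def using v(1) by (intro infsum_nonneg) (auto simp: less_imp_le)
        ultimately show "(\<lambda>k. (1 / fact k) * A ^ k) summable_on UNIV"
          by (intro summable_nonneg_imp_summable_on) auto
      qed (use cw v(1) in \<open>auto simp: divide_simps less_imp_le intro!: infsum_nonneg\<close>)
    qed auto
  qed
  then have 1: "laurent_on d (\<lambda>w. exp (\<phi> w)) D" by (simp only: exp_infsum)
  have 2: "d n = 0" if "n < 0" for n
    unfolding d_def by (rule infsum_0) (use cpow_support[of c n, OF supp] that in auto)
  have "((\<lambda>k. (1 / fact k) * cpow c k 0) has_sum 1) UNIV"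
    by (rule has_sum_finite_neutralI[where B = "{0}"]) (use cpow_support[of c 0, OF supp] in auto)
  then have "d 0 = 1" unfolding d_def by (rule infsumI)
  with 1 2 show ?thesis by blast
qed

section \<open>Jost solutions from the Weyl function\<close>

lemma laurent_on_pdisc_continuous:
  assumes "laurent_on c \<phi> pdisc" "\<And>n. n < 0 \<Longrightarrow> c n = 0"
  shows "continuous_on pdisc \<phi>"
proof (rule laurent_on_continuous[OF assms(1)])
  show "(\<lambda>n. cmod (c n)) summable_on UNIV"
    using laurent_on_summable[OF assms(1), of 1] by simp
  fix w :: complex and n :: int assume w: "w \<in> pdisc"
  show "cmod (c n) * cmod w powi n \<le> cmod (c n)"
  proof (cases "n < 0")
    case False
    then have "cmod w powi n \<le> 1" using w by (simp add: power_int_def power_le_one)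
    then show ?thesis by (simp add: mult_left_le)
  qed (use assms(2) in simp)
qed

lemma laurent_on_nonneg_part:
  assumes "laurent_on c \<phi> circle"
  shows "laurent_on (\<lambda>n. if n \<ge> 1 then c n else 0) (\<lambda>w. \<Sum>\<^sub>\<infinity>n. (if n \<ge> 1 then c n else 0) * w powi n) pdisc"
  unfolding laurent_on_def
proof (intro conjI ballI)
  fix w :: complex assume w: "w \<in> pdisc"
  have "(\<lambda>n. norm ((if n \<ge> 1 then c n else 0) * w powi n)) summable_on UNIV"
  proof (rule summable_on_comparison_test[OF laurent_on_circle_summable[OF assms]])
    fix n :: int
    have "n \<ge> 1 \<Longrightarrow> cmod w powi n \<le> 1" using w by (simp add: power_int_def power_le_one)
    then show "norm ((if n \<ge> 1 then c n else 0) * w powi n) \<le> cmod (c n)"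
      by (auto simp: norm_mult norm_power_int mult_left_le)
  qed auto
  then have "(\<lambda>n. (if n \<ge> 1 then c n else 0) * w powi n) summable_on UNIV"
    by (rule abs_summable_summable)
  then show "((\<lambda>n. (if n \<ge> 1 then c n else 0) * w powi n) has_sum
      (\<Sum>\<^sub>\<infinity>n. (if n \<ge> 1 then c n else 0) * w powi n)) UNIV" by simp
qed auto

text \<open>Writing \<open>Ln (1 - H w) = l 0 + g w + g (1 / w)\<close>, one takes
  \<open>f = exp (- g)\<close>, \<open>fi = exp g\<close>,
  \<open>S w = exp (g w - g (1 / w))\<close> and \<open>\<kappa> = exp (l 0)\<close>. Symmetry of
  \<open>h\<close> lets one \<open>g\<close> serve both factors. Decay is recorded for
  \<open>s\<close>, the input of the Marchenko equation.\<close>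

lemma wiener_hopf:
  assumes \<beta>: "0 < \<beta>" "\<beta> \<le> 1" and dec: "subexp_decay \<beta> h" and h: "laurent_on h H circle"
    and H: "\<And>w. w \<in> circle \<Longrightarrow> cmod (H w) \<le> 1/2" and sym: "\<And>n. h (- n) = h n"
  obtains fc f fic fi s S \<kappa> where
    "laurent_on fc f pdisc" "fc 0 = 1" "\<And>n. n < 0 \<Longrightarrow> fc n = 0"
    "laurent_on fic fi pdisc" "\<And>n. n < 0 \<Longrightarrow> fic n = 0"
    "\<And>w. f w * fi w = 1"
    "laurent_on s S circle" "subexp_decay \<beta> s"
    "\<And>w. w \<in> circle \<Longrightarrow> f (inverse w) = S w * f w"
    "\<kappa> \<noteq> 0" "\<And>w. w \<in> circle \<Longrightarrow> f w * f (inverse w) * (1 - H w) = \<kappa>"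
proof -
  obtain l where dl: "subexp_decay \<beta> l" and l: "laurent_on l (\<lambda>w. Ln (1 - H w)) circle"
    using wiener_levy_ln[OF \<beta> dec h H] by blast
  have Hsym: "H (inverse w) = H w" if w: "w \<in> circle" for w
  proof -
    have "((\<lambda>n. h n * w powi n) has_sum H (inverse w)) UNIV"
      using laurent_onD[OF laurent_on_inverse[OF h] w] by (simp add: sym)
    then show ?thesis using laurent_onD[OF h w] by (rule has_sum_unique)
  qed
  have "laurent_on (\<lambda>n. l (- n)) (\<lambda>w. Ln (1 - H w)) circle"
    by (rule laurent_on_cong[OF laurent_on_inverse[OF l]]) (use Hsym in simp)
  then have lsym: "l (- n) = l n" for n
    using laurent_on_unique[OF _ l] by (metis (no_types))
  \<comment> \<open>The constant term stays out of \<open>g\<close> and goes into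
    \<open>\<kappa>\<close>; this normalises \<open>fc 0 = 1\<close>.\<close>
  define gc where "gc n = (if n \<ge> 1 then l n else 0)" for n
  define g where "g w = (\<Sum>\<^sub>\<infinity>n. gc n * w powi n)" for w
  have g: "laurent_on gc g pdisc"
    using laurent_on_nonneg_part[OF l] unfolding g_def gc_def .
  note gcirc = laurent_on_circleI[OF g]
  have split: "Ln (1 - H w) = l 0 + (g w + g (inverse w))" if w: "w \<in> circle" for w
  proof -
    have "laurent_on (\<lambda>n. l 0 * (if n = 0 then 1 else 0) + (gc n + gc (- n)))
        (\<lambda>w. l 0 * w powi 0 + (g w + g (inverse w))) circle"
      by (intro laurent_on_add laurent_on_cmult laurent_on_monom gcirc laurent_on_inverse) auto
    moreover have "(\<lambda>n. l 0 * (if n = 0 then 1 else 0) + (gc n + gc (- n))) = l"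
    proof
      fix n :: int
      consider "n = 0" | "n \<ge> 1" | "n \<le> - 1" by linarith
      then show "l 0 * (if n = 0 then 1 else 0) + (gc n + gc (- n)) = l n"
        by cases (use lsym[of n] in \<open>auto simp: gc_def\<close>)
    qed
    ultimately have "laurent_on l (\<lambda>w. l 0 + (g w + g (inverse w))) circle" by simp
    from laurent_onD[OF this w] laurent_onD[OF l w] show ?thesis by (metis has_sum_unique)
  qed
  have mg: "laurent_on (\<lambda>n. (- 1) * gc n) (\<lambda>w. (- 1) * g w) pdisc" by (rule laurent_on_cmult[OF g])
  obtain fc where fc: "laurent_on fc (\<lambda>w. exp ((-1) * g w)) pdisc" "fc 0 = 1" "\<forall>n<0. fc n = 0"
    using laurent_on_exp[OF mg] by (auto simp: gc_def)
  obtain fic where fic: "laurent_on fic (\<lambda>w. exp (g w)) pdisc" "fic 0 = 1" "\<forall>n<0. fic n = 0"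
    using laurent_on_exp[OF g] by (auto simp: gc_def)
  have sg: "laurent_on (\<lambda>n. gc n - gc (- n)) (\<lambda>w. g w - g (inverse w)) circle"
    by (intro laurent_on_diff gcirc laurent_on_inverse)
  have "subexp_decay \<beta> (\<lambda>n. gc n - gc (- n))"
  proof -
    obtain C K where K: "K > 0" "\<And>n. cmod (l n) \<le> C * exp (- K * \<bar>real_of_int n\<bar> powr \<beta>)"
      using dl by (auto simp: subexp_decay_def)
    have C0: "C \<ge> 0" using order_trans[OF norm_ge_zero K(2)[of 0]] by simp
    have "cmod (gc n - gc (- n)) \<le> C * exp (- K * \<bar>real_of_int n\<bar> powr \<beta>)" for n
      using K(2)[of n] C0 lsym[of n] by (auto simp: gc_def)
    then show ?thesis unfolding subexp_decay_def using K(1) by blast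
  qed
  from wiener_levy_exp[OF \<beta> this sg] obtain s where
    s: "subexp_decay \<beta> s" "laurent_on s (\<lambda>w. exp (g w - g (inverse w))) circle" by blast
  show ?thesis
  proof (rule that[OF fc(1,2) _ fic(1) _ _ s(2,1) _ exp_not_eq_zero[of "l 0"]])
    fix w :: complex assume w: "w \<in> circle"
    have H1: "1 - H w \<noteq> 0" using H[OF w] by auto
    have "exp (l 0) = (1 - H w) * exp (- (g w + g (inverse w)))"
      using split[OF w] H1 by (metis add_diff_cancel_right' exp_Ln exp_diff exp_minus divide_inverse)
    then show "exp ((- 1) * g w) * exp ((- 1) * g (inverse w)) * (1 - H w) = exp (l 0)"
      by (simp add: exp_add[symmetric] mult.commute)
    show "exp ((- 1) * g (inverse w)) = exp (g w - g (inverse w)) * exp ((- 1) * g w)"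
      by (simp add: exp_add[symmetric])
  next
    show "exp ((- 1) * g w) * exp (g w) = 1" for w
      by (simp add: exp_add[symmetric])
  qed (use fc(3) fic(3) in simp_all)
qed

text \<open>For the matrix still to be constructed, \<open>f\<close> will be the Jost solution
  \<open>e 0\<close> at index 0, \<open>S\<close> its scattering function, and \<open>M\<close> an
  affine image of the Weyl function: \<open>M - m 0 = m 1 * e 1 / e 0\<close>.\<close>

locale jost_data =
  fixes \<beta> :: real and m fc fic s :: "int \<Rightarrow> complex" and M H f fi S :: "complex \<Rightarrow> complex"
    and \<kappa> :: complex
  assumes \<beta>: "0 < \<beta>" "\<beta> \<le> 1"
    and M: "laurent_on m M pdisc" "\<And>n. n < 0 \<Longrightarrow> m n = 0"
    and H_le: "\<And>w. w \<in> circle \<Longrightarrow> cmod (H w) \<le> 1/2"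
    and M_diff: "\<And>w. w \<in> circle \<Longrightarrow> M w - M (inverse w) = (w - inverse w) * (1 - H w)"
    and f: "laurent_on fc f pdisc" "fc 0 = 1" "\<And>n. n < 0 \<Longrightarrow> fc n = 0"
    and fi: "laurent_on fic fi pdisc" "\<And>n. n < 0 \<Longrightarrow> fic n = 0"
    and f_fi: "\<And>w. f w * fi w = 1"
    and S: "laurent_on s S circle" "subexp_decay \<beta> s"
      "\<And>w. w \<in> circle \<Longrightarrow> f (inverse w) = S w * f w"
    and \<kappa>: "\<kappa> \<noteq> 0" "\<And>w. w \<in> circle \<Longrightarrow> f w * f (inverse w) * (1 - H w) = \<kappa>"
begin

text \<open>Nondegeneracy of the continued fraction: a solution of too high an order at the origin
  makes the weight \<open>1 - H\<close>, whose real part is positive, orthogonal to \<open>\<bar>U\<bar>\<^sup>2\<close>.\<close>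

lemma nondegenerate:
  assumes x: "laurent_on x X pdisc" "\<And>n. n \<le> N \<Longrightarrow> x n = 0"
    and u: "laurent_on u U circle" "\<And>n. \<bar>n\<bar> > N \<Longrightarrow> u n = 0"
    and XU: "\<And>w. w \<in> circle \<Longrightarrow> X w * f (inverse w) - X (inverse w) * f w = U w"
  shows "u n = 0"
proof -
  define y where "y = conv x fic"
  have y: "laurent_on y (\<lambda>w. X w * fi w) pdisc" unfolding y_def by (rule laurent_on_mult[OF x(1) fi(1)])
  have y0: "y n = 0" if "n \<le> N" for n
    unfolding y_def by (rule conv_support(1)[of "N + 1" x 0 fic]) (use x(2) fi(2) that in auto)
  note yc = laurent_on_circleI[OF y]
  define ub where "ub n = cnj (u (- n))" for n
  have ub: "laurent_on ub (\<lambda>w. cnj (U w)) circle" unfolding ub_def by (rule laurent_on_cnj[OF u(1)])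
  \<comment> \<open>Dividing the relation for \<open>U\<close> by \<open>f w * f (1 / w)\<close>
    expresses \<open>(1 - H) * U\<close> as \<open>\<kappa>\<close> times the antisymmetrisation of
    \<open>X / f\<close>. After multiplication by \<open>cnj U\<close> this is the weighted square
    of \<open>U\<close>.\<close>
  define c where "c n = \<kappa> * (conv ub y n - conv ub (\<lambda>n. y (- n)) n)" for n
  have c: "laurent_on c (\<lambda>w. \<kappa> * (cnj (U w) * (X w * fi w) - cnj (U w) * (X (inverse w) * fi (inverse w)))) circle"
    unfolding c_def by (intro laurent_on_cmult laurent_on_diff laurent_on_mult ub yc laurent_on_inverse[OF yc])
  have c': "laurent_on c (\<lambda>w. (cmod (U w))\<^sup>2 * (1 - H w)) circle"
  proof (rule laurent_on_cong[OF c])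
    fix w :: complex assume w: "w \<in> circle"
    have "\<kappa> * (X w * fi w - X (inverse w) * fi (inverse w))
        = (1 - H w) * ((X w * f (inverse w)) * (f w * fi w) - (X (inverse w) * f w) * (f (inverse w) * fi (inverse w)))"
      unfolding \<kappa>(2)[OF w, symmetric] by (simp add: algebra_simps)
    also have "\<dots> = (1 - H w) * U w" by (simp add: f_fi XU[OF w])
    finally have e: "\<kappa> * (X w * fi w - X (inverse w) * fi (inverse w)) = (1 - H w) * U w" .
    have "\<kappa> * (cnj (U w) * (X w * fi w) - cnj (U w) * (X (inverse w) * fi (inverse w)))
        = cnj (U w) * (\<kappa> * (X w * fi w - X (inverse w) * fi (inverse w)))" by (simp add: algebra_simps)
    also have "\<dots> = (U w * cnj (U w)) * (1 - H w)" unfolding e by (simp add: algebra_simps)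
    finally show "\<kappa> * (cnj (U w) * (X w * fi w) - cnj (U w) * (X (inverse w) * fi (inverse w)))
        = (cmod (U w))\<^sup>2 * (1 - H w)" by (simp add: complex_norm_square del: of_real_power)
  qed
  \<comment> \<open>The frequencies of \<open>cnj U\<close> lie between \<open>- N\<close> and
    \<open>N\<close>, those of \<open>X / f\<close> start beyond \<open>N\<close>: the product has
    no constant term.\<close>
  have "conv ub y 0 = 0" unfolding conv_def
  proof (rule infsum_0)
    show "ub k * y (0 - k) = 0" for k
      using y0[of "- k"] u(2)[of "- k"] by (cases "- k \<le> N") (auto simp: ub_def)
  qed
  moreover have "conv ub (\<lambda>n. y (- n)) 0 = 0" unfolding conv_def
  proof (rule infsum_0)
    show "ub k * y (- (0 - k)) = 0" for k
      using y0[of k] u(2)[of "- k"] by (cases "k \<le> N") (auto simp: ub_def)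
  qed
  ultimately have "c 0 = 0" by (simp add: c_def)
  from laurent_on_coercive[OF u(1) c' H_le this] show ?thesis .
qed

lemma laurent_on_M_part: "laurent_on (\<lambda>n. m n - m 0 * (if n = 0 then 1 else 0)) (\<lambda>w. M w - m 0) pdisc"
  using laurent_on_diff[OF M(1) laurent_on_cmult[OF laurent_on_monom[of pdisc 0], of "m 0"]] by simp

section \<open>Continued fraction and nonvanishing of the off-diagonal entries\<close>

definition x1 :: "int \<Rightarrow> complex"
  where "x1 = conv (\<lambda>n. m n - m 0 * (if n = 0 then 1 else 0)) fc"

lemma x1: "laurent_on x1 (\<lambda>w. (M w - m 0) * f w) pdisc"
  unfolding x1_def by (rule laurent_on_mult[OF laurent_on_M_part f(1)])

lemma x1_support: "n < 1 \<Longrightarrow> x1 n = 0" "x1 1 = m 1"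
proof -
  have 1: "m n - m 0 * (if n = 0 then 1 else 0) = 0" if "n < 1" for n
    using M(2)[of n] that by (cases "n = 0") auto
  show "n < 1 \<Longrightarrow> x1 n = 0"
    unfolding x1_def
    using conv_support(1)[of 1 "\<lambda>n. m n - m 0 * (if n = 0 then 1 else 0)" 0 fc n, OF 1 f(3)] by simp
  have "x1 (1 + 0) = (m 1 - m 0 * (if (1::int) = 0 then 1 else 0)) * fc 0"
    unfolding x1_def by (rule conv_support(2)[OF 1 f(3)])
  then show "x1 1 = m 1" by (simp add: f(2))
qed

text \<open>The factorisation enters here: \<open>f w * f (1 / w)\<close> cancels the factor
  \<open>1 - H\<close> in the odd part of \<open>M\<close> and leaves a Laurent polynomial of degree
  1.\<close>

lemma x1_wronskian:
  assumes w: "w \<in> circle"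
  shows "(M w - m 0) * f w * f (inverse w) - (M (inverse w) - m 0) * f (inverse w) * f w = \<kappa> * (w - inverse w)"
proof -
  have "(M w - m 0) * f w * f (inverse w) - (M (inverse w) - m 0) * f (inverse w) * f w
      = (M w - M (inverse w)) * (f w * f (inverse w))" by (simp add: algebra_simps)
  also have "\<dots> = (w - inverse w) * (f w * f (inverse w) * (1 - H w))"
    by (simp add: M_diff[OF w])
  finally show ?thesis by (simp add: \<kappa>(2)[OF w])
qed

definition v1 :: "int \<Rightarrow> complex"
  where "v1 n = \<kappa> * ((if n = 1 then 1 else 0) - (if n = - 1 then 1 else 0))"

lemma v1: "laurent_on v1 (\<lambda>w. \<kappa> * (w - inverse w)) circle"
proof -
  have "laurent_on v1 (\<lambda>w. \<kappa> * (w powi 1 - w powi (- 1))) circle"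
    unfolding v1_def[abs_def] by (intro laurent_on_cmult laurent_on_diff laurent_on_monom) auto
  then show ?thesis by (simp add: power_int_minus)
qed

text \<open>If \<open>m 1\<close> were zero, \<open>x1\<close> would start at index 2 while its
  Wronskian has only the frequencies 1 and -1, contrary to nondegeneracy with
  \<open>N = 1\<close>.\<close>

lemma m1: "m 1 \<noteq> 0"
proof
  assume m1: "m 1 = 0"
  have "v1 1 = 0"
  proof (rule nondegenerate[OF x1 _ v1])
    show "n \<le> 1 \<Longrightarrow> x1 n = 0" for n using x1_support m1 by (cases "n = 1") auto
  qed (use x1_wronskian in \<open>auto simp: v1_def\<close>)
  then show False using \<kappa> by (simp add: v1_def)
qed

text \<open>Each function has to start one power later than its predecessor. In
  \<open>(w + 1 / w) * e n - e (n - 1) - b n * e n\<close> the coefficient of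
  \<open>w ^ (n - 1)\<close> cancels by normalisation, \<open>cb\<close> is the value of
  \<open>b n\<close> that removes the coefficient of \<open>w ^ n\<close>, and \<open>ca\<close> is
  the coefficient of \<open>w ^ (n + 1)\<close>, by which the next function is divided.\<close>

definition cb :: "(int \<Rightarrow> complex) \<Rightarrow> (int \<Rightarrow> complex) \<Rightarrow> int \<Rightarrow> complex"
  where "cb x y n = y (n + 1) - x n"

definition ca :: "(int \<Rightarrow> complex) \<Rightarrow> (int \<Rightarrow> complex) \<Rightarrow> int \<Rightarrow> complex"
  where "ca x y n = 1 + y (n + 2) - cb x y n * y (n + 1) - x (n + 1)"

fun K :: "nat \<Rightarrow> int \<Rightarrow> complex" where
  "K 0 = fc"
| "K (Suc 0) = (\<lambda>j. x1 j / m 1)"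
| "K (Suc (Suc n)) = (\<lambda>j. (K (Suc n) (j - 1) + K (Suc n) (j + 1) - K n j
      - cb (K n) (K (Suc n)) (int (Suc n)) * K (Suc n) j) / ca (K n) (K (Suc n)) (int (Suc n)))"

definition a :: "nat \<Rightarrow> complex" where "a n = ca (K (n - 1)) (K n) (int n)"
definition b :: "nat \<Rightarrow> complex" where "b n = cb (K (n - 1)) (K n) (int n)"

fun e :: "nat \<Rightarrow> complex \<Rightarrow> complex" where
  "e 0 = f"
| "e (Suc 0) = (\<lambda>w. (M w - m 0) * f w / m 1)"
| "e (Suc (Suc n)) = (\<lambda>w. ((w + inverse w) * e (Suc n) w - e n w - b (Suc n) * e (Suc n) w) / a (Suc n))"

text \<open>The invariant has two opposite halves: order \<open>n\<close> with leading coefficient 1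
  for the power series, and degree \<open>n\<close> for the Laurent polynomial obtained by
  antisymmetrising against \<open>f\<close>. At \<open>n = 0\<close> that polynomial is zero, hence
  the proviso \<open>n > 0\<close>.\<close>

definition good :: "nat \<Rightarrow> bool"
  where "good n \<longleftrightarrow> laurent_on (K n) (e n) pdisc \<and> (\<forall>j<int n. K n j = 0) \<and> K n (int n) = 1 \<and>
    (\<exists>v. laurent_on v (\<lambda>w. e n w * f (inverse w) - e n (inverse w) * f w) circle \<and>
      (\<forall>j. \<bar>j\<bar> > int n \<longrightarrow> v j = 0) \<and> (n > 0 \<longrightarrow> v (int n) \<noteq> 0))"

lemma good_0: "good 0"
proof -
  have "laurent_on (\<lambda>_. 0) (\<lambda>w. f w * f (inverse w) - f (inverse w) * f w) circle"
    by (auto simp: laurent_on_def mult.commute)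
  then show ?thesis unfolding good_def using f by auto
qed

lemma good_1: "good (Suc 0)"
proof -
  have 1: "laurent_on (K (Suc 0)) (e (Suc 0)) pdisc"
    using laurent_on_cmult[OF x1, of "1 / m 1"] by simp
  have "laurent_on (\<lambda>n. (1 / m 1) * v1 n) (\<lambda>w. (1 / m 1) * (\<kappa> * (w - inverse w))) circle"
    by (rule laurent_on_cmult[OF v1])
  then have "laurent_on (\<lambda>n. (1 / m 1) * v1 n)
      (\<lambda>w. e (Suc 0) w * f (inverse w) - e (Suc 0) (inverse w) * f w) circle"
  proof (rule laurent_on_cong)
    fix w :: complex assume "w \<in> circle"
    from x1_wronskian[OF this]
    show "(1 / m 1) * (\<kappa> * (w - inverse w)) = e (Suc 0) w * f (inverse w) - e (Suc 0) (inverse w) * f w"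
      by (simp add: diff_divide_distrib[symmetric])
  qed
  then have "\<exists>v. laurent_on v (\<lambda>w. e (Suc 0) w * f (inverse w) - e (Suc 0) (inverse w) * f w) circle \<and>
      (\<forall>j. \<bar>j\<bar> > int (Suc 0) \<longrightarrow> v j = 0) \<and> (Suc 0 > 0 \<longrightarrow> v (int (Suc 0)) \<noteq> 0)"
    using m1 \<kappa>(1) by (intro exI[of _ "\<lambda>n. (1 / m 1) * v1 n"]) (simp add: v1_def)
  moreover have "\<forall>j<int (Suc 0). K (Suc 0) j = 0" using x1_support(1) by simp
  moreover have "K (Suc 0) (int (Suc 0)) = 1" using x1_support(2) m1 by simp
  ultimately show ?thesis unfolding good_def using 1 by blast
qed

text \<open>Both halves obey the same recurrence. The new numerator has order at least
  \<open>n + 2\<close> and its polynomial has degree exactly \<open>n + 2\<close>. Were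
  \<open>a (Suc n)\<close> zero, the order would exceed the degree, and nondegeneracy would
  annihilate the polynomial.\<close>

lemma good_step:
  assumes g0: "good n" and g1: "good (Suc n)"
  shows "a (Suc n) \<noteq> 0 \<and> good (Suc (Suc n))"
proof -
  obtain v0 where v0: "laurent_on v0 (\<lambda>w. e n w * f (inverse w) - e n (inverse w) * f w) circle"
    "\<And>j. \<bar>j\<bar> > int n \<Longrightarrow> v0 j = 0" using g0 by (auto simp: good_def)
  obtain v where v: "laurent_on v (\<lambda>w. e (Suc n) w * f (inverse w) - e (Suc n) (inverse w) * f w) circle"
    "\<And>j. \<bar>j\<bar> > int (Suc n) \<Longrightarrow> v j = 0" "v (int (Suc n)) \<noteq> 0" using g1 by (auto simp: good_def)
  have k: "laurent_on (K n) (e n) pdisc" "laurent_on (K (Suc n)) (e (Suc n)) pdisc"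
    "\<And>j. j < int n \<Longrightarrow> K n j = 0" "\<And>j. j < int (Suc n) \<Longrightarrow> K (Suc n) j = 0"
    "K n (int n) = 1" "K (Suc n) (int (Suc n)) = 1"
    using g0 g1 by (auto simp: good_def)
  define B where "B = b (Suc n)"
  have step: "laurent_on (\<lambda>j. y (j - 1) + y (j + 1) - x j - B * y j)
      (\<lambda>w. (w + inverse w) * Y w - X w - B * Y w) D"
    if x: "laurent_on x X D" and y: "laurent_on y Y D" for x y X Y D
  proof -
    have "laurent_on (\<lambda>j. y (j - 1) + y (j - (- 1)) - x j - B * y j)
        (\<lambda>w. w powi 1 * Y w + w powi (- 1) * Y w - X w - B * Y w) D"
      by (intro laurent_on_diff laurent_on_add laurent_on_shift laurent_on_cmult x y)
    then show ?thesis by (simp add: power_int_minus distrib_right)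
  qed
  define x where "x j = K (Suc n) (j - 1) + K (Suc n) (j + 1) - K n j - B * K (Suc n) j" for j
  define X where "X w = (w + inverse w) * e (Suc n) w - e n w - B * e (Suc n) w" for w
  have x: "laurent_on x X pdisc" unfolding x_def[abs_def] X_def[abs_def] by (rule step[OF k(1,2)])
  have Bv: "B = K (Suc n) (int n + 2) - K n (int n + 1)"
    by (simp add: B_def b_def cb_def add.commute)
  have xs: "x j = 0" if "j < int n + 2" for j
  proof -
    consider "j < int n" | "j = int n" | "j = int n + 1" using \<open>j < int n + 2\<close> by linarith
    then show ?thesis
      by cases (use k in \<open>auto simp: x_def Bv algebra_simps\<close>)
  qed
  have xa: "x (int n + 2) = a (Suc n)"
    using k by (simp add: x_def a_def ca_def B_def b_def algebra_simps)
  define u where "u j = v (j - 1) + v (j + 1) - v0 j - B * v j" for j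
  define U where "U w = X w * f (inverse w) - X (inverse w) * f w" for w
  have u: "laurent_on u U circle"
  proof (rule laurent_on_cong)
    show "laurent_on u (\<lambda>w. (w + inverse w) * (e (Suc n) w * f (inverse w) - e (Suc n) (inverse w) * f w)
        - (e n w * f (inverse w) - e n (inverse w) * f w)
        - B * (e (Suc n) w * f (inverse w) - e (Suc n) (inverse w) * f w)) circle"
      unfolding u_def[abs_def] by (rule step[OF v0(1) v(1)])
    fix w
    show "(w + inverse w) * (e (Suc n) w * f (inverse w) - e (Suc n) (inverse w) * f w)
        - (e n w * f (inverse w) - e n (inverse w) * f w)
        - B * (e (Suc n) w * f (inverse w) - e (Suc n) (inverse w) * f w) = U w"
      by (simp add: U_def X_def algebra_simps)
  qed
  have us: "u j = 0" if "\<bar>j\<bar> > int n + 2" for j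
    using that v0(2)[of j] v(2)[of j] v(2)[of "j - 1"] v(2)[of "j + 1"] by (simp add: u_def)
  have ul: "u (int n + 2) \<noteq> 0"
    using v0(2)[of "int n + 2"] v(2)[of "int n + 2"] v(2)[of "int n + 3"] v(3)
    by (simp add: u_def algebra_simps)
  have a: "a (Suc n) \<noteq> 0"
  proof
    assume "a (Suc n) = 0"
    then have "x j = 0" if "j \<le> int n + 2" for j using xs[of j] xa that by (cases "j = int n + 2") auto
    from nondegenerate[OF x this u us] have "u (int n + 2) = 0" by (simp add: U_def)
    with ul show False by simp
  qed
  have Kx: "K (Suc (Suc n)) = (\<lambda>j. (1 / a (Suc n)) * x j)"
    by (simp add: x_def a_def B_def b_def fun_eq_iff)
  have eX: "e (Suc (Suc n)) = (\<lambda>w. (1 / a (Suc n)) * X w)"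
    by (simp add: X_def B_def fun_eq_iff)
  have "laurent_on (\<lambda>j. (1 / a (Suc n)) * u j) (\<lambda>w. (1 / a (Suc n)) * U w) circle"
    by (rule laurent_on_cmult[OF u])
  then have "laurent_on (\<lambda>j. (1 / a (Suc n)) * u j)
     (\<lambda>w. e (Suc (Suc n)) w * f (inverse w) - e (Suc (Suc n)) (inverse w) * f w) circle"
    unfolding eX by (rule laurent_on_cong) (simp add: U_def diff_divide_distrib)
  then have "\<exists>v. laurent_on v (\<lambda>w. e (Suc (Suc n)) w * f (inverse w) - e (Suc (Suc n)) (inverse w) * f w) circle \<and>
      (\<forall>j. \<bar>j\<bar> > int (Suc (Suc n)) \<longrightarrow> v j = 0) \<and> (Suc (Suc n) > 0 \<longrightarrow> v (int (Suc (Suc n))) \<noteq> 0)"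
    using us ul a by (intro exI[of _ "\<lambda>j. (1 / a (Suc n)) * u j"]) (auto simp: add.commute)
  moreover have "laurent_on (K (Suc (Suc n))) (e (Suc (Suc n))) pdisc"
    unfolding Kx eX by (rule laurent_on_cmult[OF x])
  moreover have "\<forall>j<int (Suc (Suc n)). K (Suc (Suc n)) j = 0"
    unfolding Kx using xs by auto
  moreover have "K (Suc (Suc n)) (int (Suc (Suc n))) = 1"
    unfolding Kx using xa a by (simp add: add.commute)
  ultimately show ?thesis using a unfolding good_def by blast
qed

lemma good: "good n"
proof -
  have "good n \<and> good (Suc n)"
    by (induction n) (use good_0 good_1 good_step in auto)
  then show ?thesis ..
qed

lemma a_nonzero: "n \<ge> 1 \<Longrightarrow> a n \<noteq> 0"
  using good_step[OF good good, of "n - 1"] by simp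

lemma recurrence:
  assumes "n \<ge> 1"
  shows "(w + inverse w) * e n w = e (n - 1) w + b n * e n w + a n * e (Suc n) w"
proof -
  obtain k where n: "n = Suc k" using assms by (cases n) auto
  have "a (Suc k) \<noteq> 0" by (rule a_nonzero) simp
  then have "a (Suc k) * e (Suc (Suc k)) w = (w + inverse w) * e (Suc k) w - e k w - b (Suc k) * e (Suc k) w"
    unfolding e.simps(3) by (metis nonzero_mult_div_cancel_left times_divide_eq_right)
  then show ?thesis unfolding n by (simp only: diff_Suc_1 algebra_simps)
qed

lemma K_rep: "laurent_on (K n) (e n) pdisc"
  by (rule conjunct1[OF good[of n, unfolded good_def]])

lemma K_support: "j < int n \<Longrightarrow> K n j = 0"
  by (rule conjunct1[OF conjunct2[OF good[of n, unfolded good_def]], rule_format])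

lemma K_diag: "K n (int n) = 1"
  by (rule conjunct1[OF conjunct2[OF conjunct2[OF good[of n, unfolded good_def]]]])

lemma e_continuous: "continuous_on pdisc (e n)"
  by (rule laurent_on_pdisc_continuous[OF K_rep]) (simp add: K_support)

text \<open>With \<open>V\<close> the Laurent polynomial from \<open>good\<close>, division by
  \<open>f\<close> gives \<open>e n (1 / w) = e n w * S w - V w / f w\<close>. The last term has no
  frequency below \<open>- n\<close>, so the coefficients at \<open>- j\<close> with
  \<open>j > n\<close> come from \<open>e n * S\<close> alone.\<close>

lemma marchenko:
  assumes "j > int n"
  shows "K n j = conv (K n) s (- j)"
proof -
  obtain v where v: "laurent_on v (\<lambda>w. e n w * f (inverse w) - e n (inverse w) * f w) circle"
    "\<And>j. \<bar>j\<bar> > int n \<Longrightarrow> v j = 0" using good[of n] unfolding good_def by blast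
  have "laurent_on (\<lambda>j. conv (K n) s j - conv v fic j)
      (\<lambda>w. e n w * S w - (e n w * f (inverse w) - e n (inverse w) * f w) * fi w) circle"
    by (intro laurent_on_diff laurent_on_mult laurent_on_circleI[OF K_rep] S(1) v(1) laurent_on_circleI[OF fi(1)])
  then have l: "laurent_on (\<lambda>j. conv (K n) s j - conv v fic j) (\<lambda>w. e n (inverse w)) circle"
  proof (rule laurent_on_cong)
    fix w :: complex assume w: "w \<in> circle"
    have "e n w * S w - (e n w * f (inverse w) - e n (inverse w) * f w) * fi w
      = e n w * S w - e n w * S w * (f w * fi w) + e n (inverse w) * (f w * fi w)"
      by (simp add: S(3)[OF w] algebra_simps)
    then show "e n w * S w - (e n w * f (inverse w) - e n (inverse w) * f w) * fi w = e n (inverse w)"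
      by (simp add: f_fi)
  qed
  have "(\<lambda>j. K n (- j)) = (\<lambda>j. conv (K n) s j - conv v fic j)"
    by (rule laurent_on_unique[OF laurent_on_inverse[OF laurent_on_circleI[OF K_rep]] l])
  then have "K n (- (- j)) = conv (K n) s (- j) - conv v fic (- j)" by metis
  moreover have "conv v fic (- j) = 0"
    by (rule conv_support(1)[of "- int n" v 0 fic]) (use v(2) fi(2) assms in auto)
  ultimately show ?thesis by simp
qed

section \<open>Decay of the kernel and of the matrix entries\<close>

lemma K_summable: "(\<lambda>j. cmod (K n j)) summable_on X"
  using laurent_on_circle_summable[OF laurent_on_circleI[OF K_rep]] summable_on_subset_banach by blast

definition tail :: "nat \<Rightarrow> real" where "tail n = (\<Sum>\<^sub>\<infinity>j\<in>{int n<..}. cmod (K n j))"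

lemma K_total: "(\<Sum>\<^sub>\<infinity>j. cmod (K n j)) = 1 + tail n"
proof -
  have "(\<Sum>\<^sub>\<infinity>j. cmod (K n j)) = (\<Sum>\<^sub>\<infinity>j\<in>{int n..}. cmod (K n j))"
    by (rule infsum_cong_neutral) (auto simp: K_support)
  also have "{int n..} = insert (int n) {int n<..}" by auto
  also have "(\<Sum>\<^sub>\<infinity>j\<in>insert (int n) {int n<..}. cmod (K n j)) = 1 + tail n"
    unfolding tail_def by (subst infsum_insert) (auto simp: K_summable K_diag)
  finally show ?thesis .
qed

lemma tail_nonneg: "tail n \<ge> 0" unfolding tail_def by (intro infsum_nonneg) auto

text \<open>For \<open>j > int n\<close> the Marchenko equation pairs \<open>K n\<close> only with
  coefficients of \<open>s\<close> at indices of modulus at least \<open>j + n\<close>. For large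
  \<open>n\<close> these have small sum, which bounds \<open>tail n\<close> by a fraction of
  \<open>1 + tail n\<close>; inserting that bound gives the pointwise decay.\<close>

lemma K_bound:
  obtains C c N where "C \<ge> 0" "c > 0" "\<And>n. n \<ge> N \<Longrightarrow> tail n \<le> 1/2"
    "\<And>n j. n \<ge> N \<Longrightarrow> j > int n \<Longrightarrow> cmod (K n j) \<le> C * exp (- c * real n powr \<beta>)"
proof -
  obtain C c where c: "c > 0" and C: "\<And>n. cmod (s n) \<le> C * exp (- c * \<bar>real_of_int n\<bar> powr \<beta>)"
    using S(2) by (auto simp: subexp_decay_def)
  have C0: "C \<ge> 0" using order_trans[OF norm_ge_zero C[of 0]] by simp
  define E where "E k = C * exp (- c * real_of_int k powr \<beta>)" for k :: int
  have E0: "E k \<ge> 0" for k using C0 by (simp add: E_def)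
  have Emono: "E k \<le> E i" if "0 \<le> i" "i \<le> k" for i k
  proof -
    have "real_of_int i powr \<beta> \<le> real_of_int k powr \<beta>"
      using that \<beta> by (intro powr_mono2) auto
    then show ?thesis unfolding E_def using c C0 by (intro mult_left_mono) auto
  qed
  have one: "cmod (K n j) \<le> E (j + int n) * (1 + tail n)" if j: "j > int n" for n j
  proof -
    have cs: "((\<lambda>l. K n l * s (- j - l)) has_sum K n j) UNIV"
    proof -
      have "(\<lambda>l. K n l * s (- j - l)) summable_on UNIV"
        using product_summable_diag(2)[OF K_summable laurent_on_circle_summable[OF S(1)], THEN has_sum_imp_summable, of n]
        by (rule summable_on_SigmaD1) simp
      then show ?thesis unfolding marchenko[OF j] conv_def by simp
    qed
    have "cmod (K n j) \<le> (\<Sum>\<^sub>\<infinity>l. E (j + int n) * cmod (K n l))"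
    proof (rule norm_infsum_le[OF cs has_sum_infsum])
      show "(\<lambda>l. E (j + int n) * cmod (K n l)) summable_on UNIV"
        by (rule summable_on_cmult_right[OF K_summable])
      fix l :: int
      show "cmod (K n l * s (- j - l)) \<le> E (j + int n) * cmod (K n l)"
      proof (cases "l < int n")
        case False
        have "cmod (s (- j - l)) \<le> E (j + l)"
          using C[of "- j - l"] j False by (simp add: E_def abs_if add.commute)
        also have "\<dots> \<le> E (j + int n)" using j False by (intro Emono) auto
        finally show ?thesis using mult_right_mono[of "cmod (s (- j - l))" "E (j + int n)" "cmod (K n l)"]
          by (simp add: norm_mult mult.commute)
      qed (simp add: K_support)
    qed
    also have "\<dots> = E (j + int n) * (1 + tail n)"
      by (simp add: infsum_cmult_right' K_total)
    finally show ?thesis .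
  qed
  have Esum: "E summable_on X" if "X \<subseteq> {0..}" for X
  proof -
    have "(\<lambda>k. C * exp (- c * \<bar>real_of_int k\<bar> powr \<beta>)) summable_on UNIV"
      by (rule summable_on_cmult_right[OF summable_exp_powr_int[OF c \<beta>(1)]])
    then have "(\<lambda>k. C * exp (- c * \<bar>real_of_int k\<bar> powr \<beta>)) summable_on X"
      using summable_on_subset_banach by blast
    also have "?this \<longleftrightarrow> E summable_on X"
      by (rule summable_on_cong) (use that in \<open>auto simp: E_def\<close>)
    finally show ?thesis .
  qed
  \<comment> \<open>A remaining mass of 1 / 3 gives \<open>tail n \<le> (1 + tail n) / 3\<close>,
    that is, \<open>tail n \<le> 1 / 2\<close>, for all \<open>n\<close> from an \<open>N\<close>
    beyond \<open>F\<close> on.\<close>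
  obtain F where F: "finite F" "F \<subseteq> {0..}" "dist (sum E F) (infsum E {0..}) \<le> 1/3"
    using infsum_finite_approximation[OF Esum[of "{0..}"], of "1/3"] by auto
  obtain N where N: "\<And>k. k \<in> F \<Longrightarrow> k < int N"
  proof
    fix k assume k: "k \<in> F"
    have "k \<le> (\<Sum>k\<in>F. k)" by (rule member_le_sum) (use F k in auto)
    then show "k < int (nat (\<Sum>k\<in>F. k) + 1)" by linarith
  qed
  have half: "tail n \<le> 1/2" if n: "n \<ge> N" for n
  proof -
    let ?h = "\<lambda>j. j + int n"
    have "tail n \<le> (\<Sum>\<^sub>\<infinity>j\<in>{int n<..}. E (j + int n) * (1 + tail n))"
      unfolding tail_def[of n]
    proof (rule infsum_mono[OF K_summable])
      have "E summable_on ?h ` {int n<..}" by (rule Esum) auto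
      then have "(\<lambda>j. E (j + int n)) summable_on {int n<..}"
        by (subst (asm) summable_on_reindex) (auto simp: o_def)
      then show "(\<lambda>j. E (j + int n) * (1 + (\<Sum>\<^sub>\<infinity>j\<in>{int n<..}. cmod (K n j)))) summable_on {int n<..}"
        by (rule summable_on_cmult_left)
    qed (use one in \<open>auto simp: tail_def\<close>)
    also have "\<dots> = (\<Sum>\<^sub>\<infinity>j\<in>{int n<..}. E (j + int n)) * (1 + tail n)"
      by (rule infsum_cmult_left')
    also have "(\<Sum>\<^sub>\<infinity>j\<in>{int n<..}. E (j + int n)) = infsum E (?h ` {int n<..})"
      by (subst infsum_reindex) (auto simp: o_def)
    also have "infsum E (?h ` {int n<..}) \<le> infsum E ({0..} - F)"
      by (rule infsum_mono_neutral) (use N n E0 in \<open>auto intro!: Esum dest!: N\<close>)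
    also have "infsum E ({0..} - F) = infsum E {0..} - infsum E F"
      by (rule infsum_Diff) (use F Esum in auto)
    also have "infsum E F = sum E F" using F by simp
    also have "infsum E {0..} - sum E F \<le> 1/3" using F(3) unfolding dist_real_def by linarith
    finally have "tail n \<le> 1/3 * (1 + tail n)" using tail_nonneg[of n] by (simp add: mult_right_mono)
    then show ?thesis by simp
  qed
  show ?thesis
  proof (rule that[of "C * (3/2)" c N])
    fix n j assume n: "n \<ge> N" and j: "j > int n"
    have "cmod (K n j) \<le> E (j + int n) * (1 + tail n)" by (rule one[OF j])
    also have "\<dots> \<le> E (int n) * (3/2)"
      using half[OF n] j E0 tail_nonneg[of n] by (intro mult_mono Emono) auto
    finally show "cmod (K n j) \<le> C * (3/2) * exp (- c * real n powr \<beta>)"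
      by (simp add: E_def mult_ac)
  qed (use C0 c half in auto)
qed

text \<open>All powers other than \<open>w ^ n\<close> in the series have larger exponent, so the
  deviation is at most \<open>cmod w ^ n * tail n\<close>, uniformly up to the circle.\<close>

lemma e_asymptotics:
  obtains N where "\<And>n w. n \<ge> N \<Longrightarrow> w \<in> pdisc \<Longrightarrow> cmod (e n w - w ^ n) \<le> cmod w ^ n / 2"
proof -
  obtain C c N where N: "\<And>n. n \<ge> N \<Longrightarrow> tail n \<le> 1/2" by (rule K_bound) blast
  show ?thesis
  proof (rule that[of N])
    fix n w assume n: "n \<ge> N" and w: "w \<in> pdisc"
    have "((\<lambda>j. K n j * w powi j) has_sum (e n w - (\<Sum>j\<in>{int n}. K n j * w powi j))) (UNIV - {int n})"
      by (rule has_sum_Diff[OF laurent_onD[OF K_rep w]]) (auto intro!: has_sum_finiteI)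
    then have 1: "((\<lambda>j. K n j * w powi j) has_sum (e n w - w ^ n)) (UNIV - {int n})"
      by (simp add: K_diag)
    have "((\<lambda>j. cmod (K n j)) has_sum ((1 + tail n) - (\<Sum>j\<in>{int n}. cmod (K n j)))) (UNIV - {int n})"
      by (rule has_sum_Diff) (use K_total[of n] K_summable[of n UNIV] in \<open>auto simp: has_sum_iff\<close>)
    then have "((\<lambda>j. cmod w ^ n * cmod (K n j)) has_sum (cmod w ^ n * tail n)) (UNIV - {int n})"
      by (intro has_sum_cmult_right) (simp add: K_diag)
    then have "cmod (e n w - w ^ n) \<le> cmod w ^ n * tail n"
    proof (rule norm_infsum_le[OF 1])
      fix j assume "j \<in> UNIV - {int n}"
      show "cmod (K n j * w powi j) \<le> cmod w ^ n * cmod (K n j)"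
      proof (cases "j < int n")
        case False
        then have "cmod w powi j \<le> cmod w ^ n"
          using w by (auto simp: power_int_def intro!: power_decreasing)
        then show ?thesis using mult_right_mono[of "cmod w powi j" "cmod w ^ n" "cmod (K n j)"]
          by (simp add: norm_mult norm_power_int mult.commute)
      qed (simp add: K_support)
    qed
    also have "\<dots> \<le> cmod w ^ n * (1/2)" using N[OF n] by (intro mult_left_mono) auto
    finally show "cmod (e n w - w ^ n) \<le> cmod w ^ n / 2" by simp
  qed
qed

lemma coefficient_decay:
  obtains C c where "c > 0" "\<And>n. cmod (b n) + cmod (a n - 1) \<le> C * exp (- c * real n powr \<beta>)"
proof -
  obtain C c N where C: "C \<ge> 0" and c: "c > 0"
    and B: "\<And>n j. n \<ge> N \<Longrightarrow> j > int n \<Longrightarrow> cmod (K n j) \<le> C * exp (- c * real n powr \<beta>)"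
    by (rule K_bound) blast
  define E where "E n = exp (- c * real n powr \<beta>)" for n
  have E: "0 < E n" "E n \<le> 1" for n using c by (auto simp: E_def)
  \<comment> \<open>The factor \<open>exp c\<close> pays for the shift from \<open>n - 1\<close> to
    \<open>n\<close> in the exponent, by subadditivity of the power.\<close>
  define D where "D = C * exp c"
  have D0: "D \<ge> 0" "C \<le> D" using C c mult_left_mono[of 1 "exp c" C] by (auto simp: D_def)
  have B1: "cmod (K n j) \<le> D * E n" if "n \<ge> N" "j > int n" for n j
  proof -
    have "cmod (K n j) \<le> C * E n" using B[OF that] by (simp add: E_def)
    also have "\<dots> \<le> D * E n" using D0 E[of n] by (intro mult_right_mono) auto
    finally show ?thesis .
  qed
  have B0: "cmod (K (n - 1) j) \<le> D * E n" if "n \<ge> N + 1" "j > int n - 1" for n j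
  proof -
    have "real n powr \<beta> = (real (n - 1) + 1) powr \<beta>" using that by (simp add: of_nat_diff)
    also have "\<dots> \<le> real (n - 1) powr \<beta> + 1 powr \<beta>" using \<beta> by (intro powr_subadditive) auto
    finally have "c * real n powr \<beta> \<le> c * (real (n - 1) powr \<beta> + 1)" using c by (intro mult_left_mono) auto
    then have le: "exp (- c * real (n - 1) powr \<beta>) \<le> exp (c + (- c * real n powr \<beta>))"
      by (simp add: algebra_simps)
    have "cmod (K (n - 1) j) \<le> C * exp (- c * real (n - 1) powr \<beta>)" using that by (intro B) auto
    also have "\<dots> \<le> C * exp (c + (- c * real n powr \<beta>))" using le C by (rule mult_left_mono)
    also have "\<dots> = D * E n" by (simp add: D_def E_def exp_add[symmetric] mult.assoc)
    finally show ?thesis .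
  qed
  define g where "g n = cmod (b n) + cmod (a n - 1)" for n
  have big: "g n \<le> (4 * D + 2 * D * D) * E n" if n: "n \<ge> N + 1" for n
  proof -
    have k1: "cmod (K n (int n + 1)) \<le> D * E n" "cmod (K n (int n + 2)) \<le> D * E n"
      using n by (auto intro!: B1)
    have k0: "cmod (K (n - 1) (int n)) \<le> D * E n" "cmod (K (n - 1) (int n + 1)) \<le> D * E n"
      using n B0[of n] by auto
    have b: "cmod (b n) \<le> 2 * D * E n"
      using norm_triangle_ineq4[of "K n (int n + 1)" "K (n - 1) (int n)"] k1 k0 by (simp add: b_def cb_def)
    have "cmod (b n * K n (int n + 1)) \<le> (2 * D * E n) * (D * E n)"
      unfolding norm_mult using b k1 D0 E[of n] by (intro mult_mono) auto
    also have "\<dots> \<le> (2 * D * E n) * (D * 1)" using D0 E[of n] by (intro mult_left_mono) auto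
    finally have bk: "cmod (b n * K n (int n + 1)) \<le> 2 * D * D * E n" by (simp add: mult_ac)
    have "a n - 1 = K n (int n + 2) - b n * K n (int n + 1) - K (n - 1) (int n + 1)"
      by (simp add: a_def ca_def b_def)
    then have "cmod (a n - 1) \<le> cmod (K n (int n + 2)) + cmod (b n * K n (int n + 1)) + cmod (K (n - 1) (int n + 1))"
      using norm_triangle_ineq4[of "K n (int n + 2) - b n * K n (int n + 1)" "K (n - 1) (int n + 1)"]
        norm_triangle_ineq4[of "K n (int n + 2)" "b n * K n (int n + 1)"] by simp
    then show ?thesis using b bk k1 k0 by (simp add: g_def algebra_simps)
  qed
  \<comment> \<open>The finitely many indices up to \<open>N\<close> are absorbed into the
    constant.\<close>
  define Q where "Q = (4 * D + 2 * D * D) + (\<Sum>i\<le>N. g i / E i)"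
  have g0: "g n / E n \<ge> 0" for n using E[of n] by (simp add: g_def)
  have S0: "(\<Sum>i\<le>N. g i / E i) \<ge> 0" using g0 by (intro sum_nonneg) auto
  have "g n \<le> Q * E n" for n
  proof (cases "n \<le> N")
    case True
    have "g n / E n \<le> (\<Sum>i\<le>N. g i / E i)" by (rule member_le_sum) (use True g0 in auto)
    also have "\<dots> \<le> Q" using D0 by (simp add: Q_def)
    finally show ?thesis using E[of n] by (simp add: field_simps)
  next
    case False
    then have "g n \<le> (4 * D + 2 * D * D) * E n" by (intro big) auto
    also have "\<dots> \<le> Q * E n" using S0 E[of n] by (intro mult_right_mono) (auto simp: Q_def)
    finally show ?thesis .
  qed
  then show ?thesis using that[of c Q] c by (simp add: g_def E_def)
qed

text \<open>Put \<open>y 0 = e 0 + (m 1 / m 0) * e 1\<close>, which equals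
  \<open>f * M / m 0\<close>, and subtract \<open>m 1 / m 0\<close> from the first diagonal entry.
  The recurrence at \<open>n = 1\<close> survives, and vanishing at index 0 now means
  \<open>M = 0\<close> instead of \<open>f = 0\<close>, which never happens.\<close>

lemma jacobi_solutions:
  assumes m0: "m 0 \<noteq> 0"
  obtains A B y C c N G where
    "\<And>n. n \<ge> 1 \<Longrightarrow> A n \<noteq> 0" "c > 0"
    "\<And>n. n \<ge> 1 \<Longrightarrow> cmod (B n) + cmod (A n - 1) \<le> C * exp (- c * real n powr \<beta>)"
    "\<And>n w. n \<ge> 1 \<Longrightarrow> w \<in> pdisc \<Longrightarrow> (w + inverse w) * y n w = y (n - 1) w + B n * y n w + A n * y (Suc n) w"
    "\<And>n w. n \<ge> N \<Longrightarrow> w \<in> pdisc \<Longrightarrow> cmod (y n w - w ^ n) \<le> cmod w ^ n / 2"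
    "\<And>n. continuous_on pdisc (y n)"
    "\<And>w. w \<in> pdisc \<Longrightarrow> y 0 w = G w * M w" "continuous_on pdisc G" "\<And>w. G w \<noteq> 0"
proof -
  obtain N where N: "\<And>n w. n \<ge> N \<Longrightarrow> w \<in> pdisc \<Longrightarrow> cmod (e n w - w ^ n) \<le> cmod w ^ n / 2"
    by (rule e_asymptotics) blast
  obtain C c where c: "c > 0" and C: "\<And>n. cmod (b n) + cmod (a n - 1) \<le> C * exp (- c * real n powr \<beta>)"
    by (rule coefficient_decay) blast
  define y where "y n w = (if n = 0 then f w * M w / m 0 else e n w)" for n w
  define B where "B n = (if n = 1 then b 1 - m 1 / m 0 else b n)" for n
  define C' where "C' = C + cmod (m 1 / m 0) * exp c"
  have fc: "continuous_on pdisc f" by (rule laurent_on_pdisc_continuous[OF f(1,3)])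
  have Mc: "continuous_on pdisc M" by (rule laurent_on_pdisc_continuous[OF M])
  have fn: "f w \<noteq> 0" for w using f_fi[of w] by auto
  have ye: "n \<ge> 1 \<Longrightarrow> y n w = e n w" for n w by (simp add: y_def)
  show ?thesis
  proof (rule that[of a c B C' y "max N 1" "\<lambda>w. f w / m 0"])
    show "cmod (B n) + cmod (a n - 1) \<le> C' * exp (- c * real n powr \<beta>)" if "n \<ge> 1" for n
    proof (cases "n = 1")
      case True
      have "cmod (B 1) \<le> cmod (b 1) + cmod (m 1 / m 0)"
        unfolding B_def using norm_triangle_ineq4 by simp
      then show ?thesis using True C[of 1] by (simp add: C'_def distrib_right mult.assoc exp_add[symmetric])
    next
      case False
      have "C * exp (- c * real n powr \<beta>) \<le> C' * exp (- c * real n powr \<beta>)"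
        unfolding C'_def by (intro mult_right_mono) auto
      moreover have "cmod (B n) = cmod (b n)" using False by (simp add: B_def)
      ultimately show ?thesis using C[of n] by linarith
    qed
    show "(w + inverse w) * y n w = y (n - 1) w + B n * y n w + a n * y (Suc n) w"
      if n: "n \<ge> 1" and w: "w \<in> pdisc" for n w
    proof (cases "n = 1")
      case True
      have e1: "e 1 w = (M w - m 0) * f w / m 1" by simp
      have "(w + inverse w) * e 1 w = f w + b 1 * e 1 w + a 1 * e (Suc 1) w"
        using recurrence[of 1 w] by (simp only: diff_self_eq_0 e.simps(1) order_refl)
      moreover have "f w = f w * M w / m 0 - m 1 / m 0 * e 1 w"
        unfolding e1 using m0 m1 by (simp add: field_simps)
      ultimately have "(w + inverse w) * e 1 w
          = f w * M w / m 0 - m 1 / m 0 * e 1 w + b 1 * e 1 w + a 1 * e (Suc 1) w" by simp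
      also have "\<dots> = f w * M w / m 0 + (b 1 - m 1 / m 0) * e 1 w + a 1 * e (Suc 1) w"
        by (simp only: algebra_simps)
      finally show ?thesis unfolding True y_def B_def
        by (simp only: diff_self_eq_0 if_True if_False one_neq_zero nat.distinct simp_thms)
    next
      case False
      then show ?thesis using recurrence[OF n, of w] n unfolding y_def B_def by auto
    qed
    show "continuous_on pdisc (y n)" for n
      by (cases "n = 0") (auto simp: y_def[abs_def] intro!: continuous_intros fc Mc e_continuous m0)
    show "y 0 w = f w / m 0 * M w" for w by (simp add: y_def)
    show "cmod (y n w - w ^ n) \<le> cmod w ^ n / 2" if "n \<ge> max N 1" "w \<in> pdisc" for n w
      using N[of n w] that by (simp add: ye)
    show "continuous_on pdisc (\<lambda>w. f w / m 0)" using m0 by (intro continuous_intros fc) auto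
  qed (use a_nonzero c fn m0 in auto)
qed

end

section \<open>Spectrum of a Jacobi matrix with Jost solutions\<close>

lemma prod_norm_le_exp_sum:
  fixes a :: "nat \<Rightarrow> complex"
  shows "cmod (\<Prod>i=1..n. a i) \<le> exp (\<Sum>i=1..n. cmod (a i - 1))"
proof (induction n)
  case (Suc n)
  have "cmod (a (Suc n)) \<le> 1 + cmod (a (Suc n) - 1)"
    using norm_triangle_ineq[of 1 "a (Suc n) - 1"] by simp
  also have "\<dots> \<le> exp (cmod (a (Suc n) - 1))" by (rule exp_ge_add_one_self)
  finally have "cmod (\<Prod>i=1..n. a i) * cmod (a (Suc n))
      \<le> exp (\<Sum>i=1..n. cmod (a i - 1)) * exp (cmod (a (Suc n) - 1))"
    using Suc by (intro mult_mono) auto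
  then show ?case by (simp add: norm_mult exp_add)
qed simp

text \<open>This is \<open>J - z\<close> with subdiagonal entries 1. At \<open>n = 1\<close> it
  reads \<open>v 0\<close>, which is zero on \<open>ell2\<close> but not for every Jost solution;
  its vanishing is the boundary condition.\<close>

definition jacobi_op :: "(nat \<Rightarrow> complex) \<Rightarrow> (nat \<Rightarrow> complex) \<Rightarrow> complex \<Rightarrow> (nat \<Rightarrow> complex) \<Rightarrow> nat \<Rightarrow> complex"
  where "jacobi_op A B z v n = (if n = 0 then 0 else v (n - 1) + B n * v n + A n * v (Suc n)) - z * v n"

locale jacobi_jost =
  fixes \<beta> C c :: real and N :: nat and A B :: "nat \<Rightarrow> complex" and y :: "nat \<Rightarrow> complex \<Rightarrow> complex"
    and G M :: "complex \<Rightarrow> complex"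
  assumes \<beta>: "0 < \<beta>" and A0: "\<And>n. n \<ge> 1 \<Longrightarrow> A n \<noteq> 0" and c: "c > 0"
    and decay: "\<And>n. n \<ge> 1 \<Longrightarrow> cmod (B n) + cmod (A n - 1) \<le> C * exp (- c * real n powr \<beta>)"
    and recur: "\<And>n w. n \<ge> 1 \<Longrightarrow> w \<in> pdisc \<Longrightarrow>
      (w + inverse w) * y n w = y (n - 1) w + B n * y n w + A n * y (Suc n) w"
    and asymp: "\<And>n w. n \<ge> N \<Longrightarrow> w \<in> pdisc \<Longrightarrow> cmod (y n w - w ^ n) \<le> cmod w ^ n / 2"
    and y_cont: "\<And>n. continuous_on pdisc (y n)"
    and y0: "\<And>w. w \<in> pdisc \<Longrightarrow> y 0 w = G w * M w"
    and G_cont: "continuous_on pdisc G" and G0: "\<And>w. G w \<noteq> 0"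
begin

text \<open>With subdiagonal 1 and superdiagonal \<open>A\<close> the matrix is not symmetric. These
  products are the weights that make it symmetric as a bilinear form; \<open>pr k\<close> belongs to
  index \<open>k + 1\<close>.\<close>

definition pr :: "nat \<Rightarrow> complex" where "pr n = (\<Prod>i=1..n. A i)"

lemma pr_0: "pr 0 = 1" and pr_Suc: "pr (Suc n) = pr n * A (Suc n)"
  by (simp_all add: pr_def)

lemma pr_nonzero: "pr n \<noteq> 0"
  unfolding pr_def using A0 by auto

lemma pr_bounded: obtains P where "P > 0" "\<And>n. cmod (pr n) \<le> P"
proof -
  have s: "summable (\<lambda>n. C * exp (- c * real n powr \<beta>))"
    by (intro summable_mult summable_exp_powr_nat c \<beta>)
  have C0: "C \<ge> 0"
    using order_trans[OF add_nonneg_nonneg[OF norm_ge_zero norm_ge_zero] decay[of 1]] by (simp add: zero_le_mult_iff)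
  have "cmod (pr n) \<le> exp (suminf (\<lambda>n. C * exp (- c * real n powr \<beta>)))" for n
  proof -
    have "(\<Sum>i=1..n. cmod (A i - 1)) \<le> (\<Sum>i=1..n. C * exp (- c * real i powr \<beta>))"
    proof (rule sum_mono)
      fix i assume "i \<in> {1..n}"
      then show "cmod (A i - 1) \<le> C * exp (- c * real i powr \<beta>)"
        using decay[of i] norm_ge_zero[of "B i"] unfolding atLeastAtMost_iff by linarith
    qed
    also have "\<dots> \<le> suminf (\<lambda>n. C * exp (- c * real n powr \<beta>))"
      by (rule sum_le_suminf[OF s]) (use C0 in auto)
    finally have "exp (\<Sum>i=1..n. cmod (A i - 1)) \<le> exp (suminf (\<lambda>n. C * exp (- c * real n powr \<beta>)))"
      by simp
    then show ?thesis using prod_norm_le_exp_sum[of A n] unfolding pr_def by linarith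
  qed
  then show ?thesis using that[of "exp (suminf (\<lambda>n. C * exp (- c * real n powr \<beta>)))"] by simp
qed

text \<open>A discrete Green formula. Equal parameters and \<open>r = 0\<close> compare solutions,
  different parameters give a derivative in the spectral parameter, and a source \<open>r\<close>
  detects Jordan chains.\<close>

lemma wronskian_step:
  fixes v u r :: "nat \<Rightarrow> complex"
  assumes v: "\<And>n. n \<ge> 1 \<Longrightarrow> z * v n = v (n - 1) + B n * v n + A n * v (Suc n) + r n"
    and u: "\<And>n. n \<ge> 1 \<Longrightarrow> z' * u n = u (n - 1) + B n * u n + A n * u (Suc n)"
  shows "pr n * (v n * u (Suc n) - v (Suc n) * u n)
    = (v 0 * u 1 - v 1 * u 0) + (\<Sum>k<n. pr k * ((z' - z) * (v (Suc k) * u (Suc k)) + r (Suc k) * u (Suc k)))"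
proof (induction n)
  case 0
  show ?case by (simp add: pr_0)
next
  case (Suc n)
  have v': "A (Suc n) * v (Suc (Suc n)) = z * v (Suc n) - v n - B (Suc n) * v (Suc n) - r (Suc n)"
    using v[of "Suc n"] by simp
  have u': "A (Suc n) * u (Suc (Suc n)) = z' * u (Suc n) - u n - B (Suc n) * u (Suc n)"
    using u[of "Suc n"] by simp
  have "pr (Suc n) * (v (Suc n) * u (Suc (Suc n)) - v (Suc (Suc n)) * u (Suc n))
     = pr n * (v (Suc n) * (A (Suc n) * u (Suc (Suc n))) - (A (Suc n) * v (Suc (Suc n))) * u (Suc n))"
    by (simp add: pr_Suc algebra_simps)
  also have "\<dots> = pr n * (v n * u (Suc n) - v (Suc n) * u n)
      + pr n * ((z' - z) * (v (Suc n) * u (Suc n)) + r (Suc n) * u (Suc n))"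
    unfolding v' u' by (simp add: algebra_simps)
  finally show ?case unfolding Suc by simp
qed

text \<open>The weights \<open>pr\<close> are bounded and both sequences tend to zero, so the
  boundary term at infinity disappears.\<close>

lemma wronskian_sums:
  fixes v u r :: "nat \<Rightarrow> complex"
  assumes v: "\<And>n. n \<ge> 1 \<Longrightarrow> z * v n = v (n - 1) + B n * v n + A n * v (Suc n) + r n"
    and u: "\<And>n. n \<ge> 1 \<Longrightarrow> z' * u n = u (n - 1) + B n * u n + A n * u (Suc n)"
    and v0: "v \<longlonglongrightarrow> 0" and u0: "u \<longlonglongrightarrow> 0"
  shows "(\<lambda>k. pr k * ((z' - z) * (v (Suc k) * u (Suc k)) + r (Suc k) * u (Suc k))) sums - (v 0 * u 1 - v 1 * u 0)"
proof -
  let ?W = "\<lambda>n. v n * u (Suc n) - v (Suc n) * u n"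
  obtain P where P: "P > 0" "\<And>n. cmod (pr n) \<le> P" using pr_bounded by blast
  have "?W \<longlonglongrightarrow> 0 * 0 - 0 * 0"
    by (intro tendsto_intros v0 u0 LIMSEQ_Suc)
  then have W: "?W \<longlonglongrightarrow> 0" by simp
  have "(\<lambda>n. pr n * ?W n) \<longlonglongrightarrow> 0"
  proof (rule tendsto_norm_zero_cancel, rule tendsto_sandwich[OF always_eventually always_eventually])
    show "\<forall>n. 0 \<le> norm (pr n * ?W n)" by simp
    show "\<forall>n. norm (pr n * ?W n) \<le> P * norm (?W n)"
      using P by (auto simp: norm_mult intro!: mult_right_mono)
    show "(\<lambda>n. P * norm (?W n)) \<longlonglongrightarrow> 0"
      using tendsto_mult_right_zero[OF tendsto_norm_zero[OF W]] by simp
  qed simp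
  then have "(\<lambda>n. pr n * ?W n - (v 0 * u 1 - v 1 * u 0)) \<longlonglongrightarrow> 0 - (v 0 * u 1 - v 1 * u 0)"
    by (intro tendsto_diff tendsto_const)
  then show ?thesis unfolding sums_def by (simp add: wronskian_step[OF v u])
qed

lemma forward_zero:
  assumes v: "\<And>n. n \<ge> 1 \<Longrightarrow> z * v n = v (n - 1) + B n * v n + A n * v (Suc n)"
    and "v k = 0" "v (Suc k) = (0 :: complex)"
  shows "v (k + n) = 0 \<and> v (Suc (k + n)) = 0"
proof (induction n)
  case (Suc n)
  have "A (Suc (k + n)) * v (Suc (Suc (k + n))) = 0" using v[of "Suc (k + n)"] Suc by simp
  then show ?case using Suc A0[of "Suc (k + n)"] by simp
qed (use assms in simp)

lemma backward_zero:
  assumes v: "\<And>n. n \<ge> 1 \<Longrightarrow> z * v n = v (n - 1) + B n * v n + A n * v (Suc n)"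
    and "v k = 0" "v (Suc k) = (0 :: complex)"
  shows "n \<le> k \<Longrightarrow> v (k - n) = 0 \<and> v (Suc (k - n)) = 0"
proof (induction n)
  case (Suc n)
  then have e: "Suc (k - Suc n) = k - n" by simp
  have "v (k - Suc n) = 0" using v[of "Suc (k - Suc n)"] Suc e by simp
  then show ?case using Suc e by simp
qed (use assms in simp)

text \<open>Both off-diagonals are nonzero, so two consecutive zeros propagate upwards and
  downwards.\<close>

lemma all_zero:
  assumes v: "\<And>n. n \<ge> 1 \<Longrightarrow> z * v n = v (n - 1) + B n * v n + A n * v (Suc n)"
    and "v k = 0" "v (Suc k) = (0 :: complex)"
  shows "v n = 0"
  using forward_zero[OF assms, of "n - k"] backward_zero[OF assms, of "k - n"]
  by (cases "n \<ge> k") auto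

lemma ell2_tendsto: "u \<in> ell2 \<Longrightarrow> u \<longlonglongrightarrow> 0"
proof -
  assume "u \<in> ell2"
  then have s: "summable (\<lambda>n. (cmod (u n))\<^sup>2)" by (simp add: ell2_def)
  have "(\<lambda>n. (cmod (u n))\<^sup>2) \<longlonglongrightarrow> 0" by (rule summable_LIMSEQ_zero[OF s])
  then have "(\<lambda>n. sqrt ((cmod (u n))\<^sup>2)) \<longlonglongrightarrow> sqrt 0" by (rule tendsto_real_sqrt)
  then have "(\<lambda>n. norm (u n)) \<longlonglongrightarrow> 0" by simp
  then show ?thesis by (rule tendsto_norm_zero_cancel)
qed

abbreviation jac :: "complex \<Rightarrow> (nat \<Rightarrow> complex) \<Rightarrow> nat \<Rightarrow> complex" where "jac \<equiv> jacobi_op A B"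

lemma coeff_bounded: obtains D where "D \<ge> 0" "\<And>n. n \<ge> 1 \<Longrightarrow> cmod (B n) \<le> D \<and> cmod (A n) \<le> D"
proof (rule that[of "C + 1"])
  have C0: "C \<ge> 0"
    using order_trans[OF add_nonneg_nonneg[OF norm_ge_zero norm_ge_zero] decay[of 1]] by (simp add: zero_le_mult_iff)
  show "C + 1 \<ge> 0" using C0 by simp
  fix n :: nat assume n: "n \<ge> 1"
  have "C * exp (- c * real n powr \<beta>) \<le> C * 1" using C0 c by (intro mult_left_mono) auto
  then have "cmod (B n) + cmod (A n - 1) \<le> C" using decay[OF n] by simp
  then show "cmod (B n) \<le> C + 1 \<and> cmod (A n) \<le> C + 1"
    using norm_triangle_ineq2[of "A n" 1] norm_ge_zero[of "B n"] norm_ge_zero[of "A n - 1"]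
    unfolding norm_one by linarith
qed

text \<open>Root vectors are handled by induction on the power, and the induction hypothesis is
  applied to \<open>jac z v\<close>, which must therefore be square summable.\<close>

lemma ell2_jac:
  assumes v: "v \<in> ell2"
  shows "jac z v \<in> ell2"
proof -
  obtain D where D: "D \<ge> 0" "\<And>n. n \<ge> 1 \<Longrightarrow> cmod (B n) \<le> D \<and> cmod (A n) \<le> D" using coeff_bounded by blast
  define E where "E = 1 + D + cmod z"
  have E: "E \<ge> 1" using D by (simp add: E_def)
  have v0: "v 0 = 0" and sv: "summable (\<lambda>n. (cmod (v n))\<^sup>2)" using v by (auto simp: ell2_def)
  have sq: "(a + b + c :: real)\<^sup>2 \<le> 3 * a\<^sup>2 + 3 * b\<^sup>2 + 3 * c\<^sup>2" for a b c
    using sum_squares_ge_zero[of "a - b" "b - c"] zero_le_power2[of "a - c"]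
    by (simp add: power2_eq_square algebra_simps)
  have "summable (\<lambda>n. (cmod (jac z v n))\<^sup>2)"
  proof (rule summable_comparison_test)
    show "summable (\<lambda>n. 3 * E\<^sup>2 * (cmod (v (n - 1)))\<^sup>2 + 3 * E\<^sup>2 * (cmod (v n))\<^sup>2 + 3 * E\<^sup>2 * (cmod (v (Suc n)))\<^sup>2)"
    proof (intro summable_add summable_mult sv)
      show "summable (\<lambda>n. (cmod (v (Suc n)))\<^sup>2)" using sv by (subst summable_Suc_iff)
      show "summable (\<lambda>n. (cmod (v (n - 1)))\<^sup>2)"
        using sv by (subst summable_Suc_iff[symmetric]) simp
    qed
    have "norm ((cmod (jac z v n))\<^sup>2)
      \<le> 3 * E\<^sup>2 * (cmod (v (n - 1)))\<^sup>2 + 3 * E\<^sup>2 * (cmod (v n))\<^sup>2 + 3 * E\<^sup>2 * (cmod (v (Suc n)))\<^sup>2" for n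
    proof (cases "n = 0")
      case False
      then have n: "n \<ge> 1" by simp
      have "jac z v n = v (n - 1) + (B n - z) * v n + A n * v (Suc n)"
        using False by (simp add: jacobi_op_def algebra_simps)
      then have "cmod (jac z v n) \<le> cmod (v (n - 1)) + cmod (B n - z) * cmod (v n) + cmod (A n) * cmod (v (Suc n))"
        using norm_triangle_ineq[of "v (n - 1) + (B n - z) * v n" "A n * v (Suc n)"]
          norm_triangle_ineq[of "v (n - 1)" "(B n - z) * v n"] by (simp add: norm_mult)
      also have "\<dots> \<le> E * cmod (v (n - 1)) + E * cmod (v n) + E * cmod (v (Suc n))"
      proof (intro add_mono mult_right_mono)
        show "cmod (v (n - 1)) \<le> E * cmod (v (n - 1))" using E by (simp add: mult_le_cancel_right1)
        show "cmod (B n - z) \<le> E" using D(2)[OF n] norm_triangle_ineq4[of "B n" z] by (simp add: E_def)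
        show "cmod (A n) \<le> E" using D(2)[OF n] norm_ge_zero[of z] unfolding E_def by linarith
      qed auto
      finally have "(cmod (jac z v n))\<^sup>2 \<le> (E * cmod (v (n - 1)) + E * cmod (v n) + E * cmod (v (Suc n)))\<^sup>2"
        by (intro power_mono) auto
      also have "\<dots> \<le> 3 * (E * cmod (v (n - 1)))\<^sup>2 + 3 * (E * cmod (v n))\<^sup>2 + 3 * (E * cmod (v (Suc n)))\<^sup>2"
        by (rule sq)
      finally show ?thesis by (simp add: power_mult_distrib)
    qed (simp add: jacobi_op_def v0)
    then show "\<exists>N. \<forall>n\<ge>N. norm ((cmod (jac z v n))\<^sup>2)
      \<le> 3 * E\<^sup>2 * (cmod (v (n - 1)))\<^sup>2 + 3 * E\<^sup>2 * (cmod (v n))\<^sup>2 + 3 * E\<^sup>2 * (cmod (v (Suc n)))\<^sup>2"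
      by blast
  qed
  then show ?thesis by (simp add: ell2_def jacobi_op_def v0)
qed

section \<open>Eigenvectors and root vectors at a point of the open disc\<close>

context
  fixes w :: complex
  assumes w: "w \<noteq> 0" "cmod w < 1"
begin

lemma w_pdisc: "w \<in> pdisc" using w by simp

lemma y_bound: "n \<ge> N \<Longrightarrow> w' \<in> pdisc \<Longrightarrow> cmod (y n w') \<le> 3/2 * cmod w' ^ n"
  using asymp[of n w'] norm_triangle_ineq[of "y n w' - w' ^ n" "w' ^ n"] by (simp add: norm_power)

lemma y_nonzero: "n \<ge> N \<Longrightarrow> y n w \<noteq> 0"
proof
  assume "n \<ge> N" "y n w = 0"
  then have "cmod w ^ n \<le> cmod w ^ n / 2" using asymp[of n w] w_pdisc by (simp add: norm_power)
  then show False using w by simp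
qed

lemma y_summable: "summable (\<lambda>n. (cmod (y n w))\<^sup>2)"
proof (rule summable_comparison_test)
  show "summable (\<lambda>n. 9/4 * (cmod w ^ 2) ^ n)"
    using w by (intro summable_mult summable_geometric) (simp add: power_less_one_iff)
  show "\<exists>N. \<forall>n\<ge>N. norm ((cmod (y n w))\<^sup>2) \<le> 9/4 * (cmod w ^ 2) ^ n"
  proof (intro exI allI impI)
    fix n assume "n \<ge> N"
    then have "(cmod (y n w))\<^sup>2 \<le> (3/2 * cmod w ^ n)\<^sup>2"
      using y_bound[OF _ w_pdisc] by (intro power_mono) auto
    then show "norm ((cmod (y n w))\<^sup>2) \<le> 9/4 * (cmod w ^ 2) ^ n"
      by (simp add: power_mult_distrib power2_eq_square)
  qed
qed

lemma y_ell2: "M w = 0 \<Longrightarrow> (\<lambda>n. y n w) \<in> ell2"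
  using y_summable y0[OF w_pdisc] by (simp add: ell2_def)

lemma y_tendsto: "(\<lambda>n. y n w) \<longlonglongrightarrow> 0"
proof -
  have "(\<lambda>n. sqrt ((cmod (y n w))\<^sup>2)) \<longlonglongrightarrow> sqrt 0"
    using y_summable by (intro tendsto_real_sqrt summable_LIMSEQ_zero)
  then have "(\<lambda>n. norm (y n w)) \<longlonglongrightarrow> 0" by simp
  then show ?thesis by (rule tendsto_norm_zero_cancel)
qed

lemma jac_y: "M w = 0 \<Longrightarrow> jac (w + inverse w) (\<lambda>n. y n w) = (\<lambda>_. 0)"
  using recur[OF _ w_pdisc] y0[OF w_pdisc] by (auto simp: jacobi_op_def fun_eq_iff)

text \<open>The weighted Wronskian with the Jost solution is constant and tends to zero, so the two
  solutions are proportional. The factor is read off at index \<open>N\<close>, where the Jost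
  solution is known not to vanish.\<close>

lemma jac_kernel:
  assumes v: "v \<in> ell2" and jv: "jac (w + inverse w) v = (\<lambda>_. 0)"
  obtains k where "v = (\<lambda>n. k * y n w)"
proof -
  let ?z = "w + inverse w"
  have rv: "?z * v n = v (n - 1) + B n * v n + A n * v (Suc n) + 0" if "n \<ge> 1" for n
    using fun_cong[OF jv, of n] that by (simp add: jacobi_op_def)
  have "(\<lambda>k. pr k * ((?z - ?z) * (v (Suc k) * y (Suc k) w) + 0 * y (Suc k) w)) sums
      - (v 0 * y 1 w - v 1 * y 0 w)"
    by (rule wronskian_sums[OF rv recur[OF _ w_pdisc] ell2_tendsto[OF v] y_tendsto])
  then have W0: "v 0 * y 1 w - v 1 * y 0 w = 0"
    using sums_unique2[OF _ sums_zero] by force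
  have "pr N * (v N * y (Suc N) w - v (Suc N) * y N w) = 0"
    using wronskian_step[OF rv recur[OF _ w_pdisc], of N] W0 by simp
  then have W: "v N * y (Suc N) w = v (Suc N) * y N w" using pr_nonzero by simp
  define k where "k = v N / y N w"
  define d where "d n = v n - k * y n w" for n
  have yN: "y N w \<noteq> 0" by (rule y_nonzero) simp
  have "d n = 0" for n
  proof (rule all_zero[of ?z d N])
    show "d N = 0" using yN by (simp add: d_def k_def)
    show "d (Suc N) = 0" using yN W by (simp add: d_def k_def field_simps)
    fix n :: nat assume n: "n \<ge> 1"
    have "?z * d n = ?z * v n - k * (?z * y n w)" by (simp add: d_def algebra_simps)
    also have "\<dots> = d (n - 1) + B n * d n + A n * d (Suc n)"
      unfolding rv[OF n] recur[OF n w_pdisc] by (simp add: d_def algebra_simps)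
    finally show "?z * d n = d (n - 1) + B n * d n + A n * d (Suc n)" .
  qed
  then have "v = (\<lambda>n. k * y n w)" by (simp add: d_def fun_eq_iff)
  then show ?thesis by (rule that)
qed

text \<open>Without positivity a sum of squares may vanish. The Green formula at \<open>w'\<close>
  and \<open>w\<close> expresses \<open>(1 - 1 / (w' * w)) * T w'\<close> through the difference
  quotient of \<open>M\<close>. If the sum were zero, letting \<open>w'\<close> tend to
  \<open>w\<close> would give \<open>G w * d * y 1 w = 0\<close>, hence \<open>y 1 w = 0\<close>;
  together with \<open>y 0 w = 0\<close> the Jost solution would vanish identically.\<close>

lemma square_sum_nonzero:
  assumes M: "M w = 0" and d: "(M has_field_derivative d) (at w)" "d \<noteq> 0"
  shows "(\<Sum>k. pr k * (y (Suc k) w * y (Suc k) w)) \<noteq> 0"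
proof
  assume zero: "(\<Sum>k. pr k * (y (Suc k) w * y (Suc k) w)) = 0"
  obtain P where P: "P > 0" "\<And>n. cmod (pr n) \<le> P" using pr_bounded by blast
  define T where "T w' = (\<Sum>k. pr k * (y (Suc k) w' * y (Suc k) w))" for w'
  have "open (ball 0 1 - {0 :: complex})" by (intro open_Diff) auto
  then have "eventually (\<lambda>w'. w' \<in> ball 0 1 - {0}) (at w)"
    using w by (intro eventually_at_in_open') auto
  then have ev: "eventually (\<lambda>w'. w' \<in> ball 0 1 - {0} \<and> w' \<noteq> w) (at w)"
    by (simp add: eventually_conj_iff eventually_neq_at_within)
  have at: "(g \<longlongrightarrow> g w) (at w)" if "continuous_on pdisc g" for g :: "complex \<Rightarrow> complex"
  proof -
    have "continuous_on (ball 0 1 - {0}) g" by (rule continuous_on_subset[OF that]) auto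
    then have "isCont g w" using w \<open>open (ball 0 1 - {0 :: complex})\<close>
      by (simp add: continuous_on_eq_continuous_at)
    then show ?thesis by (simp add: isCont_def)
  qed
  have T: "(T \<longlongrightarrow> 0) (at w)"
  proof -
    have "eventually (\<lambda>w'. summable (\<lambda>k. norm (pr k * (y (Suc k) w' * y (Suc k) w)))) (at w) \<and>
        summable (\<lambda>k. norm (pr k * (y (Suc k) w * y (Suc k) w))) \<and>
        ((\<lambda>w'. suminf (\<lambda>k. pr k * (y (Suc k) w' * y (Suc k) w))) \<longlongrightarrow>
          suminf (\<lambda>k. pr k * (y (Suc k) w * y (Suc k) w))) (at w)"
    \<comment> \<open>The geometric decay comes from the factor at \<open>w\<close> alone; the
      factor at \<open>w'\<close> is merely bounded by 3 / 2, so the majorant does not depend on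
      \<open>w'\<close>.\<close>
    proof (rule tannerys_theorem)
      show "((\<lambda>w'. pr k * (y (Suc k) w' * y (Suc k) w)) \<longlongrightarrow> pr k * (y (Suc k) w * y (Suc k) w)) (at w)" for k
        by (intro tendsto_intros at[OF y_cont])
      show "summable (\<lambda>k. P * (9/4) * cmod w ^ k)"
        using w by (intro summable_mult summable_geometric) simp
      show "eventually (\<lambda>(k, w'). norm (pr k * (y (Suc k) w' * y (Suc k) w)) \<le> P * (9/4) * cmod w ^ k) (at_top \<times>\<^sub>F at w)"
      proof -
        have "norm (pr k * (y (Suc k) w' * y (Suc k) w)) \<le> P * (9/4) * cmod w ^ k"
          if k: "k \<ge> N" and w'': "w' \<in> ball 0 1 - {0} \<and> w' \<noteq> w" for k w'
        proof -
          have w': "w' \<in> pdisc" "cmod w' \<le> 1" using w'' by auto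
          have "cmod (y (Suc k) w') \<le> 3/2 * cmod w' ^ Suc k" using k w' by (intro y_bound) auto
          also have "\<dots> \<le> 3/2 * 1" using w' by (intro mult_left_mono power_le_one) auto
          finally have 1: "cmod (y (Suc k) w') \<le> 3/2" by simp
          have "cmod (y (Suc k) w) \<le> 3/2 * cmod w ^ Suc k" using k w_pdisc by (intro y_bound) auto
          also have "\<dots> \<le> 3/2 * cmod w ^ k" using w by (intro mult_left_mono power_decreasing) auto
          finally have 2: "cmod (y (Suc k) w) \<le> 3/2 * cmod w ^ k" .
          have "cmod (pr k) * (cmod (y (Suc k) w') * cmod (y (Suc k) w)) \<le> P * (3/2 * (3/2 * cmod w ^ k))"
            using P 1 2 by (intro mult_mono) auto
          then show ?thesis by (simp add: norm_mult)
        qed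
        then show ?thesis
          unfolding eventually_prod_filter using eventually_ge_at_top[of N] ev by fast
      qed
    qed simp
    then show ?thesis unfolding T_def zero by blast
  qed
  have id: "(1 - inverse (w' * w)) * T w' = G w' * ((M w' - M w) / (w' - w)) * y 1 w"
    if w': "w' \<in> ball 0 1 - {0}" "w' \<noteq> w" for w'
  proof -
    have p: "w' \<in> pdisc" and w'': "w' \<noteq> 0" "cmod w' < 1" using w' by auto
    let ?z = "w + inverse w" and ?z' = "w' + inverse w'"
    have yt: "(\<lambda>n. y n w') \<longlonglongrightarrow> 0"
    proof (rule Lim_null_comparison)
      show "eventually (\<lambda>n. norm (y n w') \<le> 3/2 * cmod w' ^ n) sequentially"
        using eventually_ge_at_top[of N] by eventually_elim (rule y_bound[OF _ p])
      show "(\<lambda>n. 3/2 * cmod w' ^ n) \<longlonglongrightarrow> 0"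
        using w'' by (intro tendsto_mult_right_zero LIMSEQ_power_zero) simp
    qed
    have "(\<lambda>k. pr k * ((?z - ?z') * (y (Suc k) w' * y (Suc k) w) + 0 * y (Suc k) w)) sums
        - (y 0 w' * y 1 w - y 1 w' * y 0 w)"
      by (rule wronskian_sums[where r = "\<lambda>_. 0"]) (use recur[OF _ p] recur[OF _ w_pdisc] yt y_tendsto in auto)
    moreover have "pr k * ((?z - ?z') * (y (Suc k) w' * y (Suc k) w) + 0 * y (Suc k) w)
        = (?z - ?z') * (pr k * (y (Suc k) w' * y (Suc k) w))" for k by (simp add: algebra_simps)
    ultimately have "(\<lambda>k. (?z - ?z') * (pr k * (y (Suc k) w' * y (Suc k) w))) sums
        - (y 0 w' * y 1 w - y 1 w' * y 0 w)" by (simp only:)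
    then have s: "(\<lambda>k. (?z - ?z') * (pr k * (y (Suc k) w' * y (Suc k) w))) sums - (y 0 w' * y 1 w)"
      using y0[OF w_pdisc] M by simp
    have zz: "?z - ?z' = - ((w' - w) * (1 - inverse (w' * w)))"
      using w w'' by (simp add: field_simps)
    show ?thesis
    proof (cases "?z - ?z' = 0")
      case False
      then have "(\<lambda>k. pr k * (y (Suc k) w' * y (Suc k) w)) sums (- (y 0 w' * y 1 w) / (?z - ?z'))"
        using sums_divide[OF s, of "?z - ?z'"] by simp
      then have "T w' = - (y 0 w' * y 1 w) / (?z - ?z')" unfolding T_def by (rule sums_unique[symmetric])
      then have "(?z - ?z') * T w' = - (y 0 w' * y 1 w)" using False by simp
      then have "(w' - w) * ((1 - inverse (w' * w)) * T w') = G w' * M w' * y 1 w"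
        unfolding zz y0[OF p] by (simp add: mult.assoc)
      then show ?thesis using w'(2) M by (simp add: field_simps)
    next
      \<comment> \<open>Equal spectral parameters at distinct points would mean
        \<open>w' * w = 1\<close>. Rather than excluding this, both sides are shown to
        vanish.\<close>
      case True
      then have "(\<lambda>k. 0) sums - (y 0 w' * y 1 w)" using s by simp
      then have "y 0 w' * y 1 w = 0" using sums_0 sums_unique2 by (metis neg_equal_0_iff_equal)
      then have "G w' * M w' * y 1 w = 0" by (simp add: y0[OF p])
      moreover have "1 - inverse (w' * w) = 0" using True w'(2) unfolding zz by simp
      ultimately show ?thesis using M by auto
    qed
  qed
  have "((\<lambda>w'. (1 - inverse (w' * w)) * T w') \<longlongrightarrow> (1 - inverse (w * w)) * 0) (at w)"
    using w by (intro tendsto_intros T) auto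
  then have "((\<lambda>w'. G w' * ((M w' - M w) / (w' - w)) * y 1 w) \<longlongrightarrow> 0) (at w)"
    by (subst (asm) tendsto_cong[OF eventually_mono[OF ev]]) (use id in auto)
  moreover have "((\<lambda>w'. G w' * ((M w' - M w) / (w' - w)) * y 1 w) \<longlongrightarrow> G w * d * y 1 w) (at w)"
    using d(1) by (intro tendsto_intros at[OF G_cont]) (simp add: has_field_derivative_iff)
  ultimately have "G w * d * y 1 w = 0" by (metis tendsto_unique trivial_limit_at)
  then have "y 1 w = 0" using G0 d by simp
  moreover have "y 0 w = 0" using y0[OF w_pdisc] M by simp
  ultimately have "y N w = 0"
    using all_zero[of "w + inverse w" "\<lambda>n. y n w" 0 N] recur[OF _ w_pdisc] by simp
  then show False using y_nonzero[of N] by simp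
qed

text \<open>If \<open>jac v = q * y\<close> with \<open>y\<close> an eigenvector, the Green formula
  with this source pairs the equation with \<open>y\<close> and gives \<open>q\<close> times the sum
  of squares equal to zero, so \<open>q = 0\<close> and no Jordan chain exists. If
  \<open>M w \<noteq> 0\<close>, the condition \<open>v 0 = 0\<close> leaves only the zero multiple
  of the Jost solution.\<close>

lemma jac_root_vectors:
  assumes simple: "M w = 0 \<Longrightarrow> \<exists>d. d \<noteq> 0 \<and> (M has_field_derivative d) (at w)"
    and v: "v \<in> ell2" "(jac (w + inverse w) ^^ k) v = (\<lambda>_. 0)"
  shows "\<exists>q. v = (\<lambda>n. q * y n w) \<and> (M w \<noteq> 0 \<longrightarrow> v = (\<lambda>_. 0))"
  using v
proof (induction k arbitrary: v)
  case 0
  then show ?case by (intro exI[of _ 0]) auto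
next
  case (Suc k)
  let ?z = "w + inverse w"
  have "jac ?z v \<in> ell2" by (rule ell2_jac[OF Suc.prems(1)])
  moreover have "(jac ?z ^^ k) (jac ?z v) = (\<lambda>_. 0)" using Suc.prems(2) by (simp add: funpow_swap1)
  ultimately obtain q where q: "jac ?z v = (\<lambda>n. q * y n w)" "M w \<noteq> 0 \<longrightarrow> jac ?z v = (\<lambda>_. 0)"
    using Suc.IH by blast
  have v0: "v 0 = 0" using Suc.prems(1) by (simp add: ell2_def)
  have "jac ?z v = (\<lambda>_. 0)"
  proof (cases "M w = 0")
    case True
    then obtain d where d: "d \<noteq> 0" "(M has_field_derivative d) (at w)" using simple by blast
    have rv: "?z * v n = v (n - 1) + B n * v n + A n * v (Suc n) + (- q * y n w)" if "n \<ge> 1" for n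
      using fun_cong[OF q(1), of n] that by (simp add: jacobi_op_def algebra_simps)
    have "(\<lambda>k. pr k * ((?z - ?z) * (v (Suc k) * y (Suc k) w) + (- q * y (Suc k) w) * y (Suc k) w)) sums
      - (v 0 * y 1 w - v 1 * y 0 w)"
      by (rule wronskian_sums[OF rv recur[OF _ w_pdisc] ell2_tendsto[OF Suc.prems(1)] y_tendsto])
    moreover have "pr k * ((?z - ?z) * (v (Suc k) * y (Suc k) w) + (- q * y (Suc k) w) * y (Suc k) w)
      = - q * (pr k * (y (Suc k) w * y (Suc k) w))" for k by (simp add: algebra_simps)
    ultimately have "(\<lambda>k. - q * (pr k * (y (Suc k) w * y (Suc k) w))) sums - (v 0 * y 1 w - v 1 * y 0 w)"
      by (simp only:)
    then have s: "(\<lambda>k. - q * (pr k * (y (Suc k) w * y (Suc k) w))) sums 0"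
      using v0 y0[OF w_pdisc] True by simp
    have "q = 0"
    proof (rule ccontr)
      assume "q \<noteq> 0"
      then have "(\<lambda>k. pr k * (y (Suc k) w * y (Suc k) w)) sums 0"
        using sums_mult_D[OF s] by simp
      then show False using square_sum_nonzero[OF True d(2,1)] sums_unique by metis
    qed
    then show ?thesis using q(1) by simp
  qed (use q(2) in blast)
  then obtain q' where q': "v = (\<lambda>n. q' * y n w)" using jac_kernel[OF Suc.prems(1)] by blast
  have "M w \<noteq> 0 \<longrightarrow> v = (\<lambda>_. 0)"
  proof
    assume "M w \<noteq> 0"
    moreover have "q' * y 0 w = 0" using v0 q' by simp
    ultimately have "q' = 0" using y0[OF w_pdisc] G0 by simp
    then show "v = (\<lambda>_. 0)" using q' by simp
  qed
  with q' show ?case by blast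
qed

end

end

section \<open>Coefficient estimates\<close>

lemma fact_add_ge: "fact d * real (d + 1) ^ k \<le> fact (d + k)"
proof (induction k)
  case (Suc k)
  have "fact d * real (d + 1) ^ Suc k = real (d + 1) * (fact d * real (d + 1) ^ k)" by simp
  also have "\<dots> \<le> real (d + 1 + k) * fact (d + k)" using Suc by (intro mult_mono) auto
  finally show ?case by (simp add: algebra_simps)
qed simp

text \<open>Cauchy's inequality for the kth derivative at radius \<open>r < 1\<close>. Its bound is
  uniform in the open disc, so \<open>r\<close> may tend to 1, and only the remaining
  \<open>n - k\<close> derivatives cost a factorial.\<close>

lemma taylor_coeff_bound:
  assumes hol: "f holomorphic_on ball 0 1" and "k \<le> n"
    and bd: "\<And>w. cmod w < 1 \<Longrightarrow> cmod ((deriv ^^ k) f w) \<le> B"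
  shows "cmod ((deriv ^^ n) f 0) \<le> fact (n - k) * B"
proof -
  let ?g = "(deriv ^^ k) f"
  have g: "?g holomorphic_on ball 0 1" using hol by (intro holomorphic_higher_deriv) auto
  have e: "(deriv ^^ n) f = (deriv ^^ (n - k)) ?g"
    using \<open>k \<le> n\<close> by (metis add.commute comp_apply funpow_add le_add_diff_inverse2)
  have "cmod ((deriv ^^ n) f 0) \<le> fact (n - k) * B / r ^ (n - k)" if r: "0 < r" "r < 1" for r
    unfolding e
  proof (rule Cauchy_inequality)
    show "?g holomorphic_on ball 0 r" using g r by (auto intro: holomorphic_on_subset)
    have "cball 0 r \<subseteq> ball (0 :: complex) 1" using r by auto
    then show "continuous_on (cball 0 r) ?g"
      using g holomorphic_on_imp_continuous_on continuous_on_subset by blast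
    show "norm (0 - x) = r \<Longrightarrow> norm (?g x) \<le> B" for x using bd[of x] r by simp
  qed (use r in auto)
  then have ev: "eventually (\<lambda>r. cmod ((deriv ^^ n) f 0) \<le> fact (n - k) * B / r ^ (n - k)) (at_left (1 :: real))"
    using eventually_at_left[of 0 "1 :: real"] by (auto intro!: exI[of _ 0])
  have "((\<lambda>r. fact (n - k) * B / r ^ (n - k)) \<longlongrightarrow> fact (n - k) * B / 1 ^ (n - k)) (at_left (1 :: real))"
    by (intro tendsto_intros) auto
  then show ?thesis using tendsto_lowerbound[OF _ ev] by simp
qed

text \<open>Gevrey bounds of order \<open>1 / \<beta>\<close> are optimised over the number
  \<open>k\<close> of derivatives used: for \<open>k\<close> near \<open>K * n powr \<beta>\<close>
  the ratio of \<open>L * k powr (1 / \<beta>)\<close> to \<open>n - k + 1\<close> is at most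
  \<open>exp (- 1)\<close>, and its kth power is the desired exponential.\<close>

lemma gevrey_coeff_decay:
  assumes hol: "f holomorphic_on ball 0 1" and \<beta>: "0 < \<beta>" "\<beta> \<le> 1" and B: "B \<ge> 0" and L: "L \<ge> 0"
    and bd: "\<And>k w. cmod w < 1 \<Longrightarrow> cmod ((deriv ^^ k) f w) \<le> B * (L * real k powr (1 / \<beta>)) ^ k"
  obtains C K where "K > 0" "C \<ge> 0"
    "\<And>n. cmod ((deriv ^^ n) f 0 / fact n) \<le> C * exp (- K * real n powr \<beta>)"
proof -
  define L' where "L' = max L 1"
  have L': "L' \<ge> 1" "L \<le> L'" by (auto simp: L'_def)
  have bd': "cmod ((deriv ^^ k) f w) \<le> B * (L' * real k powr (1 / \<beta>)) ^ k" if "cmod w < 1" for k w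
  proof -
    have "B * (L * real k powr (1 / \<beta>)) ^ k \<le> B * (L' * real k powr (1 / \<beta>)) ^ k"
      using B L' L by (intro mult_left_mono power_mono mult_right_mono) auto
    then show ?thesis using bd[OF that, of k] by simp
  qed
  \<comment> \<open>The factor 2 accounts for \<open>n - k + 1 \<ge> n / 2\<close>, and
    \<open>exp 1\<close> makes the final ratio at most \<open>exp (- 1)\<close>.\<close>
  define R where "R = 2 * exp 1 * L'"
  have R: "R \<ge> 2" "R > 0"
    using L' mult_mono[of 1 "exp 1" 1 L'] one_le_exp_iff[of "1 :: real"] by (auto simp: R_def)
  define K where "K = (1 / R) powr \<beta>"
  show ?thesis
  proof (rule that[of K "B * exp 1"])
    show "K > 0" using R by (simp add: K_def)
    show "B * exp 1 \<ge> 0" using B by simp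
    fix n :: nat
    define x where "x = (real n / R) powr \<beta>"
    have xK: "x = K * real n powr \<beta>" using R by (simp add: x_def K_def powr_divide)
    have x0: "x \<ge> 0" by (simp add: x_def)
    define k where "k = nat \<lfloor>x\<rfloor>"
    have k: "real k \<le> x" "x < real k + 1" using x0 by (auto simp: k_def)
    have kR: "real k powr (1 / \<beta>) \<le> real n / R"
    proof -
      have "real k powr (1 / \<beta>) \<le> x powr (1 / \<beta>)" using k \<beta> by (intro powr_mono2) auto
      also have "\<dots> = real n / R" using R \<beta> by (simp add: x_def powr_powr)
      finally show ?thesis .
    qed
    have kn: "real k \<le> real n / 2"
    proof (cases "k = 0")
      case False
      have "real k powr 1 \<le> real k powr (1 / \<beta>)" using \<beta> False by (intro powr_mono) auto
      also have "\<dots> \<le> real n / R" by (rule kR)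
      also have "\<dots> \<le> real n / 2" using R by (intro divide_left_mono) auto
      finally show ?thesis using False by simp
    qed simp
    define d where "d = n - k"
    have n: "n = d + k" using kn by (simp add: d_def)
    have dn: "real (d + 1) \<ge> real n / 2" using kn n by simp
    have "cmod ((deriv ^^ n) f 0 / fact n) = cmod ((deriv ^^ n) f 0) / fact n" by (simp add: norm_divide)
    also have "\<dots> \<le> fact (n - k) * (B * (L' * real k powr (1 / \<beta>)) ^ k) / fact n"
      by (intro divide_right_mono taylor_coeff_bound[OF hol] bd') (use n in auto)
    also have "\<dots> = (fact d / fact (d + k)) * (B * (L' * real k powr (1 / \<beta>)) ^ k)" by (simp add: n)
    also have "\<dots> \<le> (1 / real (d + 1) ^ k) * (B * (L' * real k powr (1 / \<beta>)) ^ k)"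
      using fact_add_ge[of d k] B L'
      by (intro mult_right_mono) (auto simp: divide_simps mult_ac simp del: of_nat_add of_nat_Suc)
    also have "\<dots> = B * (L' * real k powr (1 / \<beta>) / real (d + 1)) ^ k" by (simp add: power_divide)
    also have "\<dots> \<le> B * exp (- 1) ^ k"
    proof (intro mult_left_mono power_mono B)
      have "L' * real k powr (1 / \<beta>) \<le> L' * (real n / R)" using kR L' by (intro mult_left_mono) auto
      also have "\<dots> = exp (- 1) * (real n / 2)" using L' by (simp add: R_def exp_minus field_simps)
      also have "\<dots> \<le> exp (- 1) * real (d + 1)" using dn by (intro mult_left_mono) auto
      finally show "L' * real k powr (1 / \<beta>) / real (d + 1) \<le> exp (- 1)"
        by (subst pos_divide_le_eq) auto
    qed (use L' in auto)
    also have "exp (- 1) ^ k = exp (- real k)" by (simp add: exp_of_nat_mult[symmetric])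
    \<comment> \<open>Rounding \<open>x\<close> down to the integer \<open>k\<close> costs the
      factor \<open>exp 1\<close>.\<close>
    also have "B * exp (- real k) \<le> B * exp (1 + - x)" using k B by (intro mult_left_mono) auto
    also have "\<dots> = B * exp 1 * exp (- K * real n powr \<beta>)" by (simp add: exp_add[symmetric] xK)
    finally show "cmod ((deriv ^^ n) f 0 / fact n) \<le> B * exp 1 * exp (- K * real n powr \<beta>)" .
  qed
qed

definition one_sided :: "(nat \<Rightarrow> complex) \<Rightarrow> int \<Rightarrow> complex"
  where "one_sided c j = (if j \<ge> 0 then c (nat j) else 0)"

lemma laurent_on_one_sided:
  assumes "summable (\<lambda>n. cmod (c n))"
  shows "laurent_on (one_sided c) (\<lambda>w. \<Sum>n. c n * w ^ n) pdisc"
  unfolding laurent_on_def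
proof (intro conjI ballI)
  fix w :: complex assume w: "w \<in> pdisc"
  have s: "summable (\<lambda>n. norm (c n * w ^ n))"
  proof (rule summable_comparison_test[OF _ assms])
    have "norm (norm (c n * w ^ n)) \<le> cmod (c n)" for n
      using w power_le_one[of "cmod w" n] by (simp add: norm_mult norm_power mult_left_le)
    then show "\<exists>N. \<forall>n\<ge>N. norm (norm (c n * w ^ n)) \<le> cmod (c n)" by blast
  qed
  have hs: "((\<lambda>n. c n * w ^ n) has_sum (\<Sum>n. c n * w ^ n)) UNIV"
    by (rule norm_summable_imp_has_sum[OF s summable_sums[OF summable_norm_cancel[OF s]]])
  then have "((\<lambda>j. c (nat j) * w ^ nat j) has_sum (\<Sum>n. c n * w ^ n)) {0..}"
    by (subst has_sum_reindex_bij_witness[where i = int and j = nat and T = UNIV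
          and h = "\<lambda>n. c n * w ^ n" and s' = "\<Sum>n. c n * w ^ n"]) auto
  then show "((\<lambda>j. one_sided c j * w powi j) has_sum (\<Sum>n. c n * w ^ n)) UNIV"
    by (subst (asm) has_sum_cong_neutral[where g = "\<lambda>j. one_sided c j * w powi j" and T = UNIV])
      (auto simp: one_sided_def power_int_def)
qed auto

text \<open>Since \<open>(w^m - w^(-m)) / (w - 1 / w) = w^(m-1) + w^(m-3) + ... + w^(1-m)\<close>,
  the coefficient \<open>h j\<close> is the sum of \<open>c (\<bar>j\<bar> + 1 + 2 * i)\<close> over
  \<open>i\<close>. In this form the zeros of the denominator at 1 and -1 cause no
  difficulty.\<close>

lemma symmetric_quotient:
  assumes \<beta>: "0 < \<beta>" "\<beta> \<le> 1" and K: "K > 0" and C: "C \<ge> 0"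
    and c: "\<And>n. cmod (c n) \<le> C * exp (- K * real n powr \<beta>)"
  obtains h H where "subexp_decay \<beta> h" "laurent_on h H circle" "\<And>j. h (- j) = h j"
    "\<And>w. w \<in> circle \<Longrightarrow> (w - inverse w) * H w = (\<Sum>n. c n * w ^ n) - (\<Sum>n. c n * inverse w ^ n)"
proof -
  \<comment> \<open>The exponent is split in half: one factor becomes the decay of \<open>h\<close>,
    the other makes the sum over \<open>i\<close> converge.\<close>
  define E where "E n = exp (- (K / 2) * real n powr \<beta>)" for n
  have Es: "summable E" unfolding E_def by (rule summable_exp_powr_nat) (use K \<beta> in auto)
  have E0: "E n \<ge> 0" for n by (simp add: E_def)
  have Emono: "E m \<le> E n" if "n \<le> m" for m n
    unfolding E_def using that K \<beta> by (auto intro!: mult_left_mono powr_mono2)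
  have cE: "cmod (c n) \<le> C * E n * E n" for n
    using c[of n] by (simp add: E_def mult.assoc exp_add[symmetric])
  have cs: "summable (\<lambda>n. cmod (c n))"
  proof (rule summable_comparison_test)
    show "summable (\<lambda>n. C * E n)" by (rule summable_mult[OF Es])
    have "cmod (c n) \<le> C * E n" for n
      using cE[of n] mult_left_mono[of "E n" 1 "C * E n"] C E0[of n] Emono[of 0 n] by (simp add: E_def)
    then show "\<exists>N. \<forall>n\<ge>N. norm (cmod (c n)) \<le> C * E n" by auto
  qed
  define g where "g k = (\<lambda>i. c (k + 1 + 2 * i))" for k :: nat
  have gE: "cmod (g k i) \<le> C * E k * E i" for k i
  proof -
    have "C * E (k + 1 + 2 * i) * E (k + 1 + 2 * i) \<le> C * E k * E i"
      using C E0 by (intro mult_mono mult_left_mono Emono mult_nonneg_nonneg) auto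
    then show ?thesis using cE[of "k + 1 + 2 * i"] by (simp add: g_def)
  qed
  have gs: "summable (g k)" for k
    by (rule summable_comparison_test[OF _ summable_mult[OF Es, of "C * E k"]]) (use gE in auto)
  define h where "h j = (\<Sum>i. g (nat \<bar>j\<bar>) i)" for j :: int
  define S where "S = suminf E"
  have hb: "cmod (h j) \<le> C * S * E (nat \<bar>j\<bar>)" for j
  proof -
    have "cmod (h j) \<le> (\<Sum>i. C * E (nat \<bar>j\<bar>) * E i)"
      unfolding h_def by (rule norm_suminf_le[OF gE summable_mult[OF Es]])
    also have "\<dots> = C * E (nat \<bar>j\<bar>) * S" unfolding S_def by (rule suminf_mult[OF Es])
    finally show ?thesis by (simp add: mult_ac)
  qed
  have dec: "subexp_decay \<beta> h"
    unfolding subexp_decay_def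
    by (intro exI[of _ "C * S"] exI[of _ "K / 2"] conjI allI) (use K hb in \<open>auto simp: E_def\<close>)
  define H where "H w = (\<Sum>\<^sub>\<infinity>n. h n * w powi n)" for w
  have h: "laurent_on h H circle"
    unfolding laurent_on_def H_def
  proof (intro conjI ballI has_sum_infsum)
    fix w :: complex assume w: "w \<in> circle"
    have "(\<lambda>j. C * S * E (nat \<bar>j\<bar>)) summable_on UNIV"
      by (intro summable_on_cmult_right summable_on_int_abs Es E0)
    then have "(\<lambda>n. norm (h n * w powi n)) summable_on UNIV"
      by (rule Infinite_Sum.abs_summable_on_comparison_test')
        (use hb w in \<open>auto simp: norm_mult norm_power_int\<close>)
    then show "(\<lambda>n. h n * w powi n) summable_on UNIV" by (rule abs_summable_summable)
  qed auto
  have step: "h (int k) = c (k + 1) + h (int k + 2)" for k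
  proof -
    have "h (int k) = g k 0 + (\<Sum>i. g k (Suc i))"
      using suminf_split_head[OF gs, of k] by (simp add: h_def)
    moreover have "nat \<bar>int k + 2\<bar> = k + 2" by simp
    moreover have "g k (Suc i) = g (k + 2) i" for i by (simp add: g_def)
    ultimately show ?thesis by (simp add: h_def g_def)
  qed
  have hsym: "h (- j) = h j" for j by (simp add: h_def)
  note one = laurent_on_circleI[OF laurent_on_one_sided[OF cs]]
  have coeff: "h (j - 1) - h (j + 1) = one_sided c j - one_sided c (- j)" for j
  proof -
    have pos: "h (j - 1) - h (j + 1) = c (nat j)" if "j \<ge> 1" for j
      using step[of "nat j - 1"] that by (simp add: algebra_simps nat_diff_distrib)
    consider "j \<ge> 1" | "j = 0" | "- j \<ge> 1" by linarith
    then show ?thesis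
    proof cases
      case 1
      then show ?thesis using pos[of j] by (simp add: one_sided_def)
    next
      case 2
      then show ?thesis using hsym[of 1] by simp
    next
      case 3
      have "- j + 1 = - (j - 1)" "- j - 1 = - (j + 1)" by simp_all
      then have "h (j - 1) = h (- j + 1)" "h (j + 1) = h (- j - 1)"
        by (simp_all only: hsym)
      then show ?thesis using pos[of "- j"] 3 by (simp add: one_sided_def) (metis minus_diff_eq)
    qed
  qed
  show ?thesis
  proof (rule that[OF dec h hsym])
    fix w :: complex assume w: "w \<in> circle"
    have "laurent_on (\<lambda>n. h (n - 1) - h (n - (- 1))) (\<lambda>w. w powi 1 * H w - w powi (- 1) * H w) circle"
      by (intro laurent_on_diff laurent_on_shift h)
    then have 1: "laurent_on (\<lambda>j. one_sided c j - one_sided c (- j)) (\<lambda>w. (w - inverse w) * H w) circle"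
      by (simp add: coeff power_int_minus left_diff_distrib)
    have 2: "laurent_on (\<lambda>j. one_sided c j - one_sided c (- j))
        (\<lambda>w. (\<Sum>n. c n * w ^ n) - (\<Sum>n. c n * inverse w ^ n)) circle"
      by (rule laurent_on_diff[OF one laurent_on_inverse[OF one]])
    show "(w - inverse w) * H w = (\<Sum>n. c n * w ^ n) - (\<Sum>n. c n * inverse w ^ n)"
      using laurent_onD[OF 1 w] laurent_onD[OF 2 w] by (rule has_sum_unique)
  qed
qed

section \<open>A flat function with zeros accumulating at a boundary point\<close>

lemma norm_exp_minus_1_le:
  assumes "Re u \<ge> 0"
  shows "cmod (exp (- u) - 1) \<le> cmod u"
proof -
  have "norm (exp (- u) - exp 0) \<le> 1 * norm (- u - 0)"
  proof (rule field_differentiable_bound[where S = "{z. Re z \<le> 0}" and f' = exp])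
    show "convex {z. Re z \<le> 0}" by (rule convex_halfspace_Re_le)
    show "(exp has_field_derivative exp z) (at z within {z. Re z \<le> 0})" for z :: complex
      by (rule has_field_derivative_at_within[OF DERIV_exp])
  qed (use assms in auto)
  then show ?thesis by simp
qed

text \<open>Raise \<open>s \<le> exp s\<close> at \<open>s = \<delta> * x / t\<close> to the power
  \<open>t\<close>. The true maximum is smaller by \<open>exp (- t)\<close>, a loss that only
  affects constants later.\<close>

lemma powr_mult_exp_le:
  fixes x t \<delta> :: real
  assumes "x > 0" "t > 0" "\<delta> > 0"
  shows "x powr t * exp (- \<delta> * x) \<le> (t / \<delta>) powr t"
proof -
  have "\<delta> * x / t \<le> exp (\<delta> * x / t)"
    using exp_ge_add_one_self[of "\<delta> * x / t"] by linarith
  then have "(\<delta> * x / t) powr t \<le> exp (\<delta> * x / t) powr t"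
    using assms by (intro powr_mono2) auto
  also have "\<dots> = exp (\<delta> * x)" using assms by (simp add: exp_powr_real)
  finally have "(\<delta> * x / t) powr t * exp (- \<delta> * x) \<le> 1"
    by (simp add: exp_minus field_simps)
  then have "(t / \<delta>) powr t * ((\<delta> * x / t) powr t * exp (- \<delta> * x)) \<le> (t / \<delta>) powr t"
    by (simp add: mult_left_le)
  moreover have "(t / \<delta>) powr t * (\<delta> * x / t) powr t = x powr t"
    using assms by (simp add: powr_mult[symmetric])
  ultimately show ?thesis by (simp add: mult.assoc[symmetric])
qed

locale flat_function =
  fixes \<zeta> :: complex and \<beta> :: real
  assumes \<zeta>: "cmod \<zeta> = 1" "Im \<zeta> \<noteq> 0" and \<beta>: "0 < \<beta>" "\<beta> < 1/2"
begin

definition \<gamma> :: real where "\<gamma> = \<beta> / (1 - \<beta>)"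
text \<open>Lower bound for the cosine of the argument of \<open>X\<close> on the disc; it is
  positive because \<gamma> < 1.\<close>

definition c0 :: real where "c0 = cos (\<gamma> * (pi / 2))"
text \<open>With this value \<open>8 * \<kappa>\<close> is half of
  \<open>\<bar>Im \<zeta>\<bar>\<close>, which gives exactly the constant 1 / 2 in both cases of
  \<open>Nf_quotient\<close>.\<close>

definition \<kappa> :: real where "\<kappa> = \<bar>Im \<zeta>\<bar> / 16"
definition q :: "complex \<Rightarrow> complex" where "q w = 1 - w * cnj \<zeta>"
definition X :: "complex \<Rightarrow> complex" where "X w = exp (- of_real \<gamma> * Ln (q w))"
text \<open>The imaginary slope \<open>c0 / 2\<close> is half of what the sector containing
  \<open>X\<close> tolerates, so both exponentials in \<open>E\<close> still decay.\<close>

definition sl :: "real \<Rightarrow> complex" where "sl b = of_real \<kappa> * Complex 1 (b * c0 / 2)"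
text \<open>Equal to \<open>exp (- \<kappa> * X w) * cos (\<kappa> * c0 / 2 * X w)\<close>. In the
  sum of exponentials each term is bounded by 1 on the disc, whereas the cosine by itself is
  unbounded.\<close>

definition E :: "complex \<Rightarrow> complex" where "E w = (exp (- (sl 1 * X w)) + exp (- (sl (- 1) * X w))) / 2"
definition F :: "complex \<Rightarrow> complex" where "F w = (w - \<zeta>) * E w"

lemma \<gamma>: "0 < \<gamma>" "\<gamma> < 1" "1 / \<beta> = 1 + 1 / \<gamma>"
  using \<beta> by (auto simp: \<gamma>_def field_simps)

lemma c0: "0 < c0" "c0 \<le> 1"
proof -
  have "\<gamma> * (pi / 2) < 1 * (pi / 2)" using \<gamma> by (intro mult_strict_right_mono) auto
  moreover have "- (pi / 2) < \<gamma> * (pi / 2)" using \<gamma> by (smt (verit) mult_pos_pos pi_half_gt_zero)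
  ultimately show "0 < c0" unfolding c0_def by (intro cos_gt_zero_pi) auto
qed (simp add: c0_def)

lemma \<kappa>: "0 < \<kappa>" "\<kappa> \<le> 1/16"
  using \<zeta> abs_Im_le_cmod[of \<zeta>] by (auto simp: \<kappa>_def)

lemma \<zeta>_cnj: "\<zeta> * cnj \<zeta> = 1" "cnj \<zeta> * \<zeta> = 1" "\<zeta> \<noteq> 0"
  using \<zeta> complex_norm_square[of \<zeta>] by (auto simp: mult.commute)

lemma q_eq: "q w = cnj \<zeta> * (\<zeta> - w)"
  using \<zeta>_cnj by (simp add: q_def algebra_simps)

lemma norm_q: "cmod (q w) = cmod (w - \<zeta>)"
  unfolding q_eq by (simp add: norm_mult \<zeta> norm_minus_commute)

lemma Re_q: "cmod w < 1 \<Longrightarrow> Re (q w) > 0"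
  using complex_Re_le_cmod[of "w * cnj \<zeta>"] \<zeta> by (simp add: q_def norm_mult)

lemma norm_q_le: "cmod w < 1 \<Longrightarrow> cmod (q w) \<le> 2"
  unfolding norm_q using norm_triangle_ineq4[of w \<zeta>] \<zeta> by simp

lemma norm_X: "q w \<noteq> 0 \<Longrightarrow> cmod (X w) = cmod (q w) powr (- \<gamma>)"
  by (simp add: X_def powr_def)

lemma Re_X: 
  assumes "Re (q w) > 0"
  shows "Re (X w) \<ge> c0 * cmod (X w)"
proof -
  have "\<bar>Im (Ln (q w))\<bar> < pi / 2" by (rule Re_Ln_pos_lt_imp[OF assms])
  then have "\<gamma> * \<bar>Im (Ln (q w))\<bar> \<le> \<gamma> * (pi / 2)" using \<gamma> by (intro mult_left_mono) auto
  moreover have "\<gamma> * (pi / 2) \<le> 1 * pi" using \<gamma> by (intro mult_mono) auto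
  ultimately have "cos (\<gamma> * (pi / 2)) \<le> cos (\<gamma> * \<bar>Im (Ln (q w))\<bar>)"
    using \<gamma> by (intro cos_monotone_0_pi_le) auto
  also have "\<dots> = cos (\<gamma> * Im (Ln (q w)))" by (simp add: abs_if)
  finally have "c0 * cmod (X w) \<le> cos (\<gamma> * Im (Ln (q w))) * cmod (X w)"
    unfolding c0_def by (rule mult_right_mono) simp
  also have "\<dots> = Re (X w)" by (simp add: X_def Re_exp)
  finally show ?thesis .
qed

lemma norm_sl: "b \<in> {1, - 1} \<Longrightarrow> cmod (sl b) \<le> 2 * \<kappa>"
proof -
  assume b: "b \<in> {1, - 1}"
  have "cmod (Complex 1 (b * c0 / 2)) \<le> \<bar>1\<bar> + \<bar>b * c0 / 2\<bar>"
    using cmod_le[of "Complex 1 (b * c0 / 2)"] by simp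
  also have "\<dots> \<le> 2" using b c0 by auto
  finally show ?thesis using \<kappa> by (simp add: sl_def norm_mult)
qed

lemma Re_sl:
  assumes b: "b \<in> {1, - 1}" and x: "Re x \<ge> c0 * cmod x"
  shows "Re (sl b * x) \<ge> \<kappa> * (c0 / 2) * cmod x"
proof -
  have "b * c0 / 2 * Im x \<le> c0 / 2 * cmod x"
  proof -
    have "b * c0 / 2 * Im x \<le> \<bar>b * c0 / 2 * Im x\<bar>" by simp
    also have "\<dots> = c0 / 2 * \<bar>Im x\<bar>" using b c0 by (auto simp: abs_mult)
    also have "\<dots> \<le> c0 / 2 * cmod x" using c0 by (intro mult_left_mono abs_Im_le_cmod) auto
    finally show ?thesis .
  qed
  then have "c0 / 2 * cmod x \<le> Re x - b * c0 / 2 * Im x" using x by (simp add: field_simps)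
  then have "\<kappa> * (c0 / 2 * cmod x) \<le> \<kappa> * (Re x - b * c0 / 2 * Im x)"
    using \<kappa> by (intro mult_left_mono) auto
  then show ?thesis by (simp add: sl_def algebra_simps)
qed

lemma E_minus_1:
  assumes "Re (q w) > 0"
  shows "cmod (E w - 1) \<le> 2 * \<kappa> * cmod (X w)"
proof -
  have one: "cmod (exp (- (sl b * X w)) - 1) \<le> 2 * \<kappa> * cmod (X w)" if b: "b \<in> {1, - 1}" for b
  proof -
    have "\<kappa> * (c0 / 2) * cmod (X w) \<ge> 0" using \<kappa> c0 by simp
    then have "Re (sl b * X w) \<ge> 0" using Re_sl[OF b Re_X[OF assms]] by linarith
    then have "cmod (exp (- (sl b * X w)) - 1) \<le> cmod (sl b * X w)" by (rule norm_exp_minus_1_le)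
    also have "\<dots> \<le> 2 * \<kappa> * cmod (X w)"
      unfolding norm_mult using norm_sl[OF b] by (rule mult_right_mono) simp
    finally show ?thesis .
  qed
  have E: "E w - 1 = ((exp (- (sl 1 * X w)) - 1) + (exp (- (sl (- 1) * X w)) - 1)) / 2"
    by (simp add: E_def field_simps)
  have "cmod (E w - 1) = cmod ((exp (- (sl 1 * X w)) - 1) + (exp (- (sl (- 1) * X w)) - 1)) / 2"
    unfolding E norm_divide by simp
  also have "\<dots> \<le> (2 * \<kappa> * cmod (X w) + 2 * \<kappa> * cmod (X w)) / 2"
    by (intro divide_right_mono norm_triangle_le add_mono one) auto
  finally show ?thesis by simp
qed

lemma X_deriv:
  assumes "q w \<notin> \<real>\<^sub>\<le>\<^sub>0"
  shows "(X has_field_derivative (of_real \<gamma> * X w * cnj \<zeta> / q w)) (at w)"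
proof -
  have "q w \<noteq> 0" using assms by auto
  then show ?thesis using assms unfolding X_def[abs_def] q_def[abs_def]
    by (auto intro!: derivative_eq_intros simp: field_simps)
qed

lemma E_deriv:
  assumes "q w \<notin> \<real>\<^sub>\<le>\<^sub>0"
  shows "(E has_field_derivative
    - (sl 1 * exp (- (sl 1 * X w)) + sl (- 1) * exp (- (sl (- 1) * X w))) / 2 * (of_real \<gamma> * X w * cnj \<zeta> / q w)) (at w)"
  unfolding E_def[abs_def]
  by (rule derivative_eq_intros X_deriv[OF assms] refl | simp)+
    (simp add: algebra_simps add_divide_distrib diff_divide_distrib)

lemma F_deriv:
  assumes "q w \<notin> \<real>\<^sub>\<le>\<^sub>0" and "(E has_field_derivative D) (at w)"
  shows "(F has_field_derivative (E w + (w - \<zeta>) * D)) (at w)"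
  unfolding F_def[abs_def]
  by (rule derivative_eq_intros assms(2) refl | simp)+

lemma not_nonpos: "Re (q w) > 0 \<Longrightarrow> q w \<notin> \<real>\<^sub>\<le>\<^sub>0"
  by (auto simp: complex_nonpos_Reals_iff)

lemma F_holomorphic: "F holomorphic_on ball 0 1"
  unfolding holomorphic_on_def field_differentiable_def
  using F_deriv[OF _ E_deriv] Re_q not_nonpos by (metis has_field_derivative_at_within mem_ball_0)

text \<open>The deviation from \<open>w - \<zeta>\<close>, whose odd part under inversion is exactly
  \<open>w - 1 / w\<close>. The odd quotient of this deviation is \<open>- H\<close> on the
  circle.\<close>

definition Nf :: "complex \<Rightarrow> complex" where "Nf w = F w - (w - \<zeta>)"

lemma Nf_eq: "Nf w = (w - \<zeta>) * (E w - 1)"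
  by (simp add: Nf_def F_def algebra_simps)

text \<open>The factor \<open>w - \<zeta>\<close> absorbs the singularity of \<open>X\<close>: the
  product has modulus \<open>cmod (q w) powr (1 - \<gamma>)\<close>, with positive exponent.\<close>

lemma norm_Nf:
  assumes w: "cmod w < 1"
  shows "cmod (Nf w) \<le> 4 * \<kappa>"
proof -
  note p = Re_q[OF w]
  have q0: "q w \<noteq> 0" using p by auto
  have "cmod (Nf w) \<le> cmod (q w) * (2 * \<kappa> * cmod (X w))"
    unfolding Nf_eq norm_mult norm_q by (intro mult_left_mono E_minus_1 p) auto
  also have "\<dots> = 2 * \<kappa> * cmod (q w) powr (1 - \<gamma>)"
    using q0 by (simp add: norm_X powr_minus powr_diff field_simps)
  also have "\<dots> \<le> 2 * \<kappa> * 2 powr (1 - \<gamma>)"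
    using \<gamma> \<kappa> norm_q_le[OF w] by (intro mult_left_mono powr_mono2) auto
  also have "\<dots> \<le> 2 * \<kappa> * 2 powr 1"
    using \<gamma> \<kappa> by (intro mult_left_mono powr_mono) auto
  finally show ?thesis by simp
qed

lemma Nf_deriv:
  assumes w: "cmod w < 1"
  obtains D where "(Nf has_field_derivative D) (at w)" "cmod D \<le> 4 * \<kappa> * cmod (q w) powr (- \<gamma>)"
proof -
  note p = Re_q[OF w]
  have q0: "q w \<noteq> 0" using p by auto
  define D where "D = - (sl 1 * exp (- (sl 1 * X w)) + sl (- 1) * exp (- (sl (- 1) * X w))) / 2 * (of_real \<gamma> * X w * cnj \<zeta> / q w)"
  have D: "(E has_field_derivative D) (at w)" unfolding D_def by (rule E_deriv[OF not_nonpos[OF p]])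
  have 1: "(Nf has_field_derivative ((E w - 1) + (w - \<zeta>) * D)) (at w)"
    unfolding Nf_eq[abs_def] by (rule derivative_eq_intros D refl | simp)+
  have e: "cmod (sl b * exp (- (sl b * X w))) \<le> 2 * \<kappa>" if b: "b \<in> {1, - 1}" for b
  proof -
    have "\<kappa> * (c0 / 2) * cmod (X w) \<ge> 0" using \<kappa> c0 by simp
    then have "Re (sl b * X w) \<ge> 0" using Re_sl[OF b Re_X[OF p]] by linarith
    then have "cmod (exp (- (sl b * X w))) \<le> 1" by simp
    then have "cmod (sl b) * cmod (exp (- (sl b * X w))) \<le> 2 * \<kappa> * 1"
      using norm_sl[OF b] \<kappa> by (intro mult_mono) auto
    then show ?thesis by (simp add: norm_mult)
  qed
  have "cmod (sl 1 * exp (- (sl 1 * X w)) + sl (- 1) * exp (- (sl (- 1) * X w))) \<le> 2 * \<kappa> + 2 * \<kappa>"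
    by (intro norm_triangle_le add_mono e) auto
  then have "cmod D \<le> (2 * \<kappa> + 2 * \<kappa>) / 2 * (\<gamma> * cmod (X w) * 1 / cmod (q w))"
    unfolding D_def norm_mult norm_divide norm_minus_cancel using \<gamma> \<zeta> \<kappa>
    by (intro mult_mono divide_right_mono) auto
  also have "\<dots> \<le> 2 * \<kappa> * (1 * cmod (X w) * 1 / cmod (q w))"
    using \<gamma> \<kappa> by (intro mult_mono divide_right_mono) auto
  finally have "cmod (q w) * cmod D \<le> cmod (q w) * (2 * \<kappa> * (cmod (X w) / cmod (q w)))"
    by (intro mult_left_mono) auto
  then have "cmod ((w - \<zeta>) * D) \<le> 2 * \<kappa> * cmod (X w)"
    using q0 by (simp add: norm_mult norm_q[symmetric])
  then have "cmod ((E w - 1) + (w - \<zeta>) * D) \<le> 2 * \<kappa> * cmod (X w) + 2 * \<kappa> * cmod (X w)"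
    by (intro norm_triangle_le add_mono E_minus_1 p)
  then show ?thesis using that[OF 1] q0 by (simp add: norm_X)
qed

text \<open>Close to the real axis the difference quotient is controlled by the derivative, which is only
  large near the zero \<open>\<zeta>\<close>; away from it the denominator is not small.\<close>

lemma Nf_quotient:
  assumes w: "cmod w < 1"
  shows "cmod (Nf w - Nf (cnj w)) \<le> cmod (w - cnj w) / 2"
proof (cases "\<bar>Im w\<bar> \<ge> \<bar>Im \<zeta>\<bar> / 2")
  case True
  have e: "w - cnj w = of_real (2 * Im w) * \<i>" by (simp add: complex_eq_iff)
  have "cmod (Nf w - Nf (cnj w)) \<le> 4 * \<kappa> + 4 * \<kappa>"
    using norm_triangle_ineq4[of "Nf w" "Nf (cnj w)"] norm_Nf[of w] norm_Nf[of "cnj w"] w by simp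
  also have "\<dots> \<le> \<bar>Im w\<bar>" using True by (simp add: \<kappa>_def)
  also have "\<dots> = cmod (w - cnj w) / 2" unfolding e norm_mult by simp
  finally show ?thesis .
next
  case False
  let ?s = "\<bar>Im \<zeta>\<bar> / 2"
  have s: "?s > 0" "?s \<le> 1" using \<zeta> abs_Im_le_cmod[of \<zeta>] by auto
  let ?S = "ball 0 1 \<inter> ({z. Im z \<le> ?s} \<inter> {z. Im z \<ge> - ?s})"
  have cv: "convex ?S"
    by (intro convex_Int convex_ball convex_halfspace_Im_le convex_halfspace_Im_ge)
  have "\<exists>D. (Nf has_field_derivative D) (at z within ?S) \<and> cmod D \<le> 1/2" if z: "z \<in> ?S" for z
  proof -
    have z1: "cmod z < 1" using z by simp
    obtain D where D: "(Nf has_field_derivative D) (at z)" "cmod D \<le> 4 * \<kappa> * cmod (q z) powr (- \<gamma>)"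
      using Nf_deriv[OF z1] by blast
    have "\<bar>Im z\<bar> \<le> ?s" using z by auto
    moreover have "\<bar>Im \<zeta>\<bar> \<le> \<bar>Im z\<bar> + \<bar>Im z - Im \<zeta>\<bar>" by arith
    ultimately have "?s \<le> \<bar>Im (z - \<zeta>)\<bar>" by simp
    also have "\<dots> \<le> cmod (q z)" unfolding norm_q by (rule abs_Im_le_cmod)
    finally have "cmod (q z) powr (- \<gamma>) \<le> ?s powr (- \<gamma>)"
      using s \<gamma> by (intro powr_mono2') auto
    also have "\<dots> \<le> ?s powr (- 1)" using s \<gamma> by (intro powr_mono') auto
    finally have "4 * \<kappa> * cmod (q z) powr (- \<gamma>) \<le> 4 * \<kappa> * ?s powr (- 1)"
      using \<kappa> by (intro mult_left_mono) auto
    also have "\<dots> = 1/2" using s by (simp add: powr_minus \<kappa>_def field_simps)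
    finally show ?thesis using D by (auto intro: has_field_derivative_at_within)
  qed
  then obtain f' where "\<And>z. z \<in> ?S \<Longrightarrow> (Nf has_field_derivative f' z) (at z within ?S)"
    "\<And>z. z \<in> ?S \<Longrightarrow> cmod (f' z) \<le> 1/2" by metis
  then have "norm (Nf w - Nf (cnj w)) \<le> 1/2 * norm (w - cnj w)"
    by (rule field_differentiable_bound[OF cv]) (use w False in auto)
  then show ?thesis by simp
qed

section \<open>Zeros of the flat function\<close>

lemma F_zero_iff:
  assumes w: "cmod w < 1"
  shows "F w = 0 \<longleftrightarrow> cos (of_real (\<kappa> * c0 / 2) * X w) = 0"
    and "F w = 0 \<Longrightarrow> \<exists>d. d \<noteq> 0 \<and> (F has_field_derivative d) (at w)"
proof -
  define k where "k = complex_of_real (\<kappa> * c0 / 2)"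
  have k0: "k \<noteq> 0" using \<kappa> c0 by (simp add: k_def)
  have wz: "w \<noteq> \<zeta>" using w \<zeta> by auto
  have np: "q w \<notin> \<real>\<^sub>\<le>\<^sub>0" by (rule not_nonpos[OF Re_q[OF w]])
  then have q0: "q w \<noteq> 0" by auto
  have X0: "X w \<noteq> 0" by (simp add: X_def)
  have sl: "sl 1 = of_real \<kappa> + \<i> * k" "sl (- 1) = of_real \<kappa> - \<i> * k"
    by (auto simp: sl_def k_def complex_eq_iff)
  have E: "E v = exp (- (of_real \<kappa> * X v)) * cos (k * X v)" for v
    by (simp add: E_def sl cos_exp_eq exp_add[symmetric] algebra_simps)
  then have iff: "F w = 0 \<longleftrightarrow> cos (k * X w) = 0" using wz by (simp add: F_def)
  then show "F w = 0 \<longleftrightarrow> cos (of_real (\<kappa> * c0 / 2) * X w) = 0" by (simp only: k_def)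
  \<comment> \<open>The cosine has simple zeros, the derivative of \<open>X\<close> never vanishes,
    and neither do the remaining factors in the disc.\<close>
  show "\<exists>d. d \<noteq> 0 \<and> (F has_field_derivative d) (at w)" if "F w = 0"
  proof -
    have c: "cos (k * X w) = 0" using that iff by simp
    then have s: "sin (k * X w) \<noteq> 0" using sin_cos_squared_add[of "k * X w"] by auto
    let ?X' = "of_real \<gamma> * X w * cnj \<zeta> / q w"
    define D where "D = - exp (- (of_real \<kappa> * X w)) * sin (k * X w) * (k * ?X')"
    have "((\<lambda>v. exp (- (of_real \<kappa> * X v)) * cos (k * X v)) has_field_derivative D) (at w)"
      by (rule derivative_eq_intros X_deriv[OF np] refl | simp)+ (simp add: D_def c)
    then have "(E has_field_derivative D) (at w)" by (simp add: E[abs_def])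
    then have "(F has_field_derivative (E w + (w - \<zeta>) * D)) (at w)" by (rule F_deriv[OF np])
    moreover have "E w + (w - \<zeta>) * D \<noteq> 0"
      using wz s k0 \<gamma> q0 \<zeta>_cnj(3) X0 by (simp add: E c D_def)
    ultimately show ?thesis by blast
  qed
qed

text \<open>At a zero, \<open>X w\<close> is an odd multiple of \<pi> / 2 over the cosine constant.
  Because \<gamma> < 1, \<open>Ln\<close> undoes the power and \<open>w\<close> is recovered as
  \<open>g n\<close>. At distance \<delta> from \<zeta> the modulus of \<open>X\<close> is bounded,
  which leaves finitely many \<open>n\<close>.\<close>

lemma F_zeros_finite:
  assumes "\<delta> > 0"
  shows "finite {w. cmod w < 1 \<and> F w = 0 \<and> cmod (w - \<zeta>) \<ge> \<delta>}"
proof -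
  let ?k = "\<kappa> * c0 / 2"
  have k0: "?k > 0" using \<kappa> c0 by simp
  define g where "g n = \<zeta> * (1 - exp (- (1 / of_real \<gamma>) * Ln (of_real ((real_of_int n * pi + pi / 2) / ?k))))" for n :: int
  define b where "b = ?k * \<delta> powr (- \<gamma>)"
  have "{w. cmod w < 1 \<and> F w = 0 \<and> cmod (w - \<zeta>) \<ge> \<delta>} \<subseteq> g ` {- \<lceil>b\<rceil> - 1..\<lceil>b\<rceil>}"
  proof (clarify)
    fix w assume w: "cmod w < 1" "F w = 0" "cmod (w - \<zeta>) \<ge> \<delta>"
    note p = Re_q[OF w(1)]
    have q0: "q w \<noteq> 0" using p by auto
    obtain n :: int where n: "of_real ?k * X w = of_real (real_of_int n * pi) + of_real pi / 2"
      using F_zero_iff(1)[OF w(1)] w(2) cos_eq_0 by blast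
    have Xn: "X w = of_real ((real_of_int n * pi + pi / 2) / ?k)"
    proof -
      have "X w = (of_real ?k * X w) / of_real ?k" using \<kappa> c0 by simp
      then show ?thesis unfolding n by simp
    qed
    have "\<bar>Im (Ln (q w))\<bar> < pi / 2" by (rule Re_Ln_pos_lt_imp[OF p])
    then have "\<gamma> * \<bar>Im (Ln (q w))\<bar> < 1 * pi" using \<gamma> pi_gt_zero
      by (intro mult_strict_mono) auto
    then have im: "\<bar>\<gamma> * Im (Ln (q w))\<bar> < pi" using \<gamma> by (simp add: abs_mult)
    have "Ln (X w) = - of_real \<gamma> * Ln (q w)"
      unfolding X_def by (rule Ln_exp) (use im in auto)
    then have "- (1 / of_real \<gamma>) * Ln (X w) = Ln (q w)" using \<gamma> by (simp add: field_simps)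
    then have "exp (- (1 / of_real \<gamma>) * Ln (X w)) = q w" using q0 by simp
    then have "g n = \<zeta> * (1 - q w)" unfolding g_def Xn by simp
    also have "\<dots> = w" using \<zeta>_cnj by (simp add: q_def mult.left_commute)
    finally have "w = g n" ..
    moreover have "n \<in> {- \<lceil>b\<rceil> - 1..\<lceil>b\<rceil>}"
    proof -
      have "cmod (X w) \<le> \<delta> powr (- \<gamma>)"
        using norm_X[OF q0] w(3) assms \<gamma> by (simp add: norm_q powr_mono2')
      then have "?k * cmod (X w) \<le> b" unfolding b_def using k0 by (intro mult_left_mono) auto
      moreover have "?k * cmod (X w) = \<bar>real_of_int n * pi + pi / 2\<bar>"
      proof -
        have cancel: "a * (t / a) = t" if "a > 0" for a t :: real using that by simp
        show ?thesis unfolding Xn norm_of_real abs_divide[of _ ?k] abs_of_pos[OF k0] by (rule cancel[OF k0])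
      qed
      moreover have "real_of_int n * pi + pi / 2 = pi * (real_of_int n + 1/2)" by (simp add: algebra_simps)
      ultimately have "pi * \<bar>real_of_int n + 1/2\<bar> \<le> b" by (simp add: abs_mult)
      moreover have "1 * \<bar>real_of_int n + 1/2\<bar> \<le> pi * \<bar>real_of_int n + 1/2\<bar>"
        using pi_gt3 by (intro mult_right_mono) auto
      ultimately have "\<bar>real_of_int n + 1/2\<bar> \<le> b" by simp
      then show ?thesis by (simp add: abs_le_iff) linarith
    qed
    ultimately show "w \<in> g ` {- \<lceil>b\<rceil> - 1..\<lceil>b\<rceil>}" by blast
  qed
  then show ?thesis by (rule finite_subset) simp
qed

text \<open>On the radius ending at \<zeta> the value \<open>q w\<close> is real, and
  \<open>X\<close> covers all reals above 1, hence hits infinitely many zeros of the cosine.\<close>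

lemma F_zeros_infinite: "infinite {w. w \<noteq> 0 \<and> cmod w < 1 \<and> F w = 0}"
proof
  assume fin: "finite {w. w \<noteq> 0 \<and> cmod w < 1 \<and> F w = 0}"
  let ?k = "\<kappa> * c0 / 2"
  have k0: "?k > 0" using \<kappa> c0 by simp
  \<comment> \<open>This keeps \<open>x n\<close> above 1, so that \<open>r n < 1\<close> and
    \<open>w n\<close> stays strictly between 0 and \<zeta>.\<close>
  have k1: "?k \<le> 1" using \<kappa> c0 mult_mono[of \<kappa> 1 c0 1] by simp
  define x where "x n = (real n * pi + pi / 2) / ?k" for n
  define r where "r n = x n powr (- (1 / \<gamma>))" for n
  define w where "w n = \<zeta> * of_real (1 - r n)" for n
  have x1: "x n > 1" for n
  proof -
    have "1 < pi / 2" using pi_gt3 by simp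
    also have "\<dots> \<le> real n * pi + pi / 2" using pi_gt_zero by simp
    also have "\<dots> \<le> x n"
    proof -
      have "(real n * pi + pi / 2) * ?k \<le> (real n * pi + pi / 2) * 1"
        using k1 pi_gt_zero by (intro mult_left_mono) auto
      then show ?thesis unfolding x_def using k0 by (subst pos_le_divide_eq) auto
    qed
    finally show ?thesis .
  qed
  have r: "0 < r n" "r n < 1" for n
  proof -
    show "0 < r n" using x1[of n] by (simp add: r_def)
    have "r n < x n powr 0" unfolding r_def using x1 \<gamma> by (intro powr_less_mono) auto
    then show "r n < 1" using x1[of n] by simp
  qed
  have wq: "q (w n) = of_real (r n)" for n
  proof -
    have "w n * cnj \<zeta> = (\<zeta> * cnj \<zeta>) * of_real (1 - r n)" by (simp only: w_def mult_ac)
    then show ?thesis using \<zeta>_cnj by (simp add: q_def)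
  qed
  have X: "X (w n) = of_real (x n)" for n
  proof -
    have "X (w n) = of_real (exp (- \<gamma> * ln (r n)))"
      using r[of n] by (simp add: X_def wq Ln_of_real flip: exp_of_real)
    also have "- \<gamma> * ln (r n) = ln (x n)" using x1[of n] \<gamma> by (simp add: r_def ln_powr)
    finally show ?thesis using x1[of n] by simp
  qed
  have wn: "cmod (w n) < 1" "w n \<noteq> 0" for n
    using r[of n] \<zeta>_cnj(3) by (simp_all add: w_def norm_mult \<zeta> del: of_real_diff)
  have "F (w n) = 0" for n
  proof -
    have "of_real ?k * X (w n) = of_real (real_of_int (int n) * pi) + of_real pi / 2"
      unfolding X x_def using \<kappa> c0 by simp
    then have "cos (of_real ?k * X (w n)) = 0" using cos_eq_0 by blast
    then show ?thesis using F_zero_iff(1)[OF wn(1)] by simp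
  qed
  then have "range w \<subseteq> {w. w \<noteq> 0 \<and> cmod w < 1 \<and> F w = 0}" using wn by auto
  then have "finite (range w)" using fin finite_subset by blast
  moreover have "inj w"
  proof (rule injI)
    fix m n assume "w m = w n"
    then have "X (w m) = X (w n)" by simp
    then have "x m = x n" by (simp only: X of_real_eq_iff)
    then have "real m * pi + pi / 2 = real n * pi + pi / 2" unfolding x_def using \<kappa> c0 by simp
    then show "m = n" by simp
  qed
  ultimately show False by (simp add: finite_image_iff)
qed

text \<open>This value becomes the coefficient \<open>m 0\<close>, by which the boundary condition
  of the Jacobi matrix is normalised.\<close>

lemma F_0: "F 0 \<noteq> 0"
proof -
  have "cmod (E 0 - 1) \<le> 2 * \<kappa> * cmod (X 0)" by (rule E_minus_1) (simp add: q_def)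
  also have "\<dots> < 1" using \<kappa> by (simp add: X_def q_def)
  finally have "E 0 \<noteq> 0" by auto
  then show ?thesis using \<zeta>_cnj by (simp add: F_def)
qed

section \<open>Flatness at the boundary point and bounds for all derivatives\<close>

lemma perturbation:
  obtains \<eta> where "0 < \<eta>" "\<eta> \<le> 1/2" "\<And>t. cmod t \<le> \<eta> \<Longrightarrow> cmod (exp (- of_real \<gamma> * Ln (1 + t)) - 1) \<le> c0 / 8"
proof -
  have "isCont (\<lambda>t. exp (- of_real \<gamma> * Ln (1 + t))) 0"
    by (intro continuous_intros) auto
  then obtain d where d: "d > 0"
    "\<And>t. dist t 0 < d \<Longrightarrow> dist (exp (- of_real \<gamma> * Ln (1 + t))) (exp (- of_real \<gamma> * Ln (1 + 0))) < c0 / 8"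
    unfolding continuous_at_eps_delta using c0 by (metis divide_pos_pos zero_less_numeral)
  show ?thesis
  proof (rule that[of "min (d / 2) (1/2)"])
    fix t assume "cmod t \<le> min (d / 2) (1/2)"
    then have "dist t 0 < d" using d(1) by simp
    from d(2)[OF this] show "cmod (exp (- of_real \<gamma> * Ln (1 + t)) - 1) \<le> c0 / 8"
      by (simp add: dist_norm)
  qed (use d in auto)
qed

text \<open>The Cauchy discs have radius proportional to the distance from \<zeta> and may leave the
  unit disc. On them \<open>q\<close> changes by a factor \<open>1 + t\<close> with small
  \<open>t\<close>, hence \<open>X\<close> by a factor within \<open>c0 / 8\<close> of 1, and this
  tolerance costs just half of the rate \<open>\<kappa> * c0 / 2\<close>.\<close>

lemma F_near:
  assumes \<eta>: "0 < \<eta>" "\<eta> \<le> 1/2" "\<And>t. cmod t \<le> \<eta> \<Longrightarrow> cmod (exp (- of_real \<gamma> * Ln (1 + t)) - 1) \<le> c0 / 8"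
    and w: "cmod w < 1" and v: "cmod (w - v) \<le> \<eta> * cmod (q w)"
  shows "q v \<notin> \<real>\<^sub>\<le>\<^sub>0" "cmod (F v) \<le> 4 * exp (- (\<kappa> * c0 / 4) * cmod (X w))"
proof -
  note p = Re_q[OF w]
  have q0: "q w \<noteq> 0" using p by auto
  define t where "t = (w - v) * cnj \<zeta> / q w"
  have t: "cmod t \<le> \<eta>" using v q0 by (simp add: t_def norm_mult norm_divide \<zeta> pos_divide_le_eq)
  have qv: "q v = q w * (1 + t)" using q0 by (simp add: t_def q_def field_simps)
  have "\<bar>Re t\<bar> \<le> 1/2" using t \<eta>(2) abs_Re_le_cmod[of t] by simp
  then have pt: "Re (1 + t) > 0" by simp
  then have t0: "1 + t \<noteq> 0" by (metis less_irrefl zero_complex.sel(1))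
  show nv: "q v \<notin> \<real>\<^sub>\<le>\<^sub>0"
  proof
    assume "q v \<in> \<real>\<^sub>\<le>\<^sub>0"
    then obtain x where x: "q v = of_real x" "x \<le> 0" by (auto elim!: nonpos_Reals_cases)
    have "q w * ((1 + t) * cnj (1 + t)) = of_real x * cnj (1 + t)" using x qv by (simp add: mult.assoc)
    then have "q w * of_real ((cmod (1 + t))\<^sup>2) = of_real x * cnj (1 + t)"
      by (simp only: complex_norm_square)
    from arg_cong[OF this, of Re] have "Re (q w) * (cmod (1 + t))\<^sup>2 = x * Re (1 + t)" by simp
    moreover have "Re (q w) * (cmod (1 + t))\<^sup>2 > 0" using p t0 by simp
    moreover have "x * Re (1 + t) \<le> 0" using x pt by (simp add: mult_nonpos_nonneg)
    ultimately show False by simp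
  qed
  define Y where "Y = exp (- of_real \<gamma> * Ln (1 + t))"
  have Y: "cmod (Y - 1) \<le> c0 / 8" unfolding Y_def by (rule \<eta>(3)[OF t])
  have "Ln (q v) = Ln (q w) + Ln (1 + t)"
    unfolding qv using Re_Ln_pos_lt_imp[OF p] Re_Ln_pos_lt_imp[OF pt]
    by (intro Ln_times_simple q0 t0) auto
  then have Xv: "X v = X w * Y" by (simp add: X_def Y_def exp_add[symmetric] ring_distribs)
  have e: "cmod (exp (- (sl b * X v))) \<le> exp (- (\<kappa> * c0 / 4) * cmod (X w))" if b: "b \<in> {1, - 1}" for b
  proof -
    have "cmod (sl b * X w * (Y - 1)) \<le> 2 * \<kappa> * cmod (X w) * (c0 / 8)"
      unfolding norm_mult using norm_sl[OF b] \<kappa> Y by (intro mult_mono) auto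
    then have "Re (sl b * X w * (Y - 1)) \<ge> - (2 * \<kappa> * cmod (X w) * (c0 / 8))"
      using abs_Re_le_cmod[of "sl b * X w * (Y - 1)"] by linarith
    moreover have "Re (sl b * X w) \<ge> \<kappa> * (c0 / 2) * cmod (X w)" by (rule Re_sl[OF b Re_X[OF p]])
    moreover have "sl b * X v = sl b * X w + sl b * X w * (Y - 1)" by (simp add: Xv algebra_simps)
    ultimately have "Re (sl b * X v) \<ge> \<kappa> * (c0 / 2) * cmod (X w) - 2 * \<kappa> * cmod (X w) * (c0 / 8)" by simp
    also have "\<kappa> * (c0 / 2) * cmod (X w) - 2 * \<kappa> * cmod (X w) * (c0 / 8) = \<kappa> * c0 / 4 * cmod (X w)"
      by (simp add: field_simps)
    finally show ?thesis by simp
  qed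
  let ?e = "exp (- (\<kappa> * c0 / 4) * cmod (X w))"
  have "cmod (exp (- (sl 1 * X v)) + exp (- (sl (- 1) * X v))) \<le> ?e + ?e"
    by (intro norm_triangle_le add_mono e) auto
  then have E: "cmod (E v) \<le> ?e" by (simp add: E_def norm_divide)
  have "cmod (v - \<zeta>) = cmod (q w) * cmod (1 + t)" by (simp only: norm_q[symmetric] qv norm_mult)
  also have "\<dots> \<le> 2 * 2"
    using norm_triangle_ineq[of 1 t] t \<eta> by (intro mult_mono norm_q_le w) auto
  finally show "cmod (F v) \<le> 4 * ?e"
    unfolding F_def norm_mult using E by (intro mult_mono) auto
qed

text \<open>Cauchy's inequality on these discs bounds the kth derivative by \<open>k!\<close> times
  \<open>(\<eta> * cmod (q w)) ^ k\<close> inverted and damped by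
  \<open>exp (- \<delta> * cmod (X w))\<close>. In terms of \<bar>X\<bar> this is a power times an
  exponential; its maximum contributes \<open>k powr (k / \<gamma>)\<close>, so the Gevrey order is
  \<open>1 + 1 / \<gamma> = 1 / \<beta>\<close>.\<close>

lemma F_coeff_decay:
  obtains C K where "K > 0" "C \<ge> 0" "\<And>n. cmod ((deriv ^^ n) F 0 / fact n) \<le> C * exp (- K * real n powr \<beta>)"
proof -
  obtain \<eta> where \<eta>: "0 < \<eta>" "\<eta> \<le> 1/2" "\<And>t. cmod t \<le> \<eta> \<Longrightarrow> cmod (exp (- of_real \<gamma> * Ln (1 + t)) - 1) \<le> c0 / 8"
    using perturbation by blast
  define \<delta> where "\<delta> = \<kappa> * c0 / 4"
  have \<delta>: "\<delta> > 0" using \<kappa> c0 by (simp add: \<delta>_def)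
  define L where "L = (1 / \<eta>) * (1 / (\<gamma> * \<delta>)) powr (1 / \<gamma>)"
  have L: "L \<ge> 0" using \<eta> by (simp add: L_def)
  have bd: "cmod ((deriv ^^ k) F w) \<le> 4 * (L * real k powr (1 / \<beta>)) ^ k" if w: "cmod w < 1" for k w
  proof -
    note near = F_near[OF \<eta> w]
    have q0: "q w \<noteq> 0" using Re_q[OF w] by auto
    have x0: "cmod (X w) > 0" by (simp add: X_def)
    define r where "r = \<eta> * cmod (q w)"
    have r: "r > 0" using \<eta> q0 by (simp add: r_def)
    have der: "\<exists>D. (F has_field_derivative D) (at v)" if "v \<in> cball w r" for v
      using F_deriv[OF near(1) E_deriv[OF near(1)]] that by (auto simp: dist_norm r_def)
    have "cmod ((deriv ^^ k) F w) \<le> fact k * (4 * exp (- \<delta> * cmod (X w))) / r ^ k"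
    proof (rule Cauchy_inequality)
      show "F holomorphic_on ball w r"
        unfolding holomorphic_on_def field_differentiable_def
        using der by (meson ball_subset_cball has_field_derivative_at_within subsetD)
      show "continuous_on (cball w r) F"
        using der by (meson DERIV_isCont continuous_at_imp_continuous_on)
      show "norm (w - v) = r \<Longrightarrow> norm (F v) \<le> 4 * exp (- \<delta> * cmod (X w))" for v
        using near(2)[of v] by (simp add: r_def \<delta>_def)
    qed (rule r)
    also have "\<dots> \<le> 4 * (L * real k powr (1 / \<beta>)) ^ k"
    proof (cases "k = 0")
      case True
      then show ?thesis using \<delta> by simp
    next
      case False
      define t where "t = real k / \<gamma>"
      have t: "t > 0" using False \<gamma> by (simp add: t_def)
      have qk: "1 / cmod (q w) ^ k = cmod (X w) powr t"
      proof -
        have "cmod (X w) powr t = cmod (q w) powr (- \<gamma> * t)" by (simp only: norm_X[OF q0] powr_powr)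
        also have "- \<gamma> * t = - real k" using \<gamma> by (simp add: t_def)
        finally show ?thesis using q0 by (simp add: powr_minus powr_realpow inverse_eq_divide)
      qed
      have "fact k * (4 * exp (- \<delta> * cmod (X w))) / r ^ k
          = 4 * fact k * (1 / \<eta>) ^ k * (cmod (X w) powr t * exp (- \<delta> * cmod (X w)))"
        unfolding qk[symmetric] by (simp add: r_def power_mult_distrib power_divide field_simps)
      also have "\<dots> \<le> 4 * real k ^ k * (1 / \<eta>) ^ k * (t / \<delta>) powr t"
        using \<eta> powr_mult_exp_le[OF x0 t \<delta>] fact_le_power[of k, where ?'a = real]
        by (intro mult_mono mult_nonneg_nonneg) auto
      also have "\<dots> = 4 * (L * real k powr (1 / \<beta>)) ^ k"
      proof -
        have "(t / \<delta>) powr t = ((t / \<delta>) powr (1 / \<gamma>)) ^ k"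
        proof -
          have "(t / \<delta>) powr (1 / \<gamma>) > 0" using t \<delta> by simp
          from powr_realpow[OF this, of k] show ?thesis by (simp add: powr_powr t_def)
        qed
        also have "(t / \<delta>) powr (1 / \<gamma>) = (1 / (\<gamma> * \<delta>)) powr (1 / \<gamma>) * real k powr (1 / \<gamma>)"
          using \<gamma> \<delta> by (simp add: t_def powr_mult[symmetric])
        finally have "real k ^ k * (1 / \<eta>) ^ k * (t / \<delta>) powr t
            = (real k * (1 / \<eta>) * ((1 / (\<gamma> * \<delta>)) powr (1 / \<gamma>) * real k powr (1 / \<gamma>))) ^ k"
          by (simp only: power_mult_distrib)
        also have "real k * (1 / \<eta>) * ((1 / (\<gamma> * \<delta>)) powr (1 / \<gamma>) * real k powr (1 / \<gamma>))
            = L * real k powr (1 / \<beta>)"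
          using False by (simp add: L_def \<gamma>(3) powr_add)
        finally show ?thesis by (simp add: mult.assoc)
      qed
      finally show ?thesis .
    qed
    finally show ?thesis .
  qed
  show ?thesis
    by (rule gevrey_coeff_decay[OF F_holomorphic \<beta>(1) _ _ L bd]) (use \<beta> that in auto)
qed

end

text \<open>The interface to the direct sum. An infinite \<open>Z\<close> that is finite outside
  every neighbourhood of \<open>x\<close> accumulates at \<open>x\<close> and nowhere else. The last
  clause gives finite multiplicity and, at the same time, that \<open>Z\<close> misses no eigenvalue
  off the interval.\<close>

definition discrete_block :: "real \<Rightarrow> real \<Rightarrow> (nat \<Rightarrow> complex) \<Rightarrow> (nat \<Rightarrow> complex) \<Rightarrow> complex set \<Rightarrow> bool"
  where "discrete_block \<beta> x A B Z \<longleftrightarrow> (\<forall>n\<ge>1. A n \<noteq> 0) \<and>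
    (\<exists>C. \<exists>c>0. \<forall>n\<ge>1. cmod (B n) + cmod (A n - 1) \<le> C * exp (- c * real n powr \<beta>)) \<and>
    infinite Z \<and> Z \<inter> complex_of_real ` {-2..2} = {} \<and>
    (\<forall>U. open U \<longrightarrow> complex_of_real x \<in> U \<longrightarrow> finite (Z - U)) \<and>
    (\<forall>z\<in>Z. \<exists>u\<in>ell2. u \<noteq> (\<lambda>_. 0) \<and> jacobi_op A B z u = (\<lambda>_. 0)) \<and>
    (\<forall>z. z \<notin> complex_of_real ` {-2..2} \<longrightarrow> (\<exists>u. \<forall>v\<in>ell2. \<forall>k. (jacobi_op A B z ^^ k) v = (\<lambda>_. 0) \<longrightarrow>
      (\<exists>q. v = (\<lambda>n. q * u n)) \<and> (z \<notin> Z \<longrightarrow> v = (\<lambda>_. 0))))"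

text \<open>The two roots of \<open>w^2 - z * w + 1\<close> have product 1. If neither is inside the
  disc, they are conjugate on the circle and their sum \<open>z\<close> lies in the
  interval.\<close>

lemma inverse_joukowski:
  assumes "z \<notin> complex_of_real ` {-2..2}"
  obtains w where "w \<noteq> 0" "cmod w < 1" "z = w + inverse w"
proof -
  define s where "s = csqrt (z\<^sup>2 - 4)"
  have s: "s\<^sup>2 = z\<^sup>2 - 4" by (simp add: s_def)
  define w1 w2 where "w1 = (z + s) / 2" and "w2 = (z - s) / 2"
  have "w1 * w2 = (z\<^sup>2 - s\<^sup>2) / 4" by (simp add: w1_def w2_def power2_eq_square algebra_simps)
  then have p: "w1 * w2 = 1" by (simp add: s)
  have sum: "z = w1 + w2" by (simp add: w1_def w2_def field_simps)
  have n0: "w1 \<noteq> 0" "w2 \<noteq> 0" using p by auto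
  have inv: "w2 = inverse w1" "w1 = inverse w2" using p n0 by (auto simp: field_simps)
  have "cmod w2 < 1" if "cmod w1 > 1"
  proof -
    have "cmod w2 = 1 / cmod w1" unfolding inv(1) by (simp add: norm_inverse inverse_eq_divide norm_divide)
    then show ?thesis using that by (simp add: divide_less_eq)
  qed
  then consider "cmod w1 < 1" | "cmod w2 < 1" | "cmod w1 = 1" by linarith
  then show ?thesis
  proof cases
    case 1
    then show ?thesis using that[of w1] n0 sum inv(1)[symmetric] by simp
  next
    case 2
    then show ?thesis using that[of w2] n0 sum inv(2)[symmetric] by (simp add: add.commute)
  next
    case 3
    then have "w2 = cnj w1" using inv(1) by (simp add: inverse_eq_divide divide_conv_cnj)
    then have "z = complex_of_real (2 * Re w1)" using sum complex_add_cnj by simp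
    moreover have "2 * Re w1 \<in> {-2..2}" using abs_Re_le_cmod[of w1] 3 by auto
    ultimately show ?thesis using assms by blast
  qed
qed

text \<open>For real \<open>x\<close> of modulus at most 2 the quadratic
  \<open>w^2 - x * w + 1\<close> has nonpositive discriminant, which puts its roots on the circle;
  \<open>d\<close> is the offset from their midpoint.\<close>

lemma joukowski_not_real:
  assumes "w \<noteq> 0" "cmod w < 1"
  shows "w + inverse w \<notin> complex_of_real ` {-2..2}"
proof
  assume "w + inverse w \<in> complex_of_real ` {-2..2}"
  then obtain x where x: "w + inverse w = of_real x" "\<bar>x\<bar> \<le> 2" by force
  define d where "d = w - of_real (x / 2)"
  have "w * (w + inverse w) = w * of_real x" by (simp only: x)
  then have ww: "w * w = w * of_real x - 1" using assms(1) by (simp add: distrib_left eq_diff_eq)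
  have "d\<^sup>2 = w * w - w * of_real x + of_real ((x / 2)\<^sup>2)"
    by (simp add: d_def power2_eq_square field_simps)
  then have d2: "d\<^sup>2 = of_real ((x / 2)\<^sup>2 - 1)" unfolding ww by simp
  have "\<bar>x / 2\<bar> \<le> 1" using x(2) by simp
  then have le: "(x / 2)\<^sup>2 \<le> 1" by (simp add: abs_square_le_1)
  have "Re (d\<^sup>2) = (x / 2)\<^sup>2 - 1" "Im (d\<^sup>2) = 0" using d2 by simp_all
  then have dd: "(Re d)\<^sup>2 - (Im d)\<^sup>2 = (x / 2)\<^sup>2 - 1" "Re d * Im d = 0"
    by (auto simp: power2_eq_square)
  have "Re d = 0"
  proof (rule ccontr)
    assume r: "Re d \<noteq> 0"
    then have "Im d = 0" using dd(2) by simp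
    then have "(Re d)\<^sup>2 \<le> 0" using dd(1) le by simp
    then show False using r by simp
  qed
  then have sq: "(Im d)\<^sup>2 = 1 - (x / 2)\<^sup>2" using dd(1) by simp
  have rw: "Re w = x / 2" using \<open>Re d = 0\<close> by (simp add: d_def)
  have imd: "Im d = Im w" by (simp add: d_def)
  have "(Re w)\<^sup>2 + (Im w)\<^sup>2 = 1" unfolding rw imd[symmetric] sq by simp
  then have "cmod w = 1" by (simp add: cmod_def)
  then show False using assms(2) by simp
qed

lemma joukowski_inj:
  assumes "w \<noteq> 0" "cmod w < 1" "v \<noteq> 0" "cmod v < 1" "w + inverse w = v + inverse v"
  shows "w = v"
proof -
  have "(w - v) * (1 - inverse (w * v)) = 0"
    using assms by (simp add: field_simps)
  moreover have "w * v \<noteq> 1"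
  proof
    assume "w * v = 1"
    then have "cmod w * cmod v = 1" by (metis norm_mult norm_one)
    moreover have "cmod w * cmod v < 1 * 1" using assms by (intro mult_strict_mono') auto
    ultimately show False by simp
  qed
  ultimately show ?thesis using assms by (auto simp: inverse_eq_1_iff simp del: inverse_mult_distrib)
qed

section \<open>From the flat function to a Jacobi matrix\<close>

context flat_function
begin

definition mc :: "nat \<Rightarrow> complex" where "mc n = (deriv ^^ n) F 0 / fact n"
text \<open>On the circle the power series takes the place of \<open>F\<close>: its coefficients are
  absolutely summable, so it is continuous even at \<zeta>, where \<open>X\<close> is
  singular.\<close>

definition M :: "complex \<Rightarrow> complex" where "M w = (\<Sum>n. mc n * w ^ n)"

lemma mc_summable: "summable (\<lambda>n. cmod (mc n))"
proof -
  obtain C K where CK: "K > 0" "\<And>n. cmod (mc n) \<le> C * exp (- K * real n powr \<beta>)"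
    using F_coeff_decay unfolding mc_def by blast
  have "summable (\<lambda>n. C * exp (- K * real n powr \<beta>))"
    by (intro summable_mult summable_exp_powr_nat CK(1) \<beta>(1))
  then show ?thesis by (rule summable_comparison_test[rotated]) (use CK(2) in auto)
qed

lemma M_laurent: "laurent_on (one_sided mc) M pdisc"
  unfolding M_def[abs_def] by (rule laurent_on_one_sided[OF mc_summable])

lemma M_F:
  assumes "cmod w < 1"
  shows "M w = F w"
proof -
  have "(\<lambda>n. mc n * (w - 0) ^ n) sums F w"
    unfolding mc_def by (rule holomorphic_power_series[OF F_holomorphic]) (use assms in simp)
  then show ?thesis unfolding M_def by (simp add: sums_iff)
qed

lemma one_sided_neg: "n < 0 \<Longrightarrow> one_sided c n = 0"
  by (simp add: one_sided_def)

lemma M_cont: "continuous_on pdisc M"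
  by (rule laurent_on_pdisc_continuous[OF M_laurent one_sided_neg])

text \<open>A limit along radii: inside the disc the estimate compares \<open>w\<close> with
  \<open>cnj w\<close>, which becomes \<open>1 / w\<close> on the circle.\<close>

lemma M_quotient:
  assumes w: "w \<in> circle"
  shows "cmod ((M w - (w - \<zeta>)) - (M (inverse w) - (inverse w - \<zeta>))) \<le> cmod (w - inverse w) / 2"
proof -
  have iw: "inverse w = cnj w" using w by (simp add: inverse_eq_divide divide_conv_cnj)
  define r where "r n = 1 - 1 / real (n + 2)" for n
  have r: "0 < r n" "r n < 1" for n by (simp_all add: r_def)
  have r': "r n \<noteq> 0" "\<bar>r n\<bar> \<le> 1" for n using r[of n] by auto
  have r1: "r \<longlonglongrightarrow> 1"
  proof -
    have "(\<lambda>n. 1 / real (n + 2)) \<longlonglongrightarrow> 0" by real_asymp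
    then have "(\<lambda>n. 1 - 1 / real (n + 2)) \<longlonglongrightarrow> 1 - 0" by (intro tendsto_intros)
    then show ?thesis by (simp add: r_def[abs_def])
  qed
  have lim: "(\<lambda>n. of_real (r n) * v) \<longlonglongrightarrow> v" for v :: complex
  proof -
    have "(\<lambda>n. of_real (r n) * v) \<longlonglongrightarrow> of_real 1 * v" by (intro tendsto_intros r1)
    then show ?thesis by simp
  qed
  have Mlim: "(\<lambda>n. M (of_real (r n) * v)) \<longlonglongrightarrow> M v" if v: "v \<in> circle" for v
  proof (rule continuous_on_tendsto_compose[OF M_cont lim])
    show "v \<in> pdisc" using v by auto
    show "\<forall>\<^sub>F n in sequentially. of_real (r n) * v \<in> pdisc"
      using r' v by (intro always_eventually allI) (auto simp: norm_mult)
  qed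
  have cw: "cnj w \<in> circle" using w by simp
  let ?g = "\<lambda>n. (M (of_real (r n) * w) - (of_real (r n) * w - \<zeta>)) - (M (of_real (r n) * cnj w) - (of_real (r n) * cnj w - \<zeta>))"
  show ?thesis
  proof (rule LIMSEQ_le)
    show "(\<lambda>n. cmod (?g n)) \<longlonglongrightarrow> cmod ((M w - (w - \<zeta>)) - (M (inverse w) - (inverse w - \<zeta>)))"
      unfolding iw by (intro tendsto_intros Mlim lim w cw)
    show "(\<lambda>n. cmod (of_real (r n) * w - of_real (r n) * cnj w) / 2) \<longlonglongrightarrow> cmod (w - inverse w) / 2"
      unfolding iw by (intro tendsto_intros lim) simp
    show "\<exists>N. \<forall>n\<ge>N. cmod (?g n) \<le> cmod (of_real (r n) * w - of_real (r n) * cnj w) / 2"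
    proof (intro exI allI impI)
      fix n
      have 1: "cmod (of_real (r n) * w) < 1" "cmod (of_real (r n) * cnj w) < 1"
        using r[of n] w by (simp_all add: norm_mult)
      have "cnj (of_real (r n) * w) = of_real (r n) * cnj w" by simp
      with Nf_quotient[OF 1(1)] show "cmod (?g n) \<le> cmod (of_real (r n) * w - of_real (r n) * cnj w) / 2"
        by (simp only: M_F[OF 1(1)] M_F[OF 1(2)] Nf_def)
    qed
  qed
qed

text \<open>\<open>H\<close> is the antisymmetric quotient of \<open>(w - \<zeta>) - M w\<close>.
  Its bound follows by division away from 1 and -1 and reaches these two points by
  continuity.\<close>

lemma weight_exists:
  obtains h H where "subexp_decay \<beta> h" "laurent_on h H circle" "\<And>n. h (- n) = h n"
    "\<And>w. w \<in> circle \<Longrightarrow> cmod (H w) \<le> 1/2"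
    "\<And>w. w \<in> circle \<Longrightarrow> M w - M (inverse w) = (w - inverse w) * (1 - H w)"
proof -
  obtain C K where CK: "K > 0" "C \<ge> 0" "\<And>n. cmod (mc n) \<le> C * exp (- K * real n powr \<beta>)"
    using F_coeff_decay unfolding mc_def by blast
  define l where "l n = (if n = 0 then - \<zeta> else if n = 1 then 1 else 0)" for n :: nat
  define c where "c n = l n - mc n" for n
  \<comment> \<open>The factor \<open>exp K\<close> makes up for the coefficient 1 of
    \<open>w\<close>, to be compared with \<open>exp (- K)\<close> at \<open>n = 1\<close>.\<close>
  have cb: "cmod (c n) \<le> (C + exp K) * exp (- K * real n powr \<beta>)" for n
  proof -
    consider "n = 0" | "n = 1" | "n \<ge> 2" by linarith
    then have "cmod (l n) \<le> exp K * exp (- K * real n powr \<beta>)"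
      by cases (use CK(1) \<zeta> in \<open>auto simp: l_def exp_add[symmetric]\<close>)
    then show ?thesis
      using CK(3)[of n] norm_triangle_ineq4[of "l n" "mc n"] by (simp add: c_def distrib_right)
  qed
  have lsum: "(\<lambda>n. l n * w ^ n) sums (w - \<zeta>)" for w
  proof -
    have "(\<lambda>n. l n * w ^ n) sums (\<Sum>n\<in>{0, 1}. l n * w ^ n)"
      by (rule sums_finite) (auto simp: l_def)
    then show ?thesis by (simp add: l_def)
  qed
  have csum: "(\<Sum>n. c n * w ^ n) = (w - \<zeta>) - M w" if w: "w \<in> circle" for w
  proof -
    have "summable (\<lambda>n. mc n * w ^ n)"
      by (rule summable_comparison_test[OF _ mc_summable]) (use w in \<open>auto simp: norm_mult norm_power\<close>)
    then have "(\<lambda>n. mc n * w ^ n) sums M w" unfolding M_def by (rule summable_sums)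
    from sums_diff[OF lsum this] show ?thesis by (simp add: c_def sums_iff left_diff_distrib)
  qed
  obtain h H where h: "subexp_decay \<beta> h" "laurent_on h H circle" "\<And>j. h (- j) = h j"
    and H: "\<And>w. w \<in> circle \<Longrightarrow> (w - inverse w) * H w = (\<Sum>n. c n * w ^ n) - (\<Sum>n. c n * inverse w ^ n)"
    by (rule symmetric_quotient[OF \<beta>(1) _ CK(1) _ cb]) (use \<beta> CK in auto)
  have ic: "inverse w \<in> circle" if "w \<in> circle" for w :: complex using that by (simp add: norm_inverse)
  have H': "(w - inverse w) * H w = ((w - \<zeta>) - M w) - ((inverse w - \<zeta>) - M (inverse w))" if w: "w \<in> circle" for w
    using H[OF w] csum[OF w] csum[OF ic[OF w]] by simp
  have b0: "cmod (H w) \<le> 1/2" if w: "w \<in> circle" and ne: "w \<noteq> inverse w" for w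
  proof -
    have "cmod (w - inverse w) * cmod (H w) = cmod ((M w - (w - \<zeta>)) - (M (inverse w) - (inverse w - \<zeta>)))"
      unfolding norm_mult[symmetric] H'[OF w] by (simp add: norm_minus_commute algebra_simps)
    also have "\<dots> \<le> cmod (w - inverse w) / 2" by (rule M_quotient[OF w])
    finally have "cmod (w - inverse w) * cmod (H w) \<le> cmod (w - inverse w) * (1/2)" by simp
    then show ?thesis using ne by (subst (asm) mult_le_cancel_left_pos) auto
  qed
  have b1: "cmod (H w) \<le> 1/2" if w: "w \<in> circle" for w
  proof (cases "w = inverse w")
    case True
    have ww: "w * w = 1" using True w by (metis mem_sphere_0 norm_zero right_inverse zero_neq_one)
    \<comment> \<open>Twice the rotation angle lies in \<open>(0, 2]\<close>, below \<pi>, so these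
      points avoid the fixed points of inversion.\<close>
    define x where "x n = w * cis (1 / real (n + 1))" for n
    have xc: "x n \<in> circle" for n using w by (simp add: x_def norm_mult)
    have xn: "x n \<noteq> inverse (x n)" for n
    proof
      assume "x n = inverse (x n)"
      moreover have "x n \<noteq> 0" using xc[of n] by auto
      ultimately have "x n * x n = 1" by (metis right_inverse)
      moreover have "x n * x n = (w * w) * (cis (1 / real (n + 1)) * cis (1 / real (n + 1)))"
        by (simp only: x_def mult_ac)
      ultimately have "cis (1 / real (n + 1)) * cis (1 / real (n + 1)) = 1" by (simp only: ww mult_1_left)
      then have "cis (2 * (1 / real (n + 1))) = 1"
        by (simp add: cis_mult)
      then have "sin (2 * (1 / real (n + 1))) = 0" by (simp add: complex_eq_iff)
      moreover have "2 * (1 / real (n + 1)) \<le> 2" by (simp add: divide_le_eq)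
      then have "sin (2 * (1 / real (n + 1))) > 0" using pi_gt3 by (intro sin_gt_zero) auto
      ultimately show False by simp
    qed
    have "(\<lambda>n. 1 / real (n + 1)) \<longlonglongrightarrow> 0" by real_asymp
    then have "(\<lambda>n. cis (1 / real (n + 1))) \<longlonglongrightarrow> cis 0" by (intro tendsto_intros)
    then have "(\<lambda>n. w * cis (1 / real (n + 1))) \<longlonglongrightarrow> w * cis 0" by (rule tendsto_mult_left)
    then have "x \<longlonglongrightarrow> w" by (simp add: x_def[abs_def])
    then have "(\<lambda>n. H (x n)) \<longlonglongrightarrow> H w"
      by (rule continuous_on_tendsto_compose[OF laurent_on_circle_continuous[OF h(2)]]) (use w xc in auto)
    then have "(\<lambda>n. cmod (H (x n))) \<longlonglongrightarrow> cmod (H w)" by (rule tendsto_norm)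
    then show ?thesis by (rule LIMSEQ_le_const2) (use b0[OF xc xn] in auto)
  qed (use b0 w in blast)
  show ?thesis
  proof (rule that[OF h b1])
    fix w :: complex assume "w \<in> circle"
    from H'[OF this] show "M w - M (inverse w) = (w - inverse w) * (1 - H w)"
      by (simp add: right_diff_distrib)
  qed
qed

lemma discrete_block_exists: "\<exists>A B Z. discrete_block \<beta> (2 * Re \<zeta>) A B Z"
proof -
  have \<beta>': "0 < \<beta>" "\<beta> \<le> 1" using \<beta> by auto
  obtain h H where h: "subexp_decay \<beta> h" "laurent_on h H circle" "\<And>n. h (- n) = h n"
    and H: "\<And>w. w \<in> circle \<Longrightarrow> cmod (H w) \<le> 1/2"
      "\<And>w. w \<in> circle \<Longrightarrow> M w - M (inverse w) = (w - inverse w) * (1 - H w)"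
    using weight_exists by blast
  obtain fc f fic fi s S \<kappa>' where wh:
    "laurent_on fc f pdisc" "fc 0 = 1" "\<And>n. n < 0 \<Longrightarrow> fc n = 0"
    "laurent_on fic fi pdisc" "\<And>n. n < 0 \<Longrightarrow> fic n = 0"
    "\<And>w. f w * fi w = 1"
    "laurent_on s S circle" "subexp_decay \<beta> s"
    "\<And>w. w \<in> circle \<Longrightarrow> f (inverse w) = S w * f w"
    "\<kappa>' \<noteq> 0" "\<And>w. w \<in> circle \<Longrightarrow> f w * f (inverse w) * (1 - H w) = \<kappa>'"
    by (rule wiener_hopf[OF \<beta>' h(1,2) H(1) h(3)]) (assumption | rule that | blast)+
  interpret J: jost_data \<beta> "one_sided mc" fc fic s M H f fi S \<kappa>'
    by unfold_locales (fact \<beta>' M_laurent one_sided_neg H wh)+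
  have "one_sided mc 0 \<noteq> 0" using F_0 by (simp add: one_sided_def mc_def)
  then obtain A B y C c N G where sol:
    "\<And>n. n \<ge> 1 \<Longrightarrow> A n \<noteq> 0" "c > 0"
    "\<And>n. n \<ge> 1 \<Longrightarrow> cmod (B n) + cmod (A n - 1) \<le> C * exp (- c * real n powr \<beta>)"
    "\<And>n w. n \<ge> 1 \<Longrightarrow> w \<in> pdisc \<Longrightarrow> (w + inverse w) * y n w = y (n - 1) w + B n * y n w + A n * y (Suc n) w"
    "\<And>n w. n \<ge> N \<Longrightarrow> w \<in> pdisc \<Longrightarrow> cmod (y n w - w ^ n) \<le> cmod w ^ n / 2"
    "\<And>n. continuous_on pdisc (y n)"
    "\<And>w. w \<in> pdisc \<Longrightarrow> y 0 w = G w * M w" "continuous_on pdisc G" "\<And>w. G w \<noteq> 0"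
    by (rule J.jacobi_solutions) (assumption | rule that | blast)+
  interpret Y: jacobi_jost \<beta> C c N A B y G M
    by unfold_locales (fact \<beta>' sol)+
  define W where "W = {w. w \<noteq> 0 \<and> cmod w < 1 \<and> F w = 0}"
  define Z where "Z = (\<lambda>w. w + inverse w) ` W"
  have injW: "inj_on (\<lambda>w. w + inverse w) W"
    using joukowski_inj by (auto simp: inj_on_def W_def)
  have simple: "\<exists>d. d \<noteq> 0 \<and> (M has_field_derivative d) (at w)" if w: "cmod w < 1" "M w = 0" for w
  proof -
    have "F w = 0" using w M_F by simp
    then obtain d where d: "d \<noteq> 0" "(F has_field_derivative d) (at w)" using F_zero_iff(2)[OF w(1)] by blast
    have "(M has_field_derivative d) (at w)"
      by (rule has_field_derivative_transform_within_open[OF d(2), of "ball 0 1"]) (use w M_F in auto)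
    with d(1) show ?thesis by blast
  qed
  have "infinite Z"
    unfolding Z_def using finite_imageD[OF _ injW] F_zeros_infinite by (auto simp: W_def)
  moreover have "Z \<inter> complex_of_real ` {-2..2} = {}"
    using joukowski_not_real by (auto simp: Z_def W_def)
  \<comment> \<open>The zeros accumulate only at \<zeta>, and \<open>w + 1 / w\<close> is continuous
    there with value \<open>2 * Re \<zeta>\<close>.\<close>
  moreover have "finite (Z - U)" if U: "open U" "complex_of_real (2 * Re \<zeta>) \<in> U" for U
  proof -
    have "inverse \<zeta> = cnj \<zeta>" using \<zeta> by (simp add: inverse_eq_divide divide_conv_cnj)
    then have e: "\<zeta> + inverse \<zeta> = complex_of_real (2 * Re \<zeta>)" by (simp add: complex_add_cnj)
    have "isCont (\<lambda>w. w + inverse w) \<zeta>" by (intro continuous_intros) (use \<zeta>_cnj in auto)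
    then have "eventually (\<lambda>w. w + inverse w \<in> U) (at \<zeta>)"
      unfolding isCont_def by (rule topological_tendstoD) (use U e in auto)
    then obtain d where d: "d > 0" "\<And>w. w \<noteq> \<zeta> \<Longrightarrow> dist w \<zeta> < d \<Longrightarrow> w + inverse w \<in> U"
      unfolding eventually_at by blast
    have "Z - U \<subseteq> (\<lambda>w. w + inverse w) ` {w. cmod w < 1 \<and> F w = 0 \<and> cmod (w - \<zeta>) \<ge> d}"
    proof
      fix z assume "z \<in> Z - U"
      then obtain w where w: "cmod w < 1" "F w = 0" "z = w + inverse w" "w + inverse w \<notin> U"
        by (auto simp: Z_def W_def)
      have "w \<noteq> \<zeta>" using w \<zeta> by auto
      then have "cmod (w - \<zeta>) \<ge> d" using d(2)[of w] w(4) by (force simp: dist_norm)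
      then show "z \<in> (\<lambda>w. w + inverse w) ` {w. cmod w < 1 \<and> F w = 0 \<and> cmod (w - \<zeta>) \<ge> d}"
        using w by blast
    qed
    then show ?thesis by (rule finite_subset) (intro finite_imageI F_zeros_finite d(1))
  qed
  moreover have "\<exists>u\<in>ell2. u \<noteq> (\<lambda>_. 0) \<and> jacobi_op A B z u = (\<lambda>_. 0)" if "z \<in> Z" for z
  proof -
    obtain w where w: "w \<noteq> 0" "cmod w < 1" "F w = 0" "z = w + inverse w"
      using \<open>z \<in> Z\<close> by (auto simp: Z_def W_def)
    have M0: "M w = 0" using M_F w by simp
    have "(\<lambda>n. y n w) \<noteq> (\<lambda>_. 0)" using Y.y_nonzero[OF w(1,2), of N] by (auto simp: fun_eq_iff)
    then show ?thesis
      using Y.y_ell2[OF w(1,2) M0] Y.jac_y[OF w(1,2) M0] w(4) by blast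
  qed
  moreover have "\<exists>u. \<forall>v\<in>ell2. \<forall>k. (jacobi_op A B z ^^ k) v = (\<lambda>_. 0) \<longrightarrow>
      (\<exists>q. v = (\<lambda>n. q * u n)) \<and> (z \<notin> Z \<longrightarrow> v = (\<lambda>_. 0))"
    if z: "z \<notin> complex_of_real ` {-2..2}" for z
  proof -
    obtain w where w: "w \<noteq> 0" "cmod w < 1" "z = w + inverse w" by (rule inverse_joukowski[OF z])
    have MZ: "z \<notin> Z \<Longrightarrow> M w \<noteq> 0" using w M_F by (auto simp: Z_def W_def)
    show ?thesis
    proof (intro exI[of _ "\<lambda>n. y n w"] ballI allI impI)
      fix v k assume "v \<in> ell2" "(jacobi_op A B z ^^ k) v = (\<lambda>_. 0)"
      from Y.jac_root_vectors[OF w(1,2) simple[OF w(2)] this[unfolded w(3)]] MZ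
      show "(\<exists>q. v = (\<lambda>n. q * y n w)) \<and> (z \<notin> Z \<longrightarrow> v = (\<lambda>_. 0))" by blast
    qed
  qed
  ultimately have "discrete_block \<beta> (2 * Re \<zeta>) A B Z"
    unfolding discrete_block_def using sol(1-3) by (intro conjI) blast+
  then show ?thesis by blast
qed

end

section \<open>Direct sums of Jacobi matrices\<close>

lemma sum_fun_apply: "(\<Sum>i\<in>S. f i) n = (\<Sum>i\<in>S. f i n)"
  by (induction S rule: infinite_finite_induct) auto

locale block_sum =
  fixes p :: nat and A B :: "nat \<Rightarrow> nat \<Rightarrow> complex"
  assumes p: "p \<ge> 1"
begin

text \<open>The decomposition is \<open>n - 1 = p * (pos n - 1) + col n\<close>: residues count from
  0, positions from 1 like all matrix indices.\<close>

definition col :: "nat \<Rightarrow> nat" where "col n = (n - 1) mod p"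
definition pos :: "nat \<Rightarrow> nat" where "pos n = (n - 1) div p + 1"
definition idx :: "nat \<Rightarrow> nat \<Rightarrow> nat" where "idx q j = p * (j - 1) + q + 1"

definition D :: "nat \<Rightarrow> nat \<Rightarrow> complex"
  where "D i j = (if j = i + p then A (col i) (pos i) else if i = j + p then 1
    else if i = j then B (col i) (pos i) else 0)"

text \<open>The case \<open>j = 0\<close> is separate because truncated subtraction makes
  \<open>idx q 0\<close> equal to \<open>idx q 1\<close>.\<close>

definition part :: "nat \<Rightarrow> (nat \<Rightarrow> complex) \<Rightarrow> nat \<Rightarrow> complex"
  where "part q u j = (if j = 0 then 0 else u (idx q j))"

definition embed :: "nat \<Rightarrow> (nat \<Rightarrow> complex) \<Rightarrow> nat \<Rightarrow> complex"
  where "embed q v n = (if n = 0 \<or> col n \<noteq> q then 0 else v (pos n))"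

lemma pos_ge1: "pos n \<ge> 1" by (simp add: pos_def)

lemma col_less: "col n < p" using p by (simp add: col_def)

lemma idx_ge1: "idx q j \<ge> 1" by (simp add: idx_def)

lemma col_idx: "q < p \<Longrightarrow> col (idx q j) = q" by (simp add: col_def idx_def)

lemma pos_idx: "q < p \<Longrightarrow> j \<ge> 1 \<Longrightarrow> pos (idx q j) = j" by (simp add: pos_def idx_def)

lemma idx_col_pos: "n \<ge> 1 \<Longrightarrow> idx (col n) (pos n) = n"
  by (simp add: col_def pos_def idx_def)

lemma idx_Suc: "j \<ge> 1 \<Longrightarrow> idx q (Suc j) = idx q j + p"
  by (cases j) (simp_all add: idx_def algebra_simps)

lemma idx_nonzero [simp]: "idx q j \<noteq> 0" by (simp add: idx_def)

lemma idx_inj: "inj_on (idx q) {1..}"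
  using p by (auto simp: inj_on_def idx_def)

lemma D_banded:
  assumes "\<And>q j. q < p \<Longrightarrow> j \<ge> 1 \<Longrightarrow> A q j \<noteq> 0"
  shows "banded p D"
  unfolding banded_def D_def using assms[OF col_less pos_ge1] p by auto

lemma mat_apply_D:
  assumes "n \<ge> 1"
  shows "mat_apply D u n = (if n > p then u (n - p) else 0) + B (col n) (pos n) * u n + A (col n) (pos n) * u (n + p)"
proof -
  have "((\<lambda>j. D n j * u j) has_sum (\<Sum>j\<in>insert n (insert (n + p) (if n > p then {n - p} else {})). D n j * u j)) {1..}"
    by (rule has_sum_finite_neutralI) (use assms p in \<open>auto simp: D_def split: if_splits\<close>)
  moreover have "(\<Sum>j\<in>insert n (insert (n + p) (if n > p then {n - p} else {})). D n j * u j)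
      = (if n > p then u (n - p) else 0) + B (col n) (pos n) * u n + A (col n) (pos n) * u (n + p)"
    using assms p by (auto simp: D_def)
  ultimately show ?thesis using assms by (simp add: mat_apply_def infsumI)
qed

text \<open>The nonzero entries of \<open>D\<close> join only indices of one residue class, so
  \<open>part q\<close> intertwines \<open>D\<close> with the Jacobi matrix of that class.\<close>

lemma part_apply:
  assumes q: "q < p"
  shows "part q (mat_apply D u - cscale z u) = jacobi_op (A q) (B q) z (part q u)"
proof
  fix j
  show "part q (mat_apply D u - cscale z u) j = jacobi_op (A q) (B q) z (part q u) j"
  proof (cases "j = 0")
    case True
    then show ?thesis by (simp add: part_def jacobi_op_def)
  next
    case False
    then have j: "j \<ge> 1" by simp
    \<comment> \<open>For \<open>j = 1\<close> the neighbour \<open>idx q 1 - p\<close> falls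
      outside the index set, in agreement with the value 0 of \<open>part\<close> at 0.\<close>
    have pi: "(if idx q j > p then u (idx q j - p) else 0) = part q u (j - 1)"
    proof (cases "j = 1")
      case True
      then show ?thesis using q by (simp add: idx_def part_def)
    next
      case False
      then have "idx q j = idx q (j - 1) + p" using idx_Suc[of "j - 1" q] j by simp
      then show ?thesis using idx_ge1[of q "j - 1"] False j by (simp add: part_def)
    qed
    have "part q (mat_apply D u - cscale z u) j = mat_apply D u (idx q j) - z * u (idx q j)"
      using False by (simp add: part_def cscale_def)
    then show ?thesis
      using j False by (simp add: mat_apply_D[OF idx_ge1] pi col_idx[OF q] pos_idx[OF q] jacobi_op_def
          part_def[of q u j] part_def[of q u "Suc j"] idx_Suc)
  qed
qed

lemma part_ell2: "u \<in> ell2 \<Longrightarrow> part q u \<in> ell2"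
proof -
  assume u: "u \<in> ell2"
  then have s: "summable (\<lambda>n. (cmod (u n))\<^sup>2)" by (simp add: ell2_def)
  have "summable ((\<lambda>n. (cmod (u n))\<^sup>2) \<circ> (\<lambda>j. idx q (Suc j)))"
    by (rule summable_reindex[OF s]) (use p in \<open>auto simp: inj_def idx_def\<close>)
  then have "summable (\<lambda>j. (cmod (part q u (Suc j)))\<^sup>2)" by (simp add: part_def o_def)
  then have "summable (\<lambda>j. (cmod (part q u j))\<^sup>2)" by (subst (asm) summable_Suc_iff)
  then show ?thesis by (simp add: ell2_def part_def)
qed

lemma part_embed: "q < p \<Longrightarrow> v 0 = 0 \<Longrightarrow> part q (embed q v) = v"
  by (auto simp: part_def embed_def fun_eq_iff col_idx pos_idx)

lemma part_embed_other: "q < p \<Longrightarrow> r < p \<Longrightarrow> q \<noteq> r \<Longrightarrow> part r (embed q v) = (\<lambda>_. 0)"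
  by (auto simp: part_def embed_def fun_eq_iff col_idx)

lemma embed_0: "embed q v 0 = 0" by (simp add: embed_def)

lemma eq_by_parts:
  assumes "u 0 = v 0" "\<And>q. q < p \<Longrightarrow> part q u = part q v"
  shows "u = v"
proof
  fix n
  show "u n = v n"
  proof (cases "n = 0")
    case False
    then have n: "n \<ge> 1" by simp
    have "part (col n) u (pos n) = part (col n) v (pos n)" using assms(2)[OF col_less] by simp
    then show ?thesis using idx_col_pos[OF n] pos_ge1[of n] by (simp add: part_def)
  qed (use assms in simp)
qed

lemma decompose:
  assumes "u 0 = 0"
  shows "u = (\<Sum>q<p. embed q (part q u))"
proof (rule eq_by_parts)
  have ev: "(\<Sum>q<p. embed q (part q u)) n = (\<Sum>q<p. embed q (part q u) n)" for n
    by (rule sum_fun_apply)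
  show "u 0 = (\<Sum>q<p. embed q (part q u)) 0" by (simp add: ev embed_0 assms)
  fix r assume r: "r < p"
  show "part r u = part r (\<Sum>q<p. embed q (part q u))"
  proof
    fix j
    show "part r u j = part r (\<Sum>q<p. embed q (part q u)) j"
    proof (cases "j = 0")
      case False
      have "(\<Sum>q<p. embed q (part q u) (idx r j)) = (\<Sum>q<p. if q = r then part r u j else 0)"
        using r False by (intro sum.cong) (auto simp: embed_def part_def col_idx pos_idx)
      then show ?thesis using r False by (simp add: part_def[of r "sum _ _"] ev)
    qed (simp add: part_def)
  qed
qed

lemma embed_ell2:
  assumes q: "q < p" and v: "v \<in> ell2"
  shows "embed q v \<in> ell2"
proof -
  have s: "summable (\<lambda>n. (cmod (v n))\<^sup>2)" using v by (simp add: ell2_def)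
  then have "(\<lambda>n. (cmod (v n))\<^sup>2) summable_on UNIV"
    by (intro summable_nonneg_imp_summable_on) auto
  then have "(\<lambda>n. (cmod (v n))\<^sup>2) summable_on {1..}"
    by (rule summable_on_subset_banach) simp
  also have "?this \<longleftrightarrow> ((\<lambda>n. (cmod (embed q v n))\<^sup>2) \<circ> idx q) summable_on {1..}"
    by (rule summable_on_cong) (simp add: embed_def col_idx[OF q] pos_idx[OF q])
  also have "\<dots> \<longleftrightarrow> (\<lambda>n. (cmod (embed q v n))\<^sup>2) summable_on idx q ` {1..}"
    by (rule summable_on_reindex[OF idx_inj, symmetric])
  finally have "(\<lambda>n. (cmod (embed q v n))\<^sup>2) summable_on idx q ` {1..}" .
  then have "(\<lambda>n. (cmod (embed q v n))\<^sup>2) summable_on UNIV"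
  proof (subst (asm) summable_on_cong_neutral[where T = UNIV and g = "\<lambda>n. (cmod (embed q v n))\<^sup>2"])
    fix n assume "n \<in> UNIV - idx q ` {1..}"
    then have "n = 0 \<or> col n \<noteq> q" using idx_col_pos[of n] pos_ge1[of n] by (cases "n = 0") force+
    then show "(cmod (embed q v n))\<^sup>2 = 0" by (simp add: embed_def)
  qed auto
  then show ?thesis by (simp add: ell2_def embed_0 summable_on_imp_summable)
qed

abbreviation shifted :: "complex \<Rightarrow> (nat \<Rightarrow> complex) \<Rightarrow> nat \<Rightarrow> complex"
  where "shifted z \<equiv> \<lambda>v. mat_apply D v - cscale z v"

lemma part_op_pow:
  assumes q: "q < p"
  shows "part q ((shifted z ^^ k) u) = (jacobi_op (A q) (B q) z ^^ k) (part q u)"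
proof (induction k)
  case (Suc k)
  show ?case
    by (simp only: funpow.simps comp_apply part_apply[OF q] Suc)
qed simp

lemma eigenvalue_of_block:
  assumes q: "q < p" and u: "u \<in> ell2" "u \<noteq> (\<lambda>_. 0)" "jacobi_op (A q) (B q) z u = (\<lambda>_. 0)"
  shows "is_eigenvalue D z"
  unfolding is_eigenvalue_def
proof (intro bexI conjI)
  have u0: "u 0 = 0" using u by (simp add: ell2_def)
  show "embed q u \<in> ell2" by (rule embed_ell2[OF q u(1)])
  show "embed q u \<noteq> 0"
  proof
    assume "embed q u = 0"
    then have "part q (embed q u) = (\<lambda>_. 0)" by (simp add: part_def fun_eq_iff)
    then show False using u(2) part_embed[of q u, OF q u0] by simp
  qed
  have "shifted z (embed q u) = (\<lambda>_. 0)"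
  proof (rule eq_by_parts)
    show "shifted z (embed q u) 0 = 0" by (simp add: mat_apply_def cscale_def embed_0)
    fix r assume r: "r < p"
    have z0: "jacobi_op A' B' z (\<lambda>_. 0) = (\<lambda>_. 0)" for A' B' by (simp add: jacobi_op_def fun_eq_iff)
    have "part r (shifted z (embed q u)) = jacobi_op (A r) (B r) z (part r (embed q u))"
      by (rule part_apply[OF r])
    also have "\<dots> = (\<lambda>_. 0)"
      using part_embed[of q u, OF q u0] part_embed_other[OF q r] u(3) z0 by (cases "q = r") auto
    finally show "part r (shifted z (embed q u)) = part r (\<lambda>_. 0)" by (simp add: part_def fun_eq_iff)
  qed
  then show "mat_apply D (embed q u) = cscale z (embed q u)" by (simp add: fun_eq_iff)
qed

text \<open>The parts of a root vector are root vectors of the blocks, hence multiples of one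
  sequence per block. The root space has dimension at most \<open>p\<close>, even when blocks share
  the eigenvalue.\<close>

lemma finite_alg_mult_of_blocks:
  assumes "\<And>q. q < p \<Longrightarrow> \<exists>u. \<forall>v\<in>ell2. \<forall>k. (jacobi_op (A q) (B q) z ^^ k) v = (\<lambda>_. 0) \<longrightarrow> (\<exists>c. v = (\<lambda>n. c * u n))"
  shows "finite_alg_mult D z"
proof -
  obtain u where u: "\<And>q v k. q < p \<Longrightarrow> v \<in> ell2 \<Longrightarrow> (jacobi_op (A q) (B q) z ^^ k) v = (\<lambda>_. 0) \<Longrightarrow> \<exists>c. v = (\<lambda>n. c * u q n)"
    using assms by metis
  define S where "S = (\<lambda>q. embed q (u q)) ` {..<p}"
  have "root_space D z \<subseteq> cseq.span S"
  proof
    fix v assume "v \<in> root_space D z"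
    then obtain k where v: "v \<in> ell2" and k: "(shifted z ^^ k) v = 0" by (auto simp: root_space_def)
    have v0: "v 0 = 0" using v by (simp add: ell2_def)
    have "embed q (part q v) \<in> cseq.span S" if q: "q < p" for q
    proof -
      have "(jacobi_op (A q) (B q) z ^^ k) (part q v) = (\<lambda>_. 0)"
        unfolding part_op_pow[OF q, symmetric] k by (simp add: part_def fun_eq_iff)
      then obtain c where c: "part q v = (\<lambda>n. c * u q n)" using u[OF q part_ell2[OF v]] by blast
      have "embed q (part q v) = cscale c (embed q (u q))"
        unfolding c by (simp add: embed_def cscale_def fun_eq_iff)
      then show ?thesis using q by (simp add: S_def cseq.span_scale cseq.span_base)
    qed
    then have "(\<Sum>q<p. embed q (part q v)) \<in> cseq.span S" by (intro cseq.span_sum) auto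
    then show "v \<in> cseq.span S" using decompose[of v, OF v0] by simp
  qed
  then show ?thesis unfolding finite_alg_mult_def by (intro exI[of _ S]) (auto simp: S_def)
qed

lemma block_of_eigenvalue:
  assumes "is_eigenvalue D z"
  obtains q v where "q < p" "v \<in> ell2" "v \<noteq> (\<lambda>_. 0)" "jacobi_op (A q) (B q) z v = (\<lambda>_. 0)"
proof -
  obtain u where u: "u \<in> ell2" "u \<noteq> 0" "mat_apply D u = cscale z u"
    using assms by (auto simp: is_eigenvalue_def)
  have u0: "u 0 = 0" using u by (simp add: ell2_def)
  have "\<exists>q<p. part q u \<noteq> (\<lambda>_. 0)"
  proof (rule ccontr)
    assume n: "\<not> (\<exists>q<p. part q u \<noteq> (\<lambda>_. 0))"
    have "u = (\<lambda>_. 0)"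
    proof (rule eq_by_parts)
      fix q assume "q < p"
      then have "part q u = (\<lambda>_. 0)" using n by blast
      then show "part q u = part q (\<lambda>_. 0)" by (simp add: part_def fun_eq_iff)
    qed (rule u0)
    then show False using u(2) by (simp add: fun_eq_iff)
  qed
  then obtain q where q: "q < p" "part q u \<noteq> (\<lambda>_. 0)" by blast
  have "jacobi_op (A q) (B q) z (part q u) = part q (shifted z u)"
    by (rule part_apply[OF q(1), symmetric])
  also have "\<dots> = (\<lambda>_. 0)" using u(3) by (simp add: part_def fun_eq_iff)
  finally show ?thesis using that[OF q(1) part_ell2[OF u(1)] q(2)] by blast
qed

lemma defect_D:
  assumes "n \<ge> 1"
  shows "defect p D n = cmod (B (col n) (pos n)) + cmod (A (col n) (pos n) - 1)"
proof -
  \<comment> \<open>For \<open>n \<le> p\<close> the entry lies outside the matrix and is 1 by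
    convention; otherwise it is the constant subdiagonal.\<close>
  have 1: "ext_entry p D (int n) (int n - int p) = 1"
  proof (cases "n \<le> p")
    case False
    then have "nat (int n - int p) = n - p" by simp
    then show ?thesis using False p assms by (simp add: ext_entry_def D_def)
  qed (use assms in \<open>auto simp: ext_entry_def\<close>)
  have "nat (int n + int p) = n + p" by simp
  then have 2: "ext_entry p D (int n) (int n + int p) = A (col n) (pos n)"
    using assms by (simp add: ext_entry_def D_def)
  have 3: "ext_entry p D (int n) (int n + r) = (if r = 0 then B (col n) (pos n) else 0)"
    if r: "r \<in> {- int p + 1..int p - 1}" for r
  proof (cases "int n + r \<le> 0")
    case True
    then show ?thesis using r assms by (auto simp: ext_entry_def)
  next
    case False
    then have "ext_entry p D (int n) (int n + r) = D n (nat (int n + r))"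
      using assms by (auto simp: ext_entry_def min_def)
    also have "\<dots> = (if r = 0 then B (col n) (pos n) else 0)"
      using r False p by (auto simp: D_def)
    finally show ?thesis .
  qed
  have "(\<Sum>r\<in>{- int p + 1..int p - 1}. cmod (ext_entry p D (int n) (int n + r)))
      = (\<Sum>r\<in>{- int p + 1..int p - 1}. if r = 0 then cmod (B (col n) (pos n)) else 0)"
    by (rule sum.cong) (auto simp: 3)
  also have "\<dots> = cmod (B (col n) (pos n))" using p by simp
  finally show ?thesis unfolding defect_def 1 2 by simp
qed

text \<open>Passing from block index to matrix index costs a factor of at most \<open>p\<close>, so
  the exponent of the decay is preserved and only its constant changes.\<close>

lemma pos_ge: "n \<ge> 1 \<Longrightarrow> real (pos n) \<ge> real n / real p"
proof -
  assume n: "n \<ge> 1"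
  have "n = p * (pos n - 1) + col n + 1" using idx_col_pos[OF n] by (simp add: idx_def)
  then have "n \<le> p * pos n"
    using col_less[of n] pos_ge1[of n] by (cases "pos n") (auto simp: algebra_simps)
  then have "real n \<le> real p * real (pos n)" by (metis of_nat_le_iff of_nat_mult)
  then show ?thesis using p by (simp add: divide_le_eq mult.commute)
qed

end

section \<open>Direct sum over the residue classes and its accumulation points\<close>

theorem theorem1p3:
  fixes p :: nat and \<epsilon> :: real and \<nu> :: "nat \<Rightarrow> real"
  assumes "p \<ge> 1"
    and "0 < \<epsilon>" and "\<epsilon> < 1/2"
    and "\<And>j. j \<in> {1..p} \<Longrightarrow> \<nu> j \<in> {-2<..<2}"
  shows "\<exists>D \<in> P_class p (1/2 - \<epsilon>).
           infinite (discrete_spectrum D) \<and>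
           acc_set D = (\<lambda>j. complex_of_real (\<nu> j)) ` {1..p}"
proof -
  define \<beta> where "\<beta> = 1/2 - \<epsilon>"
  have \<beta>: "0 < \<beta>" "\<beta> < 1/2" using assms by (auto simp: \<beta>_def)
  let ?I = "complex_of_real ` {-2..2}"
  have "\<exists>A B Z. discrete_block \<beta> (\<nu> (Suc q)) A B Z" if q: "q < p" for q
  proof -
    define x where "x = \<nu> (Suc q)"
    have x: "- 2 < x" "x < 2" using assms(4)[of "Suc q"] q by (auto simp: x_def)
    \<comment> \<open>The point of the upper unit semicircle with \<open>2 * Re \<zeta> = x\<close>;
      it is not real because \<bar>x\<bar> < 2.\<close>
    define \<zeta> where "\<zeta> = Complex (x / 2) (sqrt (1 - (x / 2)\<^sup>2))"
    have "\<bar>x / 2\<bar> < 1" using x by simp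
    then have x1: "(x / 2)\<^sup>2 < 1" by (simp add: abs_square_less_1)
    interpret flat_function \<zeta> \<beta>
    proof
      show "cmod \<zeta> = 1" using x1 by (simp add: \<zeta>_def cmod_def)
      show "Im \<zeta> \<noteq> 0" using x1 by (simp add: \<zeta>_def)
    qed (use \<beta> in auto)
    have "2 * Re \<zeta> = \<nu> (Suc q)" by (simp add: \<zeta>_def x_def)
    then show ?thesis using discrete_block_exists by simp
  qed
  then obtain A B Z where G: "\<And>q. q < p \<Longrightarrow> discrete_block \<beta> (\<nu> (Suc q)) (A q) (B q) (Z q)" by metis
  note G' = G[unfolded discrete_block_def]
  interpret block_sum p A B by unfold_locales (rule assms(1))
  have A0: "A q j \<noteq> 0" if "q < p" "j \<ge> 1" for q j using G'[OF that(1)] that(2) by blast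
  have "\<exists>C. \<exists>c>0. \<forall>n\<ge>1. cmod (B q n) + cmod (A q n - 1) \<le> C * exp (- c * real n powr \<beta>)" if "q < p" for q
    using G'[OF that] by blast
  then obtain C c where c0: "\<And>q. q < p \<Longrightarrow> c q > 0"
    and dec: "\<And>q n. q < p \<Longrightarrow> n \<ge> 1 \<Longrightarrow> cmod (B q n) + cmod (A q n - 1) \<le> C q * exp (- c q * real n powr \<beta>)"
    by metis
  have Zinf: "infinite (Z q)" if "q < p" for q using G'[OF that] by blast
  have ZI: "Z q \<inter> ?I = {}" if "q < p" for q using G'[OF that] by blast
  have Zfin: "finite (Z q - U)" if "q < p" "open U" "complex_of_real (\<nu> (Suc q)) \<in> U" for q U
    using G'[OF that(1)] that(2,3) by blast
  have Zev: "\<exists>u\<in>ell2. u \<noteq> (\<lambda>_. 0) \<and> jacobi_op (A q) (B q) z u = (\<lambda>_. 0)" if "q < p" "z \<in> Z q" for q z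
    using G'[OF that(1)] that(2) by blast
  have root: "\<exists>u. \<forall>v\<in>ell2. \<forall>k. (jacobi_op (A q) (B q) z ^^ k) v = (\<lambda>_. 0) \<longrightarrow>
        (\<exists>q. v = (\<lambda>n. q * u n)) \<and> (z \<notin> Z q \<longrightarrow> v = (\<lambda>_. 0))" if "q < p" "z \<notin> ?I" for q z
    using G'[OF that(1)] that(2) by blast
  have "D \<in> P_class p \<beta>"
  proof -
    \<comment> \<open>The summand 1 makes the constant positive, as \<open>P_class\<close>
      demands.\<close>
    define C1 where "C1 = 1 + (\<Sum>q<p. \<bar>C q\<bar>)"
    define c1 where "c1 = Min (c ` {..<p})"
    have "0 \<in> {..<p}" using assms(1) by simp
    then have ne: "{..<p} \<noteq> {}" by blast
    have c1: "c1 > 0" unfolding c1_def using c0 ne by (subst Min_gr_iff) auto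
    define C2 where "C2 = c1 * (1 / real p) powr \<beta>"
    have "defect p D n \<le> C1 * exp (- C2 * real n powr \<beta>)" if n: "n \<ge> 1" for n
    proof -
      let ?q = "col n" and ?j = "pos n"
      have "defect p D n \<le> C ?q * exp (- c ?q * real ?j powr \<beta>)"
        unfolding defect_D[OF n] by (rule dec[OF col_less pos_ge1])
      also have "\<dots> \<le> C1 * exp (- C2 * real n powr \<beta>)"
      proof (intro mult_mono)
        have "\<bar>C ?q\<bar> \<le> (\<Sum>q<p. \<bar>C q\<bar>)" by (rule member_le_sum) (use col_less in auto)
        then show "C ?q \<le> C1" by (simp add: C1_def)
        show "0 \<le> C1" unfolding C1_def by (intro add_nonneg_nonneg sum_nonneg) auto
        have "c1 \<le> c ?q" unfolding c1_def by (rule Min_le) (use col_less in auto)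
        moreover have "(real n / real p) powr \<beta> \<le> real ?j powr \<beta>"
          using pos_ge[OF n] \<beta> by (intro powr_mono2) auto
        ultimately have "c1 * (real n / real p) powr \<beta> \<le> c ?q * real ?j powr \<beta>"
          using c1 by (intro mult_mono) auto
        moreover have "c1 * (real n / real p) powr \<beta> = C2 * real n powr \<beta>"
          by (simp add: C2_def powr_divide)
        ultimately show "exp (- c ?q * real ?j powr \<beta>) \<le> exp (- C2 * real n powr \<beta>)" by simp
      qed auto
      finally show ?thesis .
    qed
    moreover have "C1 > 0" unfolding C1_def by (intro add_pos_nonneg sum_nonneg) auto
    moreover have "C2 > 0" using c1 assms(1) by (simp add: C2_def)
    ultimately show ?thesis unfolding P_class_def using D_banded[OF A0] by blast
  qed
  moreover have spec: "discrete_spectrum D = (\<Union>q<p. Z q)"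
  proof (intro equalityI subsetI)
    fix z assume "z \<in> discrete_spectrum D"
    then have z: "z \<notin> ?I" "is_eigenvalue D z" by (auto simp: discrete_spectrum_def)
    obtain q v where q: "q < p" and v: "v \<in> ell2" "v \<noteq> (\<lambda>_. 0)" "jacobi_op (A q) (B q) z v = (\<lambda>_. 0)"
      by (rule block_of_eigenvalue[OF z(2)])
    have "(jacobi_op (A q) (B q) z ^^ 1) v = (\<lambda>_. 0)" using v(3) by simp
    then have "z \<in> Z q" using root[OF q z(1)] v(1,2) by blast
    then show "z \<in> (\<Union>q<p. Z q)" using q by blast
  next
    fix z assume "z \<in> (\<Union>q<p. Z q)"
    then obtain q where q: "q < p" "z \<in> Z q" by blast
    have z: "z \<notin> ?I" using ZI[OF q(1)] q(2) by blast
    obtain u where "u \<in> ell2" "u \<noteq> (\<lambda>_. 0)" "jacobi_op (A q) (B q) z u = (\<lambda>_. 0)" using Zev[OF q] by blast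
    then have "is_eigenvalue D z" by (rule eigenvalue_of_block[OF q(1)])
    moreover have "finite_alg_mult D z"
      by (rule finite_alg_mult_of_blocks) (use root[OF _ z] in blast)
    ultimately show "z \<in> discrete_spectrum D" using z by (simp add: discrete_spectrum_def)
  qed
  moreover have "infinite (\<Union>q<p. Z q)"
    using Zinf[of 0] assms(1) finite_subset[of "Z 0" "\<Union>q<p. Z q"] by auto
  moreover have "acc_set D = (\<lambda>j. complex_of_real (\<nu> j)) ` {1..p}"
  proof -
    let ?N = "(\<lambda>j. complex_of_real (\<nu> j)) ` {1..p}"
    have "z \<in> ?N" if z: "z islimpt (\<Union>q<p. Z q)" for z
    proof (rule ccontr)
      assume zN: "z \<notin> ?N"
      have "finite ?N" by simp
      then obtain d where d: "d > 0" "\<And>x. x \<in> ?N \<Longrightarrow> x \<noteq> z \<Longrightarrow> d \<le> dist z x"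
        using finite_set_avoid[of ?N z] by blast
      \<comment> \<open>A point within \<open>d / 2\<close> of \<open>z\<close> is further than
        \<open>d / 2\<close> from every prescribed point, and each block has only finitely many
        eigenvalues that far from its own.\<close>
      have "finite (ball z (d / 2) \<inter> (\<Union>q<p. Z q))"
      proof -
        have "finite (Z q - ball (complex_of_real (\<nu> (Suc q))) (d / 2))" if "q < p" for q
          using d(1) by (intro Zfin that) auto
        then have "finite (\<Union>q<p. Z q - ball (complex_of_real (\<nu> (Suc q))) (d / 2))" by blast
        moreover have "ball z (d / 2) \<inter> (\<Union>q<p. Z q) \<subseteq> (\<Union>q<p. Z q - ball (complex_of_real (\<nu> (Suc q))) (d / 2))"
        proof
          fix x assume "x \<in> ball z (d / 2) \<inter> (\<Union>q<p. Z q)"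
          then obtain q where x: "dist z x < d / 2" "q < p" "x \<in> Z q" by auto
          have n: "complex_of_real (\<nu> (Suc q)) \<in> ?N" using x(2) by auto
          then have "d \<le> dist z (complex_of_real (\<nu> (Suc q)))" using d(2) zN by blast
          also have "\<dots> \<le> dist z x + dist (complex_of_real (\<nu> (Suc q))) x" by (rule dist_triangle2)
          finally have "x \<notin> ball (complex_of_real (\<nu> (Suc q))) (d / 2)" using x(1) by simp
          then show "x \<in> (\<Union>q<p. Z q - ball (complex_of_real (\<nu> (Suc q))) (d / 2))" using x by blast
        qed
        ultimately show ?thesis by (rule rev_finite_subset)
      qed
      moreover have "infinite (ball z (d / 2) \<inter> (\<Union>q<p. Z q))"
        using z d(1) unfolding islimpt_eq_infinite_ball by (metis Int_commute half_gt_zero)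
      ultimately show False by simp
    qed
    moreover have "z islimpt (\<Union>q<p. Z q)" if zN: "z \<in> ?N" for z
    proof -
      obtain j where j: "j \<in> {1..p}" "z = complex_of_real (\<nu> j)" using zN by blast
      define q where "q = j - 1"
      have q: "q < p" "z = complex_of_real (\<nu> (Suc q))" using j by (auto simp: q_def)
      \<comment> \<open>\<open>Z q\<close> is infinite but finite outside each ball around the
        point, hence infinite inside; coinciding prescribed points do no harm.\<close>
      have "z islimpt Z q"
        unfolding islimpt_eq_infinite_ball
      proof (intro allI impI)
        fix e :: real assume "e > 0"
        then have "finite (Z q - ball z e)" using q by (intro Zfin) auto
        then show "infinite (Z q \<inter> ball z e)"
          using Zinf[OF q(1)] by (metis Diff_Diff_Int finite_Diff2)
      qed
      then show ?thesis by (rule islimpt_subset) (use q in blast)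
    qed
    ultimately show ?thesis unfolding acc_set_def spec by blast
  qed
  ultimately show ?thesis unfolding \<beta>_def by metis
qed

end
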